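(* Let $m\le n$. Suppose that $\mu\in\mathcal{W}_1(\mathbb{R}^n,\mathbb{R}^m)$ is absolutely continuous with respect to the Lebesgue measure on $\mathbb{R}^n$. Let $u\colon\mathbb{R}^n\to\mathbb{R}^m$ be an optimal potential of $\mu$. Then each of the following conditions implies the subsequent one: (i) there exists an optimal transport $\pi$ of $\mu$ such that $\mathrm{P}_1\|\pi\|$ is absolutely continuous with respect to $\|\mu\|$; (ii) there exists an optimal transport $\pi$ of $\mu$ (any $\pi$ as in (i) has this property) such that for any transport set $A$ associated with $u$: (a) $\pi|_{A\times A}\in\Gamma(\mu|_A)$ and $\pi|_{A\times A}$ is an optimal transport of $\mu|_A$; in particular $\mu(A)=0$; (b) $u$ is an optimal potential of $\mu|_A$; (iii) if $\{\|\mu\|_{\mathcal{S}}\mid\mathcal{S}\in CC(\mathbb{R}^n)\}$ is a disintegration of $\|\mu\|$ with respect to the map $\mathcal{S}\colon\mathbb{R}^n\to CC(\mathbb{R}^n)$ associated with $u$, and $\nu$ is the push-forward of $\|\mu\|$ by this map, then for $\nu$-almost every $\mathcal{S}\in CC(\mathbb{R}^n)$ $$\int_{\mathbb{R}^n}\frac{d\mu}{d\|\mu\|}\,d\|\mu\|_{\mathcal{S}}=0$$ and $u$ is an optimal potential of the measure $\frac{d\mu}{d\|\mu\|}\,d\|\mu\|_{\mathcal{S}}$.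
   Context: All norms on $\mathbb{R}^n,\mathbb{R}^m$ are Euclidean. For an $\mathbb{R}^m$-valued Borel measure $\mu$, $\|\mu\|$ denotes its total variation (a finite non-negative measure), and $\frac{d\mu}{d\|\mu\|}$ is the Radon–Nikodym density. $\mathcal{W}_1(\mathbb{R}^n,\mathbb{R}^m)$ is the space of $\mathbb{R}^m$-valued Borel measures $\mu$ on $\mathbb{R}^n$ with $\mu(\mathbb{R}^n)=0$ and $\int\|x-x_0\|\,d\|\mu\|(x)<\infty$ for some $x_0$. For an $\mathbb{R}^m$-valued measure (or a real-valued measure) $\pi$ on $\mathbb{R}^n\times\mathbb{R}^n$, $\mathrm{P}_1\pi(A)=\pi(A\times\mathbb{R}^n)$ and $\mathrm{P}_2\pi(A)=\pi(\mathbb{R}^n\times A)$. $\Gamma(\mu)$ is the set of $\mathbb{R}^m$-valued Borel measures $\pi$ on $\mathbb{R}^n\times\mathbb{R}^n$ with $\mathrm{P}_1\pi-\mathrm{P}_2\pi=\mu$, and $\|\mu\|_{\mathcal{W}_1}=\inf\{\int\|x-y\|\,d\|\pi\|(x,y)\mid\pi\in\Gamma(\mu)\}$. An optimal transport of $\mu$ is $\pi\in\Gamma(\mu)$ attaining this infimum. An optimal potential of $\mu$ is a $1$-Lipschitz map $u\colon\mathbb{R}^n\to\mathbb{R}^m$ attaining $\sup\{\int\langle v,d\mu\rangle\mid v\colon\mathbb{R}^n\to\mathbb{R}^m\ 1\text{-Lipschitz}\}$. A leaf of a $1$-Lipschitz map $u$ is a maximal (with respect to inclusion) set $\mathcal{S}\subset\mathbb{R}^n$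 such that $u|_{\mathcal{S}}$ preserves distances; leaves are closed and convex. $B(u)$ is the set of points belonging to at least two distinct leaves of $u$; it is contained in the Borel, Lebesgue-null set $N(u)$ of points of non-differentiability of $u$. A transport set associated with $u$ is a Borel set $A\subset\mathbb{R}^n$ such that if $x\in A\setminus B(u)$ and $y\in\mathbb{R}^n$ satisfy $\|u(x)-u(y)\|=\|x-y\|$, then $y\in A$. $CC(\mathbb{R}^n)$ is the set of non-empty closed convex subsets of $\mathbb{R}^n$ with the Wijsman topology (the weakest topology making $A\mapsto\mathrm{dist}(x,A)$ continuous for every $x$; it is Polish). The map $\mathcal{S}\colon\mathbb{R}^n\to CC(\mathbb{R}^n)$ associated with $u$ assigns to $x\notin N(u)$ the unique leaf of $u$ containing $x$, and $\mathcal{S}(x)=\{x\}$ for $x\in N(u)$; it is Borel measurable. A disintegration of a finite measure $\eta$ on $\mathbb{R}^n$ with respect to a Borel map $\mathcal{S}$, with $\nu$ the push-forward of $\eta$, is a family of Borel probability measures $\eta_{\mathcal{S}}$ on $\mathbb{R}^n$ such that for $\nu$-a.e. element the measure is concentrated on the preimage of that element under the map, and for every $\eta$-integrable $f$, $f$ is $\eta_{\mathcal{S}}$-integrable for $\nu$-a.e. $\mathcal{S}$, $\mathcal{S}\mapsto\int f\,d\eta_{\mathcal{S}}$ is $\nu$-measurable and $\int f\,d\eta=\int\int f\,d\eta_{\mathcal{S}}\,d\nu(\mathcal{S})$. *)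

theory Defs
  imports "HOL-Probability.Probability"
begin

text \<open>Vector measures are set functions of which only the values on Borel sets matter.
  Countable additivity forces the value on the empty set to be zero.\<close>

definition vector_measure :: "('a::topological_space set \<Rightarrow> 'b::real_normed_vector) \<Rightarrow> bool" where
  "vector_measure \<mu> \<longleftrightarrow>
    (\<forall>A::nat \<Rightarrow> 'a set. range A \<subseteq> sets borel \<and> disjoint_family A \<longrightarrow>
      (\<lambda>i. \<mu> (A i)) sums \<mu> (\<Union>i. A i))"

definition total_variation ::
  "('a::topological_space set \<Rightarrow> 'b::real_normed_vector) \<Rightarrow> 'a measure" where
  "total_variation \<mu> = measure_of UNIV (sets borel)
    (\<lambda>A. SUP E \<in> {E::nat \<Rightarrow> 'a set. range E \<subseteq> sets borel \<and> disjoint_family E \<and> (\<Union>i. E i) = A}.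
      \<Sum>i. ennreal (norm (\<mu> (E i))))"

definition vm_absolutely_continuous ::
  "'a measure \<Rightarrow> ('a set \<Rightarrow> 'b::real_normed_vector) \<Rightarrow> bool" where
  "vm_absolutely_continuous M \<mu> \<longleftrightarrow> (\<forall>A\<in>null_sets M. \<mu> A = 0)"

definition vm_restrict :: "('a set \<Rightarrow> 'b) \<Rightarrow> 'a set \<Rightarrow> 'a set \<Rightarrow> 'b" where
  "vm_restrict \<mu> A = (\<lambda>E. \<mu> (E \<inter> A))"

text \<open>The vector measure with density \<open>g\<close> with respect to \<open>M\<close>, and the vector-valued
  counterpart of \<^const>\<open>RN_deriv\<close>; the latter is determined up to \<open>M\<close>-null sets.\<close>

definition vm_density ::
  "'a measure \<Rightarrow> ('a \<Rightarrow> 'b::{banach, second_countable_topology}) \<Rightarrow> 'a set \<Rightarrow> 'b" where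
  "vm_density M g = (\<lambda>A. set_lebesgue_integral M A g)"

definition vm_RN_deriv ::
  "'a measure \<Rightarrow> ('a set \<Rightarrow> 'b::{banach, second_countable_topology}) \<Rightarrow> 'a \<Rightarrow> 'b" where
  "vm_RN_deriv M \<mu> = (SOME g. integrable M g \<and> (\<forall>A\<in>sets M. vm_density M g A = \<mu> A))"

abbreviation polar_density ::
  "('a::topological_space set \<Rightarrow> 'b::{banach, second_countable_topology}) \<Rightarrow> 'a \<Rightarrow> 'b" where
  "polar_density \<mu> \<equiv> vm_RN_deriv (total_variation \<mu>) \<mu>"

text \<open>The integral of \<open>\<langle>v, d\<mu>\<rangle>\<close>, by the polar decomposition of \<open>\<mu>\<close>.\<close>

definition vm_integral ::
  "('a::topological_space set \<Rightarrow> 'b::euclidean_space) \<Rightarrow> ('a \<Rightarrow> 'b) \<Rightarrow> real" where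
  "vm_integral \<mu> v = (\<integral>x. v x \<bullet> polar_density \<mu> x \<partial>total_variation \<mu>)"

definition W1_space :: "('a::euclidean_space set \<Rightarrow> 'b::euclidean_space) set" where
  "W1_space = {\<mu>. vector_measure \<mu> \<and> \<mu> UNIV = 0 \<and>
    (\<exists>x0. integrable (total_variation \<mu>) (\<lambda>x. norm (x - x0)))}"

definition transports ::
  "('a::euclidean_space set \<Rightarrow> 'b::euclidean_space) \<Rightarrow> (('a \<times> 'a) set \<Rightarrow> 'b) set" where
  "transports \<mu> = {\<pi>. vector_measure \<pi> \<and>
    (\<forall>A\<in>sets borel. \<pi> (A \<times> UNIV) - \<pi> (UNIV \<times> A) = \<mu> A)}"

definition transport_cost ::
  "(('a::euclidean_space \<times> 'a) set \<Rightarrow> 'b::euclidean_space) \<Rightarrow> ennreal" where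
  "transport_cost \<pi> = (\<integral>\<^sup>+ (x, y). ennreal (norm (x - y)) \<partial>total_variation \<pi>)"

text \<open>Optimal transports and optimal potentials are only considered for measures in
  \<open>W1_space\<close>: there the infimal cost is finite and all 1-Lipschitz maps are
  integrable, so no default value of an integral is involved.\<close>

definition optimal_transport ::
  "('a::euclidean_space set \<Rightarrow> 'b::euclidean_space) \<Rightarrow> (('a \<times> 'a) set \<Rightarrow> 'b) \<Rightarrow> bool" where
  "optimal_transport \<mu> \<pi> \<longleftrightarrow> \<mu> \<in> W1_space \<and>
    is_arg_min transport_cost (\<lambda>\<pi>'. \<pi>' \<in> transports \<mu>) \<pi>"

definition optimal_potential ::
  "('a::euclidean_space set \<Rightarrow> 'b::euclidean_space) \<Rightarrow> ('a \<Rightarrow> 'b) \<Rightarrow> bool" where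
  "optimal_potential \<mu> u \<longleftrightarrow> \<mu> \<in> W1_space \<and>
    is_arg_max (vm_integral \<mu>) (\<lambda>v. 1-lipschitz_on UNIV v) u"

definition preserves_dist :: "('a::metric_space \<Rightarrow> 'b::metric_space) \<Rightarrow> 'a set \<Rightarrow> bool" where
  "preserves_dist u S \<longleftrightarrow> (\<forall>x\<in>S. \<forall>y\<in>S. dist (u x) (u y) = dist x y)"

definition leaf :: "('a::metric_space \<Rightarrow> 'b::metric_space) \<Rightarrow> 'a set \<Rightarrow> bool" where
  "leaf u S \<longleftrightarrow> preserves_dist u S \<and> (\<forall>T. S \<subseteq> T \<and> preserves_dist u T \<longrightarrow> T = S)"

definition leaf_overlap :: "('a::metric_space \<Rightarrow> 'b::metric_space) \<Rightarrow> 'a set" where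
  "leaf_overlap u = {x. \<exists>S T. leaf u S \<and> leaf u T \<and> S \<noteq> T \<and> x \<in> S \<and> x \<in> T}"

definition nondiff_set :: "('a::real_normed_vector \<Rightarrow> 'b::real_normed_vector) \<Rightarrow> 'a set" where
  "nondiff_set u = {x. \<not> u differentiable (at x)}"

definition transport_set ::
  "('a::real_normed_vector \<Rightarrow> 'b::real_normed_vector) \<Rightarrow> 'a set \<Rightarrow> bool" where
  "transport_set u A \<longleftrightarrow> A \<in> sets borel \<and>
    (\<forall>x \<in> A - leaf_overlap u. \<forall>y. norm (u x - u y) = norm (x - y) \<longrightarrow> y \<in> A)"

text \<open>The description below is well defined for 1-Lipschitz \<open>u\<close>, because then
  \<open>leaf_overlap u \<subseteq> nondiff_set u\<close>.\<close>

definition leaf_map :: "('a::real_normed_vector \<Rightarrow> 'b::real_normed_vector) \<Rightarrow> 'a \<Rightarrow> 'a set" where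
  "leaf_map u x = (if x \<in> nondiff_set u then {x} else (THE S. leaf u S \<and> x \<in> S))"

definition closed_convex_sets :: "'a::euclidean_space set set" where
  "closed_convex_sets = {S. S \<noteq> {} \<and> closed S \<and> convex S}"

definition wijsman_topology :: "'a::euclidean_space set topology" where
  "wijsman_topology = topology_generated_by
    {{S \<in> closed_convex_sets. infdist x S \<in> U} | x U. open U}"

definition wijsman_borel :: "'a::euclidean_space set measure" where
  "wijsman_borel = sigma closed_convex_sets {U. openin wijsman_topology U}"

text \<open>The inner integrals need only be measurable with
  respect to the completion of the push-forward, since they are meaningful only almost
  everywhere.\<close>

definition disintegration ::
  "'a::topological_space measure \<Rightarrow> 'c measure \<Rightarrow> ('a \<Rightarrow> 'c) \<Rightarrow> ('c \<Rightarrow> 'a measure) \<Rightarrow> bool" where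
  "disintegration \<eta> N T \<kappa> \<longleftrightarrow>
    (\<forall>s\<in>space N. prob_space (\<kappa> s) \<and> sets (\<kappa> s) = sets borel) \<and>
    (AE s in distr \<eta> N T. AE x in \<kappa> s. T x = s) \<and>
    (\<forall>f::'a \<Rightarrow> real. integrable \<eta> f \<longrightarrow>
      (AE s in distr \<eta> N T. integrable (\<kappa> s) f) \<and>
      has_bochner_integral (completion (distr \<eta> N T)) (\<lambda>s. \<integral>x. f x \<partial>\<kappa> s) (\<integral>x. f x \<partial>\<eta>))"

definition localises_to_transport_sets ::
  "('a::euclidean_space set \<Rightarrow> 'b::euclidean_space) \<Rightarrow> ('a \<Rightarrow> 'b) \<Rightarrow> (('a \<times> 'a) set \<Rightarrow> 'b) \<Rightarrow> bool"
  where
  "localises_to_transport_sets \<mu> u \<pi> \<longleftrightarrow>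
    (\<forall>A. transport_set u A \<longrightarrow>
      vm_restrict \<pi> (A \<times> A) \<in> transports (vm_restrict \<mu> A) \<and>
      optimal_transport (vm_restrict \<mu> A) (vm_restrict \<pi> (A \<times> A)) \<and>
      \<mu> A = 0 \<and>
      optimal_potential (vm_restrict \<mu> A) u)"

definition localises_to_leaves ::
  "('a::euclidean_space set \<Rightarrow> 'b::euclidean_space) \<Rightarrow> ('a \<Rightarrow> 'b) \<Rightarrow> bool" where
  "localises_to_leaves \<mu> u \<longleftrightarrow>
    (\<forall>\<kappa>. disintegration (total_variation \<mu>) wijsman_borel (leaf_map u) \<kappa> \<longrightarrow>
      (AE S in distr (total_variation \<mu>) wijsman_borel (leaf_map u).
        integrable (\<kappa> S) (polar_density \<mu>) \<and>
        (\<integral>x. polar_density \<mu> x \<partial>\<kappa> S) = 0 \<and>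
        optimal_potential (vm_density (\<kappa> S) (polar_density \<mu>)) u))"

end

theory Submission
  imports Defs "HOL-Library.Function_Algebras"
begin

text \<open>Strong duality, obtained from the Hahn--Banach theorem for finite sums of dipoles and a discretisation
  of \<open>\<mu>\<close>, shows that an optimal transport \<open>\<pi>\<close> with polar density \<open>\<theta>\<close> satisfies
  \<open>u x - u y = \<bar>x - y\<bar> \<theta>(x, y)\<close> almost everywhere, so mass moves only inside leaves. The set \<open>N\<close> of
  non-differentiability is Lebesgue null, hence charged neither by \<open>\<mu>\<close> nor by the first marginal of the
  variation of \<open>\<pi>\<close>. The second marginal may charge \<open>N\<close>, but vanishes there as a vector measure, and such a
  cancellation at \<open>y\<close> forces the mass arriving at \<open>y\<close> to come from points whose leaves contain
  every leaf through \<open>y\<close>. Hence almost no mass arrives at a point of several leaves, almost every pair has either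
  both or no points in a given transport set, and restricting \<open>\<pi>\<close> preserves equality in the duality.

  For the disintegration, the union of the leaves in a Borel family is a transport set up to the overlap. Therefore
  the vanishing of \<open>\<mu>\<close> and the inequalities \<open>\<integral>\<langle>u - v, d\<mu>\<rangle> \<ge> 0\<close> on transport sets pass to almost every
  leaf, simultaneously for all \<open>v\<close> in a countable set dense with respect to pointwise convergence.\<close>

section \<open>Rademacher's theorem\<close>

text \<open>Only the first marginal of the variation of the transport is controlled, so targets
  inside the non-differentiability set \<open>N\<close> are the obstacle. For a pair (x, y) with y
  in \<open>N\<close> and direction \<open>\<theta>\<close>, expanding squares gives: defect of (x,
  w) = defect of (y, w) + 2 |x - y| times a term \<open>gap\<close>, linear in
  \<open>\<theta>\<close> and in the unit vector \<open>e\<close> from y to x. Choose w depending on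
  y with the defect of (y, w) nearly 0. Defects are non-negative, so \<open>gap\<close> is nearly
  non-negative; and \<open>\<theta>\<close> averages to 0 over the pairs ending at y, which leaves
  the average \<open>m y\<close> of \<open>e\<close> and yields
  \<open>(w - y) \<bullet> m y \<le> 0\<close>. Taking for w the sources x themselves and averaging
  shows that the square norm of \<open>m y\<close> is at most 0. Hence \<open>gap\<close> has mean 0
  too, so it vanishes, and x is isometric to every such w. The averages are made rigorous without
  disintegrating the transport: w runs through measurable choices from a dense sequence that are
  isometric to y up to 1/(j+1).\<close>

lemma ex_sum_measure:
  assumes "sets N = sets M"
  obtains P where "sets P = sets M"
    and "\<And>A. A \<in> sets M \<Longrightarrow> emeasure P A = emeasure M A + emeasure N A"
proof
  let ?P = "measure_of (space M) (sets M) (\<lambda>A. emeasure M A + emeasure N A)"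
  show "sets ?P = sets M"
    by simp
  show "emeasure ?P A = emeasure M A + emeasure N A" if "A \<in> sets M" for A
  proof (rule emeasure_measure_of_sigma)
    show "sigma_algebra (space M) (sets M)"
      by (rule sets.sigma_algebra_axioms)
    show "positive (sets M) (\<lambda>A. emeasure M A + emeasure N A)"
      by (simp add: positive_def)
    show "countably_additive (sets M) (\<lambda>A. emeasure M A + emeasure N A)"
    proof (rule countably_additiveI)
      fix A :: "nat \<Rightarrow> _"
      assume A: "range A \<subseteq> sets M" "disjoint_family A"
      then have "range A \<subseteq> sets N"
        using assms by simp
      with A show "(\<Sum>i. emeasure M (A i) + emeasure N (A i)) = emeasure M (\<Union> (range A)) + emeasure N (\<Union> (range A))"
        by (simp add: suminf_add[symmetric] suminf_emeasure)
    qed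
  qed (use that in auto)
qed

section \<open>Lipschitz functions of one variable\<close>

text \<open>The complement \<open>x - F x\<close> is monotone as well, and its Stieltjes measure
  together with that of \<open>F\<close> gives Lebesgue measure, because the lengths add up on open
  intervals.\<close>

lemma interval_measure_emeasure_le_lborel:
  fixes F :: "real \<Rightarrow> real"
  assumes mono: "\<And>x y. x \<le> y \<Longrightarrow> F x \<le> F y"
    and le: "\<And>x y. x \<le> y \<Longrightarrow> F y - F x \<le> y - x"
    and A: "A \<in> sets borel"
  shows "emeasure (interval_measure F) A \<le> emeasure lborel A"
proof -
  define G where "G = (\<lambda>x. x - F x)"
  have monoG: "G x \<le> G y" if "x \<le> y" for x y
    using le[OF that] by (simp add: G_def)
  have lip: "\<bar>F x - F y\<bar> \<le> \<bar>x - y\<bar>" for x y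
    using mono[of x y] mono[of y x] le[of x y] le[of y x] by linarith
  have contF: "continuous_on UNIV F"
    by (rule lipschitz_on_continuous_on[of 1])
       (use lip in \<open>auto intro!: lipschitz_onI simp: dist_real_def\<close>)
  then have contG: "continuous_on UNIV G"
    unfolding G_def by (intro continuous_intros)
  have Ioo: "emeasure (interval_measure H) {a<..<b} = ennreal (H b - H a)"
    if "a \<le> b" and monoH: "\<And>x y. x \<le> y \<Longrightarrow> H x \<le> H y" and contH: "continuous_on UNIV H"
    for a b and H :: "real \<Rightarrow> real"
  proof (cases "a = b")
    case False
    let ?M = "interval_measure H"
    have Icc: "emeasure ?M {x..y} = ennreal (H y - H x)" if "x \<le> y" for x y
      using emeasure_interval_measure_Icc[OF that monoH contH] .
    have "emeasure ?M {a} = 0" "emeasure ?M {b} = 0"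
      using Icc[of a a] Icc[of b b] by auto
    then have null: "{a, b} \<in> null_sets ?M"
      using null_sets.Un[of "{a}" ?M "{b}"] by (auto simp: null_sets_def insert_commute)
    have "{a<..<b} = {a..b} - {a, b}"
      by auto
    then have "emeasure ?M {a<..<b} = emeasure ?M {a..b}"
      by (simp only:) (rule emeasure_Diff_null_set[OF null], simp)
    then show ?thesis
      using Icc[OF that(1)] by simp
  qed simp
  obtain P where P: "sets P = sets borel"
    and emP: "\<And>A. A \<in> sets borel \<Longrightarrow>
      emeasure P A = emeasure (interval_measure F) A + emeasure (interval_measure G) A"
    using ex_sum_measure[of "interval_measure G" "interval_measure F"] by auto
  have "lborel = P"
  proof (rule lborel_eqI)
    fix a b :: real
    assume "\<And>i. i \<in> Basis \<Longrightarrow> a \<bullet> i \<le> b \<bullet> i"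
    then have ab: "a \<le> b"
      by simp
    have "emeasure P (box a b) = ennreal (F b - F a) + ennreal (G b - G a)"
      by (simp add: emP box_real Ioo ab mono monoG contF contG)
    also have "\<dots> = ennreal (b - a)"
      using mono[OF ab] monoG[OF ab] by (simp flip: ennreal_plus add: G_def)
    finally show "emeasure P (box a b) = (\<Prod>i\<in>Basis. (b - a) \<bullet> i)"
      by simp
  qed (rule P)
  then show ?thesis
    using emP[OF A] by simp
qed

text \<open>Domination by Lebesgue measure makes the Stieltjes measure of \<open>F\<close>
  absolutely continuous, so \<open>F\<close> is the indefinite integral of a Radon-Nikodym density,
  and Lebesgue differentiation applies.\<close>

lemma contraction_mono_differentiable_AE:
  fixes F :: "real \<Rightarrow> real"
  assumes mono: "\<And>x y. x \<le> y \<Longrightarrow> F x \<le> F y"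
    and le: "\<And>x y. x \<le> y \<Longrightarrow> F y - F x \<le> y - x"
  obtains N where "negligible N" "\<And>x. x \<notin> N \<Longrightarrow> F differentiable (at x)"
proof -
  have lip: "\<bar>F x - F y\<bar> \<le> \<bar>x - y\<bar>" for x y
    using mono[of x y] mono[of y x] le[of x y] le[of y x] by linarith
  have contF: "continuous_on UNIV F"
    by (rule lipschitz_on_continuous_on[of 1])
       (use lip in \<open>auto intro!: lipschitz_onI simp: dist_real_def\<close>)
  let ?M = "interval_measure F"
  have "absolutely_continuous lborel ?M"
    unfolding absolutely_continuous_def
  proof
    fix A :: "real set"
    assume "A \<in> null_sets lborel"
    then have "A \<in> sets borel" "emeasure lborel A = 0"
      by (auto simp: null_sets_def)
    with interval_measure_emeasure_le_lborel[OF mono le, of A] show "A \<in> null_sets ?M"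
      by (auto simp: null_sets_def)
  qed
  then obtain g0 where g0[measurable]: "g0 \<in> borel_measurable lborel" and dens: "density lborel g0 = ?M"
    using sigma_finite_measure.Radon_Nikodym[OF sigma_finite_lborel, of ?M] by auto
  define g where "g = (\<lambda>x. enn2real (g0 x))"
  have [measurable]: "g \<in> borel_measurable borel"
    using g0 unfolding g_def by measurable
  have Icc: "emeasure ?M {a..b} = ennreal (F b - F a)" if "a \<le> b" for a b
    using emeasure_interval_measure_Icc[OF that mono contF] .
  have nn: "(\<integral>\<^sup>+x\<in>{a..b}. g0 x \<partial>lborel) = ennreal (F b - F a)" if "a \<le> b" for a b
    using Icc[OF that] by (simp add: dens[symmetric] emeasure_density)
  have int: "(g has_integral (F b - F a)) {a..b}" if "a \<le> b" for a b
  proof -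
    have "(\<integral>\<^sup>+x\<in>{a..b}. g0 x \<partial>lborel) \<noteq> \<infinity>"
      using nn[OF that] by simp
    then have "AE x in lborel. g0 x * indicator {a..b} x \<noteq> \<infinity>"
      by (intro nn_integral_PInf_AE) auto
    then have AE: "AE x in lborel. ennreal (g x * indicator {a..b} x) = g0 x * indicator {a..b} x"
      by eventually_elim (auto simp: g_def indicator_def less_top)
    have "((\<lambda>x. g x * indicator {a..b} x) has_integral (F b - F a)) UNIV"
    proof (rule nn_integral_has_integral)
      show "(\<integral>\<^sup>+x. ennreal (g x * indicator {a..b} x) \<partial>lborel) = ennreal (F b - F a)"
        using nn_integral_cong_AE[OF AE] nn[OF that] by simp
    qed (use mono[OF that] in \<open>auto simp: g_def indicator_def\<close>)
    then have "((\<lambda>x. if x \<in> {a..b} then g x else 0) has_integral (F b - F a)) UNIV"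
      by (rule has_integral_eq[rotated]) auto
    then show ?thesis
      by (simp only: has_integral_restrict_UNIV)
  qed
  have "g integrable_on cbox a b" for a b
  proof (cases "a \<le> b")
    case True
    then show ?thesis using int[OF True] by (auto simp: integrable_on_def)
  qed auto
  then obtain N1 where N1: "negligible N1"
    and R: "\<And>x e. \<lbrakk>x \<notin> N1; 0 < e\<rbrakk> \<Longrightarrow> \<exists>d>0. \<forall>h. 0 < h \<and> h < d \<longrightarrow>
              norm (integral (cbox x (x + h *\<^sub>R One)) g /\<^sub>R h ^ DIM(real) - g x) < e"
    using integrable_ccontinuous_explicit[of g] by metis
  \<comment> \<open>Lebesgue differentiation is used for cubes with lowest corner \<open>x\<close>,
    which yields right difference quotients only; the left ones come from the reflected
    density.\<close>
  have int': "((\<lambda>x. g (- x)) has_integral (F (- a) - F (- b))) {a..b}" if "a \<le> b" for a b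
    using int[of "-b" "-a"] that has_integral_reflect_real[where f=g and a="-b" and b="-a"] by simp
  have "(\<lambda>x. g (- x)) integrable_on cbox a b" for a b
  proof (cases "a \<le> b")
    case True
    then show ?thesis using int'[OF True] by (auto simp: integrable_on_def)
  qed auto
  then obtain N2 where N2: "negligible N2"
    and L: "\<And>x e. \<lbrakk>x \<notin> N2; 0 < e\<rbrakk> \<Longrightarrow> \<exists>d>0. \<forall>h. 0 < h \<and> h < d \<longrightarrow>
              norm (integral (cbox x (x + h *\<^sub>R One)) (\<lambda>x. g (- x)) /\<^sub>R h ^ DIM(real) - g (- x)) < e"
    using integrable_ccontinuous_explicit[of "\<lambda>x. g (- x)"] by metis
  have "negligible (uminus ` N2)"
    using N2 by (intro negligible_differentiable_image_negligible)
       (auto simp: differentiable_on_def intro!: differentiable_minus differentiable_ident)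
  moreover have "F differentiable (at x)" if "x \<notin> N1 \<union> uminus ` N2" for x
  proof -
    have x: "x \<notin> N1" "- x \<notin> N2"
      using that by (auto simp: image_iff)
    have "((\<lambda>h. (F (x + h) - F x) / h) \<longlongrightarrow> g x) (at 0)"
    proof (rule LIM_I)
      fix e :: real assume "0 < e"
      obtain d1 where d1: "d1 > 0" "\<And>h. 0 < h \<Longrightarrow> h < d1 \<Longrightarrow> \<bar>(F (x + h) - F x) / h - g x\<bar> < e"
      proof -
        obtain d where "d > 0" and d: "\<And>h. 0 < h \<Longrightarrow> h < d \<Longrightarrow>
          norm (integral (cbox x (x + h *\<^sub>R One)) g /\<^sub>R h ^ DIM(real) - g x) < e"
          using R[OF x(1) \<open>0 < e\<close>] by blast
        have "\<bar>(F (x + h) - F x) / h - g x\<bar> < e" if "0 < h" "h < d" for h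
          using d[OF that] integral_unique[OF int[of x "x + h"]] that
          by (simp add: divide_inverse mult.commute)
        with \<open>d > 0\<close> show ?thesis by (rule that)
      qed
      obtain d2 where d2: "d2 > 0" "\<And>h. 0 < h \<Longrightarrow> h < d2 \<Longrightarrow> \<bar>(F x - F (x - h)) / h - g x\<bar> < e"
      proof -
        obtain d where "d > 0" and d: "\<And>h. 0 < h \<Longrightarrow> h < d \<Longrightarrow>
          norm (integral (cbox (- x) (- x + h *\<^sub>R One)) (\<lambda>x. g (- x)) /\<^sub>R h ^ DIM(real) - g (- (- x))) < e"
          using L[OF x(2) \<open>0 < e\<close>] by blast
        have "\<bar>(F x - F (x - h)) / h - g x\<bar> < e" if "0 < h" "h < d" for h
          using d[OF that] integral_unique[OF int'[of "- x" "- x + h"]] that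
          by (simp add: divide_inverse mult.commute)
        with \<open>d > 0\<close> show ?thesis by (rule that)
      qed
      have "norm ((F (x + h) - F x) / h - g x) < e" if "h \<noteq> 0" "norm (h - 0) < min d1 d2" for h
      proof (cases "h > 0")
        case True
        then show ?thesis using d1(2)[of h] that by simp
      next
        case False
        then have "\<bar>(F x - F (x - (- h))) / (- h) - g x\<bar> < e"
          using d2(2)[of "- h"] that by simp
        moreover have "(F x - F (x - (- h))) / (- h) = (F (x + h) - F x) / h"
          using that(1) by (simp add: field_simps)
        ultimately show ?thesis by (simp only: real_norm_def)
      qed
      then show "\<exists>s>0. \<forall>h. h \<noteq> 0 \<and> norm (h - 0) < s \<longrightarrow> norm ((F (x + h) - F x) / h - g x) < e"
        using d1(1) d2(1) by (intro exI[of _ "min d1 d2"]) auto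
    qed
    then have "(F has_field_derivative g x) (at x)"
      by (simp add: DERIV_def)
    then show ?thesis
      by (auto simp: real_differentiable_def)
  qed
  ultimately show ?thesis
    using N1 by (intro that[of "N1 \<union> uminus ` N2"]) auto
qed

text \<open>The mean of the identity and \<open>f / K\<close> is increasing with slopes at most 1.
  The constant \<open>K = L + 1\<close> stays positive for \<open>L = 0\<close>.\<close>

lemma lipschitz_real_differentiable_AE:
  fixes f :: "real \<Rightarrow> real"
  assumes "L-lipschitz_on UNIV f"
  obtains N where "negligible N" "\<And>x. x \<notin> N \<Longrightarrow> f differentiable (at x)"
proof -
  define K where "K = L + 1"
  have K: "K > 0"
    using lipschitz_on_nonneg[OF assms] by (simp add: K_def)
  have f: "\<bar>f x - f y\<bar> \<le> K * \<bar>x - y\<bar>" for x y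
    using lipschitz_onD[OF assms, of x y] by (simp add: dist_real_def K_def algebra_simps)
  define F where "F = (\<lambda>x. (x + f x / K) / 2)"
  have f': "\<bar>f y / K - f x / K\<bar> \<le> y - x" if "x \<le> y" for x y
    using f[of y x] that K by (simp add: field_simps abs_le_iff)
  have "F x \<le> F y" "F y - F x \<le> y - x" if "x \<le> y" for x y
    using f'[OF that] by (auto simp: F_def add_divide_distrib diff_divide_distrib abs_le_iff)
  then obtain N where N: "negligible N" "\<And>x. x \<notin> N \<Longrightarrow> F differentiable (at x)"
    by (rule contraction_mono_differentiable_AE) auto
  have "f = (\<lambda>x. K * (2 * F x - x))"
    using K by (auto simp: F_def field_simps)
  with N show ?thesis
    by (intro that[of N]) (auto intro!: differentiable_mult differentiable_diff differentiable_const differentiable_ident)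
qed

section \<open>Directional derivatives almost everywhere\<close>

text \<open>Quantified over all scales below \<open>d\<close> rather than in the limit: this makes
  the set closed for continuous \<open>f\<close>, and lets one scale serve all points of the set in
  the porosity argument.\<close>

definition directional_near :: "('a::euclidean_space \<Rightarrow> real) \<Rightarrow> 'a \<Rightarrow> real \<Rightarrow> real \<Rightarrow> real \<Rightarrow> 'a set" where
  "directional_near f v a d e = {x. \<forall>t. \<bar>t\<bar> < d \<longrightarrow> \<bar>f (x + t *\<^sub>R v) - f x - t * a\<bar> \<le> e * \<bar>t\<bar>}"

lemma closed_directional_near:
  assumes "continuous_on UNIV f"
  shows "closed (directional_near f v a d e)"
proof -
  have "continuous_on UNIV (\<lambda>x. f (x + t *\<^sub>R v))" for t
    by (rule continuous_on_compose2[OF assms]) (auto intro!: continuous_intros)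
  then have "closed {x. \<bar>f (x + t *\<^sub>R v) - f x - t * a\<bar> \<le> e * \<bar>t\<bar>}" for t
    using assms by (intro closed_Collect_le continuous_intros) auto
  then have "closed (\<Inter>t\<in>{t. \<bar>t\<bar> < d}. {x. \<bar>f (x + t *\<^sub>R v) - f x - t * a\<bar> \<le> e * \<bar>t\<bar>})"
    by blast
  then show ?thesis
    by (simp add: directional_near_def INTER_eq)
qed

text \<open>Rational slopes and scales \<open>1 / Suc j\<close> keep the set Borel; it contains all
  points at which the derivative along \<open>v\<close> exists.\<close>

definition directional_good :: "('a::euclidean_space \<Rightarrow> real) \<Rightarrow> 'a \<Rightarrow> 'a set" where
  "directional_good f v = (\<Inter>k::nat. \<Union>a\<in>\<rat>. \<Union>j::nat. directional_near f v a (1 / Suc j) (1 / Suc k))"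

lemma differentiable_imp_directional_good:
  fixes f :: "'a::euclidean_space \<Rightarrow> real"
  assumes "(\<lambda>t. f (x + t *\<^sub>R v)) differentiable (at s)"
  shows "x + s *\<^sub>R v \<in> directional_good f v"
  unfolding directional_good_def
proof (intro INT_I)
  fix k :: nat
  obtain D where "((\<lambda>t. f (x + t *\<^sub>R v)) has_real_derivative D) (at s)"
    using assms real_differentiable_def by blast
  then have D: "(\<lambda>h. (f (x + (s + h) *\<^sub>R v) - f (x + s *\<^sub>R v)) / h) \<midarrow>0\<rightarrow> D"
    by (simp add: DERIV_def)
  \<comment> \<open>Half of the tolerance \<open>1 / Suc k\<close> is spent on the difference
    quotient, half on replacing \<open>D\<close> by a rational slope.\<close>
  define e where "e = 1 / (2 * real (Suc k))"
  have e: "e > 0" by (simp add: e_def)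
  obtain d where d: "d > 0" and
    dh: "\<And>h. h \<noteq> 0 \<Longrightarrow> norm h < d \<Longrightarrow> \<bar>(f (x + (s + h) *\<^sub>R v) - f (x + s *\<^sub>R v)) / h - D\<bar> < e"
    using LIM_D[OF D e] by auto
  obtain a where a: "a \<in> \<rat>" "\<bar>a - D\<bar> < e"
    using Rats_dense_in_real[of "D - e" "D + e"] e by (auto simp: abs_less_iff field_simps)
  obtain j where j: "1 / real (Suc j) < d"
    using d nat_approx_posE by blast
  have "x + s *\<^sub>R v \<in> directional_near f v a (1 / Suc j) (1 / Suc k)"
    unfolding directional_near_def
  proof (intro CollectI allI impI)
    fix t :: real
    assume t: "\<bar>t\<bar> < 1 / Suc j"
    show "\<bar>f (x + s *\<^sub>R v + t *\<^sub>R v) - f (x + s *\<^sub>R v) - t * a\<bar> \<le> 1 / Suc k * \<bar>t\<bar>"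
    proof (cases "t = 0")
      case False
      let ?q = "(f (x + (s + t) *\<^sub>R v) - f (x + s *\<^sub>R v)) / t"
      have "\<bar>?q - D\<bar> < e"
        using dh[OF False] t j by simp
      with a have "\<bar>?q - a\<bar> \<le> 2 * e"
        by linarith
      then have "\<bar>?q - a\<bar> * \<bar>t\<bar> \<le> 2 * e * \<bar>t\<bar>"
        by (rule mult_right_mono) simp
      moreover have "\<bar>?q - a\<bar> * \<bar>t\<bar> = \<bar>f (x + (s + t) *\<^sub>R v) - f (x + s *\<^sub>R v) - t * a\<bar>"
        using False by (simp flip: abs_mult add: field_simps)
      moreover have "2 * e = 1 / Suc k"
        by (simp add: e_def field_simps)
      moreover have "x + (s + t) *\<^sub>R v = x + s *\<^sub>R v + t *\<^sub>R v"
        by (simp add: scaleR_left_distrib)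
      ultimately show ?thesis
        by (simp only:)
    qed simp
  qed
  with a(1) show "x + s *\<^sub>R v \<in> (\<Union>a\<in>\<rat>. \<Union>j. directional_near f v a (1 / Suc j) (1 / Suc k))"
    by blast
qed

text \<open>By Fubini: every line parallel to \<open>v\<close> meets the exceptional set in a null
  set, since \<open>f\<close> along that line is a Lipschitz function of one variable.\<close>

lemma directional_good_AE:
  fixes f :: "'a::euclidean_space \<Rightarrow> real"
  assumes L: "L-lipschitz_on UNIV f"
  shows "- directional_good f v \<in> null_sets lborel"
proof -
  let ?E = "- directional_good f v"
  have "closed (directional_near f v a d e)" for a d e
    by (rule closed_directional_near[OF lipschitz_on_continuous_on[OF L]])
  then have E[measurable]: "?E \<in> sets borel"
    unfolding directional_good_def
    by (intro borel_comp sets.countable_INT'' sets.countable_UN' countable_rat borel_closed) auto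
  have line: "(\<integral>\<^sup>+t. indicator ?E (x + t *\<^sub>R v) \<partial>lborel) = 0" for x
  proof -
    have "(L * norm v)-lipschitz_on UNIV (\<lambda>t. f (x + t *\<^sub>R v))"
    proof (rule lipschitz_onI)
      fix s t :: real
      have "dist (f (x + s *\<^sub>R v)) (f (x + t *\<^sub>R v)) \<le> L * dist (x + s *\<^sub>R v) (x + t *\<^sub>R v)"
        by (rule lipschitz_onD[OF L]) auto
      also have "dist (x + s *\<^sub>R v) (x + t *\<^sub>R v) = norm v * dist s t"
        by (simp add: dist_norm dist_real_def mult.commute flip: scaleR_diff_left)
      finally show "dist (f (x + s *\<^sub>R v)) (f (x + t *\<^sub>R v)) \<le> L * norm v * dist s t"
        by (simp add: mult_ac)
    qed (use lipschitz_on_nonneg[OF L] in auto)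
    then obtain N where N: "negligible N" "\<And>t. t \<notin> N \<Longrightarrow> (\<lambda>t. f (x + t *\<^sub>R v)) differentiable (at t)"
      using lipschitz_real_differentiable_AE by blast
    have sub: "{t. x + t *\<^sub>R v \<in> ?E} \<subseteq> N"
      using N(2) differentiable_imp_directional_good by blast
    have "{t. x + t *\<^sub>R v \<in> ?E} \<in> sets borel"
      by measurable
    moreover have "negligible {t. x + t *\<^sub>R v \<in> ?E}"
      using N(1) sub negligible_subset by blast
    ultimately have "{t. x + t *\<^sub>R v \<in> ?E} \<in> null_sets lborel"
      by (simp add: negligible_iff_null_sets null_sets_completion_iff)
    then have "{t. x + t *\<^sub>R v \<in> ?E} \<in> sets lborel" "emeasure lborel {t. x + t *\<^sub>R v \<in> ?E} = 0"
      by auto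
    then have "(\<integral>\<^sup>+t. indicator {t. x + t *\<^sub>R v \<in> ?E} t \<partial>lborel) = 0"
      by (simp only: nn_integral_indicator)
    moreover have "(\<integral>\<^sup>+t. indicator ?E (x + t *\<^sub>R v) \<partial>lborel) = (\<integral>\<^sup>+t. indicator {t. x + t *\<^sub>R v \<in> ?E} t \<partial>lborel)"
      by (intro nn_integral_cong) (auto simp: indicator_def)
    ultimately show ?thesis
      by (simp only:)
  qed
  \<comment> \<open>The measure of \<open>?E\<close> is the average over \<open>t \<in> [0,1]\<close> of the measures of its translates by \<open>t v\<close>.\<close>
  have shift: "(\<integral>\<^sup>+x. indicator ?E (x + t *\<^sub>R v) \<partial>lborel) = emeasure lborel ?E" for t
  proof -
    have "(\<integral>\<^sup>+x. indicator ?E x \<partial>lborel) = (\<integral>\<^sup>+x. indicator ?E x \<partial>distr lborel borel ((+) (t *\<^sub>R v)))"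
      by (simp add: lborel_distr_plus)
    also have "\<dots> = (\<integral>\<^sup>+x. indicator ?E (t *\<^sub>R v + x) \<partial>lborel)"
      by (rule nn_integral_distr) auto
    finally show ?thesis
      by (simp add: add.commute)
  qed
  have "emeasure lborel ?E = (\<integral>\<^sup>+t\<in>{0..1::real}. emeasure lborel ?E \<partial>lborel)"
    by (simp add: nn_integral_cmult_indicator)
  also have "\<dots> = (\<integral>\<^sup>+t. (\<integral>\<^sup>+x. indicator ?E (x + t *\<^sub>R v) * indicator {0..1} t \<partial>lborel) \<partial>lborel)"
    by (simp add: nn_integral_multc shift)
  also have "\<dots> = (\<integral>\<^sup>+x. (\<integral>\<^sup>+t. indicator ?E (x + t *\<^sub>R v) * indicator {0..1} t \<partial>lborel) \<partial>lborel)"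
    by (rule lborel_pair.Fubini') measurable
  also have "\<dots> \<le> (\<integral>\<^sup>+x. (\<integral>\<^sup>+t. indicator ?E (x + t *\<^sub>R v) \<partial>lborel) \<partial>lborel)"
    by (intro nn_integral_mono) (auto simp: indicator_def)
  also have "\<dots> = 0"
    by (simp add: line)
  finally show ?thesis
    using E by (auto simp: null_sets_def)
qed

section \<open>Porous sets, and the step from partial derivatives to the full derivative\<close>

text \<open>At arbitrarily small scales around each of its points the set misses a fixed proportion
  of a ball. A Vitali cover by such balls, inside an open set barely larger than a bounded piece
  \<open>T\<close> of positive measure, would give \<open>T\<close> less measure than it
  has.\<close>

lemma porous_imp_null:
  fixes S :: "'a::euclidean_space set"
  assumes S: "S \<in> sets borel" and \<eta>: "0 < \<eta>"
    and por: "\<And>x d. x \<in> S \<Longrightarrow> 0 < d \<Longrightarrow>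
      \<exists>r p. 0 < r \<and> r < d \<and> ball p (\<eta> * r) \<subseteq> ball x r \<and> ball p (\<eta> * r) \<inter> S = {}"
  shows "S \<in> null_sets lborel"
proof (rule ccontr)
  assume "S \<notin> null_sets lborel"
  then have pos: "emeasure lborel S \<noteq> 0"
    using S by (auto simp: null_sets_def)
  have "S = (\<Union>k::nat. S \<inter> ball 0 k)"
    using real_arch_simple reals_Archimedean2 by (auto simp: dist_norm)
  moreover have "(\<Union>k::nat. S \<inter> ball 0 k) \<in> null_sets lborel" if "\<And>k::nat. S \<inter> ball 0 k \<in> null_sets lborel"
    using that by (intro null_sets_UN) auto
  ultimately obtain k :: nat where k: "S \<inter> ball 0 k \<notin> null_sets lborel"
    using \<open>S \<notin> null_sets lborel\<close> by metis
  define T where "T = S \<inter> ball 0 (real k)"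
  have T: "T \<in> sets borel" "T \<subseteq> S" "emeasure lborel T \<noteq> 0"
    using k S by (auto simp: T_def null_sets_def)
  have Tfin: "emeasure lborel T < \<infinity>"
  proof -
    have "emeasure lborel T \<le> emeasure lborel (ball 0 (real k) :: 'a set)"
      by (rule emeasure_mono) (auto simp: T_def)
    also have "\<dots> < \<infinity>"
      by (simp add: emeasure_ball)
    finally show ?thesis .
  qed
  define m where "m = measure lborel T"
  have m: "emeasure lborel T = ennreal m" "m > 0"
  proof -
    show *: "emeasure lborel T = ennreal m"
      unfolding m_def using Tfin by (intro emeasure_eq_ennreal_measure) auto
    show "m > 0"
      using T(3) unfolding * by (simp add: ennreal_eq_0_iff not_le)
  qed
  \<comment> \<open>A hole of radius \<open>\<eta> * r\<close> removes the fraction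
    \<open>\<eta> ^ DIM('a)\<close> from a ball of radius \<open>r\<close>; the minimum with 1 keeps
    \<open>c\<close> non-negative.\<close>
  define c where "c = 1 - min 1 \<eta> ^ DIM('a)"
  have c: "0 \<le> c" "c < 1"
    using \<eta> by (auto simp: c_def intro!: power_le_one)
  have hole: "emeasure lborel (T \<inter> ball x r) \<le> ennreal c * emeasure lborel (ball x r)"
    if "0 < r" "ball p (\<eta> * r) \<subseteq> ball x r" "ball p (\<eta> * r) \<inter> S = {}" for x p r
  proof -
    let ?\<eta> = "min 1 \<eta>"
    have sub: "ball p (?\<eta> * r) \<subseteq> ball p (\<eta> * r)"
      using that(1) by (intro subset_ball mult_right_mono) auto
    have "emeasure lborel (T \<inter> ball x r) \<le> emeasure lborel (ball x r - ball p (?\<eta> * r))"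
      using that(3) T(2) sub by (intro emeasure_mono) auto
    also have "\<dots> = emeasure lborel (ball x r) - emeasure lborel (ball p (?\<eta> * r))"
      using that(2) sub by (intro emeasure_Diff) (auto simp: emeasure_ball \<eta> that(1) less_imp_le)
    also have "\<dots> = ennreal (unit_ball_vol DIM('a) * r ^ DIM('a) - unit_ball_vol DIM('a) * (?\<eta> * r) ^ DIM('a))"
      using that(1) \<eta> by (simp add: emeasure_ball ennreal_minus)
    also have "\<dots> = ennreal (c * (unit_ball_vol DIM('a) * r ^ DIM('a)))"
      by (simp add: c_def algebra_simps power_mult_distrib)
    also have "\<dots> = ennreal c * emeasure lborel (ball x r)"
      using c that(1) by (simp add: emeasure_ball ennreal_mult)
    finally show ?thesis .
  qed
  \<comment> \<open>The measure by which \<open>U\<close> may exceed \<open>T\<close>, chosen so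
    that \<open>c * (m + e) < m\<close>.\<close>
  define e where "e = m * (1 - c) / 2"
  have e: "e > 0" using m c by (simp add: e_def)
  have "T \<in> sets lebesgue" using T by auto
  then obtain U where U: "open U" "T \<subseteq> U" "(U - T) \<in> lmeasurable" "emeasure lebesgue (U - T) < ennreal e"
    using sets_lebesgue_outer_open[OF _ e] by blast
  let ?K = "{(x, r). 0 < r \<and> ball x r \<subseteq> U \<and> emeasure lborel (T \<inter> ball x r) \<le> ennreal c * emeasure lborel (ball x r)}"
  have V: "\<exists>i. i \<in> ?K \<and> x \<in> ball (fst i) (snd i) \<and> snd i < d" if xd: "x \<in> T" "0 < d" for x d
  proof -
    obtain d' where d': "d' > 0" "ball x d' \<subseteq> U"
      using openE[OF U(1), of x] U(2) xd(1) by auto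
    obtain r p where r: "0 < r" "r < min d d'" "ball p (\<eta> * r) \<subseteq> ball x r" "ball p (\<eta> * r) \<inter> S = {}"
      using por[of x "min d d'"] xd T(2) d'(1) by auto
    moreover have "ball x r \<subseteq> U"
      using d' r(2) subset_ball[of r d' x] by auto
    ultimately have "(x, r) \<in> ?K"
      using hole[of r p x] by auto
    with r show ?thesis
      by (intro exI[of _ "(x, r)"]) auto
  qed
  obtain C where C: "countable C" "C \<subseteq> ?K"
    "pairwise (\<lambda>i j. disjnt (ball (fst i) (snd i)) (ball (fst j) (snd j))) C"
    "negligible (T - (\<Union>i\<in>C. ball (fst i) (snd i)))"
    by (rule Vitali_covering_theorem_balls[OF V])
  let ?B = "\<lambda>i::'a \<times> real. ball (fst i) (snd i)"
  have disj: "disjoint_family_on ?B C"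
    using C(3) by (auto simp: disjoint_family_on_def pairwise_def disjnt_def)
  have null: "T - (\<Union>i\<in>C. ?B i) \<in> null_sets lborel"
  proof -
    have "(\<Union>i\<in>C. ?B i) \<in> sets borel"
      by (intro borel_open open_UN) auto
    then have "T - (\<Union>i\<in>C. ?B i) \<in> sets borel"
      using T(1) by auto
    with C(4) show ?thesis
      by (auto simp: null_sets_completion_iff negligible_iff_null_sets)
  qed
  have "emeasure lborel T \<le> emeasure lborel ((\<Union>i\<in>C. T \<inter> ?B i) \<union> (T - (\<Union>i\<in>C. ?B i)))"
    using T(1) null C(1) by (intro emeasure_mono sets.Un sets.countable_UN') (auto simp: null_sets_def)
  also have "\<dots> = emeasure lborel (\<Union>i\<in>C. T \<inter> ?B i)"
    using T(1) C(1) by (intro emeasure_Un_null_set[OF _ null] sets.countable_UN') auto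
  also have "\<dots> = (\<integral>\<^sup>+i. emeasure lborel (T \<inter> ?B i) \<partial>count_space C)"
  proof (rule emeasure_UN_countable)
    show "disjoint_family_on (\<lambda>i. T \<inter> ?B i) C"
      using disj unfolding disjoint_family_on_def by blast
  qed (use T(1) C(1) in auto)
  also have "\<dots> \<le> (\<integral>\<^sup>+i. ennreal c * emeasure lborel (?B i) \<partial>count_space C)"
    using C(2) by (intro nn_integral_mono) auto
  also have "\<dots> = ennreal c * (\<integral>\<^sup>+i. emeasure lborel (?B i) \<partial>count_space C)"
    by (intro nn_integral_cmult) auto
  also have "(\<integral>\<^sup>+i. emeasure lborel (?B i) \<partial>count_space C) = emeasure lborel (\<Union>i\<in>C. ?B i)"
    using C(1) disj by (intro emeasure_UN_countable[symmetric]) auto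
  also have "\<dots> \<le> emeasure lborel (T \<union> (U - T))"
  proof (rule emeasure_mono)
    have "?B i \<subseteq> U" if "i \<in> C" for i
      using subsetD[OF C(2) that] by (simp add: case_prod_beta)
    then show "(\<Union>i\<in>C. ?B i) \<subseteq> T \<union> (U - T)"
      by blast
  qed (use U(1) T(1) in auto)
  also have "\<dots> \<le> emeasure lborel T + emeasure lborel (U - T)"
    using U(1) T(1) by (intro emeasure_subadditive) auto
  also have "emeasure lborel (U - T) \<le> ennreal e"
    using U(1,4) T(1) by (simp add: less_imp_le)
  finally have "ennreal m \<le> ennreal c * (ennreal m + ennreal e)"
    using m(1) by (simp add: mult_left_mono add_left_mono)
  then have "m \<le> c * (m + e)"
    using m c e by (simp flip: ennreal_plus ennreal_mult)
  also have "\<dots> = m * (1 - (1 - c)) + c * e"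
    by (simp add: algebra_simps)
  also have "\<dots> \<le> m * (1 - (1 - c)) + e"
    using c e by (simp add: mult_left_le_one_le)
  also have "\<dots> < m"
    using mult_strict_right_mono[of c 1 m] m c by (simp add: e_def field_simps)
  finally show False by simp
qed

definition near_linear :: "('a::euclidean_space \<Rightarrow> real) \<Rightarrow> 'a \<Rightarrow> real \<Rightarrow> real \<Rightarrow> 'a set" where
  "near_linear f a d e = {x. \<forall>h. norm h < d \<longrightarrow> \<bar>f (x + h) - f x - a \<bullet> h\<bar> \<le> e * norm h}"

lemma closed_near_linear:
  assumes "continuous_on UNIV f"
  shows "closed (near_linear f a d e)"
proof -
  have cont: "continuous_on UNIV (\<lambda>x. f (x + h))" for h
    by (rule continuous_on_compose2[OF assms]) (auto intro!: continuous_intros)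
  have "closed {x. \<bar>f (x + h) - f x - a \<bullet> h\<bar> \<le> e * norm h}" for h
    by (intro closed_Collect_le continuous_intros cont assms)
  then have "closed (\<Inter>h\<in>{h. norm h < d}. {x. \<bar>f (x + h) - f x - a \<bullet> h\<bar> \<le> e * norm h})"
    by blast
  then show ?thesis
    by (simp add: near_linear_def INTER_eq)
qed

text \<open>The approximate gradients \<open>a k\<close> form a Cauchy sequence: for a short vector
  along \<open>a k - a l\<close> both linear approximations hold, so they differ by at most the sum
  of the two errors. The limit is the gradient.\<close>

lemma near_linear_imp_differentiable:
  fixes f :: "'a::euclidean_space \<Rightarrow> real"
  assumes "\<And>k::nat. \<exists>a. \<exists>j::nat. x \<in> near_linear f a (1 / Suc j) (1 / Suc k)"
  shows "f differentiable (at x)"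
proof -
  obtain a j where aj: "\<And>k::nat. x \<in> near_linear f (a k) (1 / Suc (j k)) (1 / Suc k)"
    using assms by metis
  have near: "\<bar>f (x + h) - f x - a k \<bullet> h\<bar> \<le> norm h / Suc k" if "norm h < 1 / Suc (j k)" for h k
    using aj[of k] that by (simp add: near_linear_def)
  have diff: "norm (a k - a l) \<le> 1 / Suc k + 1 / Suc l" for k l
  proof (cases "a k = a l")
    case False
    define v where "v = a k - a l"
    \<comment> \<open>Half the smaller of the two scales, so that both approximations apply to
      \<open>h\<close>.\<close>
    define d where "d = min (1 / Suc (j k)) (1 / Suc (j l)) / 2"
    define h where "h = (d / norm v) *\<^sub>R v"
    have d: "d > 0" by (simp add: d_def)
    have v: "norm v > 0" using False by (simp add: v_def)
    have nh: "norm h = d"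
      using v d by (simp add: h_def)
    have "d < 1 / Suc (j k)" "d < 1 / Suc (j l)"
      using d unfolding d_def by (auto simp: min_def field_simps)
    then have "\<bar>f (x + h) - f x - a k \<bullet> h\<bar> \<le> d / Suc k" "\<bar>f (x + h) - f x - a l \<bullet> h\<bar> \<le> d / Suc l"
      using near[of h k] near[of h l] nh by auto
    then have "v \<bullet> h \<le> d / Suc k + d / Suc l"
      unfolding v_def inner_diff_left by linarith
    moreover have "v \<bullet> h = d * norm v"
      using v by (simp add: h_def power2_norm_eq_inner[symmetric] power2_eq_square)
    ultimately have "d * norm v \<le> d * (1 / Suc k + 1 / Suc l)"
      by (simp add: algebra_simps)
    then show ?thesis
      using d by (simp add: v_def)
  qed simp
  have "Cauchy a"
  proof (rule metric_CauchyI)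
    fix e :: real assume "e > 0"
    then obtain M where M: "1 / real (Suc M) < e / 2"
      using nat_approx_posE[of "e / 2"] by auto
    have "dist (a k) (a l) < e" if "k \<ge> M" "l \<ge> M" for k l
    proof -
      have "1 / real (Suc k) \<le> 1 / Suc M" "1 / real (Suc l) \<le> 1 / Suc M"
        using that by (auto simp: field_simps)
      then show ?thesis
        using diff[of k l] M by (simp add: dist_norm)
    qed
    then show "\<exists>M. \<forall>k\<ge>M. \<forall>l\<ge>M. dist (a k) (a l) < e"
      by blast
  qed
  then obtain A where A: "a \<longlonglongrightarrow> A"
    using Cauchy_convergent_iff convergent_def by blast
  have lim: "norm (a k - A) \<le> 1 / Suc k" for k
  proof (rule LIMSEQ_le)
    show "(\<lambda>l. norm (a k - a l)) \<longlonglongrightarrow> norm (a k - A)"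
      by (intro tendsto_intros A)
    have "(\<lambda>l. 1 / Suc k + 1 / Suc l) \<longlonglongrightarrow> 1 / Suc k + 0"
      using LIMSEQ_inverse_real_of_nat by (intro tendsto_intros) (simp add: inverse_eq_divide)
    then show "(\<lambda>l. 1 / Suc k + 1 / Suc l) \<longlonglongrightarrow> 1 / Suc k"
      by simp
  qed (use diff in auto)
  have "(f has_derivative (\<lambda>h. A \<bullet> h)) (at x)"
    unfolding has_derivative_at_alt
  proof (intro conjI allI impI)
    fix e :: real assume "e > 0"
    then obtain k where k: "1 / real (Suc k) < e / 2"
      using nat_approx_posE[of "e / 2"] by auto
    have "norm (f y - f x - A \<bullet> (y - x)) \<le> e * norm (y - x)" if y: "norm (y - x) < 1 / Suc (j k)" for y
    proof -
      have "\<bar>f y - f x - a k \<bullet> (y - x)\<bar> \<le> norm (y - x) / Suc k"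
        using near[OF y] by simp
      moreover have "\<bar>(a k - A) \<bullet> (y - x)\<bar> \<le> 1 / Suc k * norm (y - x)"
        using Cauchy_Schwarz_ineq2[of "a k - A" "y - x"] lim[of k]
        by (meson mult_right_mono norm_ge_zero order_trans)
      ultimately have "\<bar>f y - f x - A \<bullet> (y - x)\<bar> \<le> 2 * (1 / Suc k) * norm (y - x)"
        by (simp add: inner_diff_left)
      also have "\<dots> \<le> e * norm (y - x)"
        using k by (intro mult_right_mono) auto
      finally show ?thesis by simp
    qed
    then show "\<exists>d>0. \<forall>y. norm (y - x) < d \<longrightarrow> norm (f y - f x - A \<bullet> (y - x)) \<le> e * norm (y - x)"
      by (intro exI[of _ "1 / Suc (j k)"]) auto
  qed (rule bounded_linear_inner_right)
  then show ?thesis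
    by (rule differentiableI)
qed

lemma differentiable_imp_near_linear:
  fixes f :: "'a::euclidean_space \<Rightarrow> real"
  assumes "f differentiable (at x)" and Q: "\<And>x e. 0 < e \<Longrightarrow> \<exists>q\<in>Q. dist q (x::'a) < e"
  shows "\<exists>a\<in>Q. \<exists>j::nat. x \<in> near_linear f a (1 / Suc j) (1 / Suc k)"
proof -
  obtain f' where f': "(f has_derivative f') (at x)"
    using assms(1) by (auto simp: differentiable_def)
  define A where "A = adjoint f' 1"
  have A: "f' h = A \<bullet> h" for h
    using adjoint_works[OF has_derivative_linear[OF f'], of h 1] by (simp add: A_def inner_commute)
  define e where "e = 1 / (2 * real (Suc k))"
  have e: "e > 0" by (simp add: e_def)
  obtain d where d: "d > 0" "\<And>y. norm (y - x) < d \<Longrightarrow> norm (f y - f x - f' (y - x)) \<le> e * norm (y - x)"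
    using f' e unfolding has_derivative_at_alt by blast
  obtain a where a: "a \<in> Q" "dist a A < e"
    using Q[OF e] by blast
  obtain j where j: "1 / real (Suc j) < d"
    using d nat_approx_posE by blast
  have "\<bar>f (x + h) - f x - a \<bullet> h\<bar> \<le> 1 / Suc k * norm h" if "norm h < 1 / Suc j" for h
  proof -
    have "\<bar>f (x + h) - f x - A \<bullet> h\<bar> \<le> e * norm h"
      using d(2)[of "x + h"] that j by (simp add: A)
    moreover have "\<bar>(A - a) \<bullet> h\<bar> \<le> e * norm h"
      using Cauchy_Schwarz_ineq2[of "A - a" h] a(2)
      by (smt (verit) dist_commute dist_norm mult_right_mono norm_ge_zero)
    ultimately have "\<bar>f (x + h) - f x - a \<bullet> h\<bar> \<le> 2 * e * norm h"
      by (simp add: inner_diff_left)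
    also have "2 * e = 1 / Suc k"
      by (simp add: e_def field_simps)
    finally show ?thesis .
  qed
  then have "x \<in> near_linear f a (1 / Suc j) (1 / Suc k)"
    by (auto simp: near_linear_def)
  with a(1) show ?thesis
    by blast
qed

lemma countable_dense_points:
  obtains Q :: "'a::{metric_space, second_countable_topology} set"
  where "countable Q" "\<And>x e. 0 < e \<Longrightarrow> \<exists>q\<in>Q. dist q x < e"
proof -
  obtain Q :: "'a set" where "countable Q" and Q: "\<And>X. open X \<Longrightarrow> X \<noteq> {} \<Longrightarrow> \<exists>d\<in>Q. d \<in> X"
    using countable_dense_exists by blast
  have "\<exists>q\<in>Q. dist q x < e" if "0 < e" for x e
    using Q[of "ball x e"] that by (auto simp: dist_commute)
  with \<open>countable Q\<close> show ?thesis
    by (rule that)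
qed

text \<open>Differentiability is a countable condition on closed sets once the candidate gradients
  run through a countable dense set.\<close>

lemma differentiable_set_borel_real:
  fixes f :: "'a::euclidean_space \<Rightarrow> real"
  assumes "continuous_on UNIV f"
  shows "{x. f differentiable (at x)} \<in> sets borel"
proof -
  obtain Q :: "'a set" where Q: "countable Q" "\<And>x e. 0 < e \<Longrightarrow> \<exists>q\<in>Q. dist q x < e"
    using countable_dense_points[where 'a='a] by metis
  have "{x. f differentiable (at x)} = (\<Inter>k::nat. \<Union>a\<in>Q. \<Union>j::nat. near_linear f a (1 / Suc j) (1 / Suc k))"
  proof (intro set_eqI iffI)
    fix x assume "x \<in> {x. f differentiable (at x)}"
    then have "\<exists>a\<in>Q. \<exists>j::nat. x \<in> near_linear f a (1 / Suc j) (1 / Suc k)" for k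
      using differentiable_imp_near_linear[OF _ Q(2)] by simp
    then show "x \<in> (\<Inter>k::nat. \<Union>a\<in>Q. \<Union>j::nat. near_linear f a (1 / Suc j) (1 / Suc k))"
      by simp
  next
    fix x assume "x \<in> (\<Inter>k::nat. \<Union>a\<in>Q. \<Union>j::nat. near_linear f a (1 / Suc j) (1 / Suc k))"
    then have "\<exists>a. \<exists>j::nat. x \<in> near_linear f a (1 / Suc j) (1 / Suc k)" for k
      by (simp del: of_nat_Suc) blast
    then show "x \<in> {x. f differentiable (at x)}"
      using near_linear_imp_differentiable by blast
  qed
  also have "\<dots> \<in> sets borel"
  proof -
    have "(\<Union>j::nat. near_linear f a (1 / Suc j) e) \<in> sets borel" for a e
      using borel_closed[OF closed_near_linear[OF assms]] by (intro sets.countable_UN) blast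
    then have "(\<Union>a\<in>Q. \<Union>j::nat. near_linear f a (1 / Suc j) e) \<in> sets borel" for e
      by (intro sets.countable_UN'[OF Q(1)]) blast
    then show ?thesis
      by (intro sets.countable_INT) (blast, simp)
  qed
  finally show ?thesis .
qed

text \<open>Walking from \<open>x\<close> to \<open>x + h\<close> parallel to the axes, each increment is read off at a point
  of \<open>A\<close> near the corresponding corner.\<close>

lemma axis_walk:
  fixes f :: "'a::euclidean_space \<Rightarrow> real" and L e \<eta> :: real
  assumes L: "L-lipschitz_on UNIV f"
    and A: "A \<subseteq> (\<Inter>b\<in>Basis. directional_near f b (a \<bullet> b) d e)"
    and h: "norm h < d" and e: "0 \<le> e"
    and near: "\<And>B. B \<subseteq> Basis \<Longrightarrow> \<exists>q\<in>A. dist q (x + (\<Sum>b\<in>B. (h \<bullet> b) *\<^sub>R b)) < \<eta> * norm h"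
  shows "\<bar>f (x + h) - f x - a \<bullet> h\<bar> \<le> DIM('a) * (e + 2 * L * \<eta>) * norm h"
proof -
  define p where "p = (\<lambda>B. x + (\<Sum>b\<in>B. (h \<bullet> b) *\<^sub>R b))"
  have L0: "L \<ge> 0" using lipschitz_on_nonneg[OF L] .
  have "\<bar>f (p B) - f x - (\<Sum>b\<in>B. (h \<bullet> b) * (a \<bullet> b))\<bar> \<le> card B * ((e + 2 * L * \<eta>) * norm h)"
    if "finite B" "B \<subseteq> Basis" for B
    using that
  proof (induction B rule: finite_induct)
    case (insert b B)
    then have b: "b \<in> Basis" "B \<subseteq> Basis" by auto
    obtain q where q: "q \<in> A" "dist q (p B) < \<eta> * norm h"
      using near[OF b(2)] by (auto simp: p_def)
    have pI: "p (insert b B) = p B + (h \<bullet> b) *\<^sub>R b"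
      using insert.hyps by (simp add: p_def algebra_simps)
    have hb: "\<bar>h \<bullet> b\<bar> \<le> norm h"
      using b(1) by (rule Basis_le_norm)
    have "\<bar>f (q + (h \<bullet> b) *\<^sub>R b) - f q - (h \<bullet> b) * (a \<bullet> b)\<bar> \<le> e * \<bar>h \<bullet> b\<bar>"
      using A q(1) b(1) hb h by (force simp: directional_near_def)
    also have "\<dots> \<le> e * norm h"
      using hb e by (rule mult_left_mono)
    finally have 1: "\<bar>f (q + (h \<bullet> b) *\<^sub>R b) - f q - (h \<bullet> b) * (a \<bullet> b)\<bar> \<le> e * norm h" .
    have Lq: "L * dist q (p B) \<le> L * (\<eta> * norm h)"
      using q(2) L0 by (intro mult_left_mono) auto
    have "\<bar>f q - f (p B)\<bar> \<le> L * (\<eta> * norm h)"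
      using lipschitz_onD[OF L, of q "p B"] Lq by (simp add: dist_real_def)
    moreover have "\<bar>f (q + (h \<bullet> b) *\<^sub>R b) - f (p (insert b B))\<bar> \<le> L * (\<eta> * norm h)"
      using lipschitz_onD[OF L, of "q + (h \<bullet> b) *\<^sub>R b" "p (insert b B)"] Lq by (simp add: pI dist_real_def)
    ultimately have "\<bar>f (p (insert b B)) - f (p B) - (h \<bullet> b) * (a \<bullet> b)\<bar> \<le> (e + 2 * L * \<eta>) * norm h"
      using 1 by (simp add: algebra_simps)
    with insert show ?case
      by (simp add: algebra_simps)
  qed (simp add: p_def)
  from this[of Basis] have "\<bar>f (x + h) - f x - (\<Sum>b\<in>Basis. (h \<bullet> b) * (a \<bullet> b))\<bar> \<le> DIM('a) * ((e + 2 * L * \<eta>) * norm h)"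
    by (simp add: p_def euclidean_representation)
  then show ?thesis
    by (simp add: euclidean_inner[of a h] mult_ac)
qed

text \<open>By contraposition of \<open>axis_walk\<close>: if the linear approximation fails at
  \<open>x\<close> for some short \<open>h\<close>, then around one corner of the walk there is a
  ball of radius \<open>\<eta> * norm h\<close> without points of \<open>?A\<close>. As this happens
  for arbitrarily short \<open>h\<close>, the exceptional set is porous.\<close>

lemma rademacher_exceptional_null:
  fixes f :: "'a::euclidean_space \<Rightarrow> real" and L e \<eta> k :: real
  assumes L: "L-lipschitz_on UNIV f" and d: "0 < d" and e: "0 \<le> e" and \<eta>: "0 < \<eta>" "\<eta> \<le> 1"
    and k: "DIM('a) * (e + 2 * L * \<eta>) \<le> k"
  shows "(\<Inter>b\<in>Basis. directional_near f b (a \<bullet> b) d e) - (\<Union>j::nat. near_linear f a (1 / Suc j) k)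
    \<in> null_sets lborel"
    (is "?A - ?G \<in> _")
\<comment> \<open>The hole of radius \<open>\<eta> * norm h\<close> lies in the ball of radius
  \<open>2 * norm h\<close> around \<open>x\<close>, hence the proportion
  \<open>\<eta> / 2\<close>.\<close>
proof (rule porous_imp_null[where \<eta> = "\<eta> / 2"])
  have cont: "continuous_on UNIV f"
    by (rule lipschitz_on_continuous_on[OF L])
  have "closed ?A"
    using closed_directional_near[OF cont] by auto
  moreover have "?G \<in> sets borel"
    using borel_closed[OF closed_near_linear[OF cont]] by (intro sets.countable_UN) blast
  ultimately show "?A - ?G \<in> sets borel"
    by auto
  show "0 < \<eta> / 2" using \<eta> by simp
  fix x :: 'a and d' :: real
  assume x: "x \<in> ?A - ?G" and d': "0 < d'"
  obtain j where j: "1 / real (Suc j) < min d (d' / 2)"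
    using nat_approx_posE[of "min d (d' / 2)"] d d' by auto
  have "x \<notin> near_linear f a (1 / Suc j) k"
    using x by blast
  then obtain h where h: "norm h < 1 / Suc j" "\<bar>f (x + h) - f x - a \<bullet> h\<bar> > k * norm h"
    by (auto simp: near_linear_def not_le)
  have h0: "norm h > 0"
    using h(2) by (cases "h = 0") auto
  have "\<exists>B\<subseteq>Basis. \<forall>q\<in>?A. \<not> dist q (x + (\<Sum>b\<in>B. (h \<bullet> b) *\<^sub>R b)) < \<eta> * norm h"
  proof (rule ccontr)
    assume "\<not> ?thesis"
    then have "\<bar>f (x + h) - f x - a \<bullet> h\<bar> \<le> DIM('a) * (e + 2 * L * \<eta>) * norm h"
      using h(1) j by (intro axis_walk[where d=d, OF L order_refl _ e]) auto
    also have "\<dots> \<le> k * norm h"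
      by (intro mult_right_mono k) auto
    finally show False using h(2) by simp
  qed
  then obtain B where B: "B \<subseteq> Basis"
    and hole: "\<And>q. q \<in> ?A \<Longrightarrow> \<not> dist q (x + (\<Sum>b\<in>B. (h \<bullet> b) *\<^sub>R b)) < \<eta> * norm h"
    by blast
  define p where "p = x + (\<Sum>b\<in>B. (h \<bullet> b) *\<^sub>R b)"
  have "dist x p \<le> norm h"
  proof -
    have "norm (\<Sum>b\<in>B. (h \<bullet> b) *\<^sub>R b) \<le> norm h"
    proof (rule norm_le_componentwise)
      fix c :: 'a assume c: "c \<in> Basis"
      have "(\<Sum>b\<in>B. (h \<bullet> b) *\<^sub>R b) \<bullet> c = (\<Sum>b\<in>B. if b = c then h \<bullet> c else 0)"
        unfolding inner_sum_left by (rule sum.cong) (use B c in \<open>auto simp: inner_Basis\<close>)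
      then show "\<bar>(\<Sum>b\<in>B. (h \<bullet> b) *\<^sub>R b) \<bullet> c\<bar> \<le> \<bar>h \<bullet> c\<bar>"
        using finite_subset[OF B] by simp
    qed
    then show ?thesis
      by (simp add: p_def dist_norm)
  qed
  moreover have "\<eta> * norm h \<le> norm h"
    using \<eta> by (simp add: mult_left_le_one_le)
  ultimately have "ball p (\<eta> * norm h) \<subseteq> ball x (2 * norm h)"
    by (intro subsetI, unfold mem_ball) (use dist_triangle[of x _ p] in \<open>smt (verit)\<close>)
  moreover have "ball p (\<eta> * norm h) \<inter> (?A - ?G) = {}"
    using hole by (fastforce simp: p_def dist_commute)
  ultimately show "\<exists>r p. 0 < r \<and> r < d' \<and> ball p (\<eta> / 2 * r) \<subseteq> ball x r \<and> ball p (\<eta> / 2 * r) \<inter> (?A - ?G) = {}"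
    using h(1) h0 j by (intro exI[of _ "2 * norm h"] exI[of _ p]) auto
qed

lemma rademacher_real:
  fixes f :: "'a::euclidean_space \<Rightarrow> real"
  assumes L: "L-lipschitz_on UNIV f"
  shows "{x. \<not> f differentiable (at x)} \<in> null_sets lborel"
proof -
  define Q :: "'a set" where "Q = (\<lambda>g. \<Sum>b\<in>Basis. g b *\<^sub>R b) ` (PiE Basis (\<lambda>_. \<rat>))"
  have Q: "countable Q"
    unfolding Q_def by (intro countable_image countable_PiE) (auto intro: countable_rat)
  define n where "n = real (DIM('a))"
  have n: "n \<ge> 1" using DIM_positive[where 'a='a] unfolding n_def by linarith
  \<comment> \<open>Error budget: \<open>axis_walk\<close> loses
    \<open>n * (e + 2 * L * \<eta>)\<close>. The tolerance \<open>e = 1 / Suc (K k)\<close> and the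
    value of \<open>?\<eta>\<close> below each use at most half of \<open>1 / Suc k\<close>; the
    factor \<open>L + 1\<close> in \<open>?\<eta>\<close> covers \<open>L = 0\<close>.\<close>
  define K where "K = (\<lambda>k. 2 * DIM('a) * Suc k)"
  define bad where "bad = (\<lambda>a (j::nat) (k::nat). (\<Inter>b\<in>Basis. directional_near f b (a \<bullet> b) (1 / Suc j) (1 / Suc (K k)))
    - (\<Union>j::nat. near_linear f a (1 / Suc j) (1 / Suc k)))"
  have L0: "L \<ge> 0" using lipschitz_on_nonneg[OF L] .
  have bad: "bad a j k \<in> null_sets lborel" for a j k
    unfolding bad_def
  proof (rule rademacher_exceptional_null[OF L])
    let ?\<eta> = "1 / (4 * (L + 1) * n * Suc k)"
    have den: "4 * (L + 1) * n * Suc k \<ge> 1"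
    proof -
      have "1 * 1 * 1 \<le> (4 * (L + 1)) * n * real (Suc k)"
        using L0 n by (intro mult_mono) auto
      then show ?thesis by simp
    qed
    show "0 < ?\<eta>" "?\<eta> \<le> 1"
      using den by auto
    have "0 < 2 * n * Suc k"
      using n by simp
    then have "n * (1 / Suc (K k)) \<le> n * (1 / (2 * n * Suc k))"
      using n by (intro mult_left_mono frac_le) (auto simp: K_def n_def algebra_simps)
    also have "\<dots> = 1 / (2 * Suc k)"
      unfolding of_nat_mult using n by (simp del: of_nat_Suc add: field_simps)
    finally have "n * (1 / Suc (K k)) \<le> 1 / (2 * Suc k)" .
    moreover have "n * (2 * L * ?\<eta>) \<le> 1 / (2 * Suc k)"
    proof -
      have "n * (2 * L * ?\<eta>) = (L / (L + 1)) * (1 / (2 * Suc k))"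
        using n L0 by (simp add: divide_simps) (simp add: algebra_simps)
      also have "\<dots> \<le> 1 * (1 / (2 * Suc k))"
        using L0 by (intro mult_right_mono) auto
      finally show ?thesis by simp
    qed
    ultimately have "n * (1 / Suc (K k) + 2 * L * ?\<eta>) \<le> 1 / (2 * Suc k) + 1 / (2 * Suc k)"
      unfolding distrib_left by linarith
    also have "\<dots> = 1 / Suc k"
      by (simp add: field_simps)
    finally show "DIM('a) * (1 / Suc (K k) + 2 * L * ?\<eta>) \<le> 1 / Suc k"
      by (simp only: n_def)
  qed auto
  define N where "N = (\<Union>b\<in>Basis. - directional_good f b) \<union> (\<Union>a\<in>Q. \<Union>j. \<Union>k. bad a j k)"
  have N: "N \<in> null_sets lborel"
    unfolding N_def
    by (intro null_sets.Un null_sets_UN' directional_good_AE[OF L] bad Q)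
       (auto simp: countable_finite)
  have "f differentiable (at x)" if x: "x \<notin> N" for x
  proof (rule near_linear_imp_differentiable)
    fix k :: nat
    have "\<exists>a\<in>\<rat>. \<exists>j::nat. x \<in> directional_near f b a (1 / Suc j) (1 / Suc (K k))" if "b \<in> Basis" for b
      using x that by (auto simp: N_def directional_good_def)
    then obtain g J where gJ: "\<And>b. b \<in> Basis \<Longrightarrow> g b \<in> \<rat>"
      "\<And>b. b \<in> Basis \<Longrightarrow> x \<in> directional_near f b (g b) (1 / Suc (J b :: nat)) (1 / Suc (K k))"
      by metis
    define a where "a = (\<Sum>b\<in>Basis. restrict g Basis b *\<^sub>R b)"
    have aQ: "a \<in> Q"
      unfolding a_def Q_def using gJ(1) by (intro imageI) auto
    have ab: "a \<bullet> b = g b" if "b \<in> Basis" for b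
      using that by (simp add: a_def inner_sum_left inner_Basis if_distrib sum.delta cong: if_cong)
    \<comment> \<open>The smallest of the finitely many scales serves all axes.\<close>
    define j where "j = Max (J ` Basis)"
    have "x \<in> directional_near f b (a \<bullet> b) (1 / Suc j) (1 / Suc (K k))" if "b \<in> Basis" for b
    proof -
      have "J b \<le> j" using that by (simp add: j_def)
      then have "1 / real (Suc j) \<le> 1 / Suc (J b)"
        by (simp add: field_simps)
      then show ?thesis
        using gJ(2)[OF that] by (auto simp: directional_near_def ab[OF that])
    qed
    moreover have "x \<notin> bad a j k"
      using x aQ by (auto simp: N_def)
    ultimately show "\<exists>a. \<exists>j::nat. x \<in> near_linear f a (1 / Suc j) (1 / Suc k)"
      by (auto simp: bad_def)
  qed
  then have "{x. \<not> f differentiable (at x)} \<subseteq> N"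
    by blast
  moreover have "{x. \<not> f differentiable (at x)} \<in> sets lborel"
    using differentiable_set_borel_real[OF lipschitz_on_continuous_on[OF L]]
    unfolding Collect_neg_eq sets_lborel by (rule borel_comp)
  ultimately show ?thesis
    using N null_sets_subset by blast
qed

theorem rademacher:
  fixes u :: "'a::euclidean_space \<Rightarrow> 'b::euclidean_space"
  assumes L: "L-lipschitz_on UNIV u"
  shows "nondiff_set u \<in> null_sets lborel"
proof -
  have "L-lipschitz_on UNIV (\<lambda>x. u x \<bullet> i)" if "i \<in> Basis" for i
  proof (rule lipschitz_onI)
    fix x y
    have "dist (u x \<bullet> i) (u y \<bullet> i) \<le> dist (u x) (u y)"
      using Basis_le_norm[OF that, of "u x - u y"] by (simp add: dist_norm inner_diff_left)
    also have "\<dots> \<le> L * dist x y"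
      by (rule lipschitz_onD[OF L]) auto
    finally show "dist (u x \<bullet> i) (u y \<bullet> i) \<le> L * dist x y" .
  qed (rule lipschitz_on_nonneg[OF L])
  then have "(\<Union>i\<in>Basis. {x. \<not> (\<lambda>x. u x \<bullet> i) differentiable (at x)}) \<in> null_sets lborel"
    by (intro null_sets_UN' rademacher_real) (auto simp: countable_finite)
  moreover have "nondiff_set u = (\<Union>i\<in>Basis. {x. \<not> (\<lambda>x. u x \<bullet> i) differentiable (at x)})"
    unfolding nondiff_set_def by (subst differentiable_componentwise_within) auto
  ultimately show ?thesis
    by simp
qed

section \<open>Total variation and polar decomposition\<close>

lemma vm_sums:
  assumes "vector_measure \<mu>" "range A \<subseteq> sets borel" "disjoint_family A"
  shows "(\<lambda>i. \<mu> (A i)) sums \<mu> (\<Union>i::nat. A i)"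
  using assms by (simp add: vector_measure_def)

lemma vm_empty [simp]:
  assumes "vector_measure \<mu>"
  shows "\<mu> {} = 0"
proof -
  have "(\<lambda>i::nat. \<mu> {}) sums \<mu> {}"
    using vm_sums[OF assms, of "\<lambda>_. {}"] by (simp add: disjoint_family_on_def)
  then show ?thesis
    using summable_LIMSEQ_zero[of "\<lambda>_. \<mu> {}"] by (simp add: sums_iff LIMSEQ_const_iff)
qed

lemma vm_Un:
  assumes "vector_measure \<mu>" "A \<in> sets borel" "B \<in> sets borel" "A \<inter> B = {}"
  shows "\<mu> (A \<union> B) = \<mu> A + \<mu> B"
proof -
  have "(\<lambda>i. \<mu> (binaryset A B i)) sums \<mu> (\<Union>i. binaryset A B i)"
  proof (rule vm_sums[OF assms(1)])
    show "range (binaryset A B) \<subseteq> sets borel"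
      using assms by (simp add: range_binaryset_eq)
    show "disjoint_family (binaryset A B)"
      using assms(4) by (auto simp: disjoint_family_on_def binaryset_def)
  qed
  moreover have "(\<lambda>i. \<mu> (binaryset A B i)) sums (\<mu> A + \<mu> B)"
    by (rule binaryset_sums) (simp add: assms(1))
  ultimately show ?thesis
    by (simp add: UN_binaryset_eq sums_iff)
qed

lemma vm_Diff:
  assumes "vector_measure \<mu>" "A \<in> sets borel" "B \<in> sets borel" "B \<subseteq> A"
  shows "\<mu> (A - B) = \<mu> A - \<mu> B"
proof -
  have "(A - B) \<inter> B = {}" "A - B \<union> B = A"
    using assms(4) by auto
  then show ?thesis
    using vm_Un[OF assms(1), of "A - B" B] assms by simp
qed

lemma vm_finite_UN:
  assumes "vector_measure \<mu>" "finite I" "\<And>i. i \<in> I \<Longrightarrow> A i \<in> sets borel" "disjoint_family_on A I"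
  shows "\<mu> (\<Union>i\<in>I. A i) = (\<Sum>i\<in>I. \<mu> (A i))"
  using assms(2-4)
proof (induction I rule: finite_induct)
  case (insert i I)
  have "A i \<inter> (\<Union>i\<in>I. A i) = {}"
    using insert by (auto simp: disjoint_family_on_def)
  then have "\<mu> (A i \<union> (\<Union>i\<in>I. A i)) = \<mu> (A i) + \<mu> (\<Union>i\<in>I. A i)"
    using insert by (intro vm_Un[OF assms(1)] sets.finite_UN) auto
  with insert show ?case
    by (simp add: disjoint_family_on_def)
qed (simp add: assms(1))

section \<open>Additivity and finiteness of the variation\<close>

text \<open>The set function inside \<open>total_variation\<close>. It gets a name of its own
  because \<open>measure_of\<close> returns it as a measure only once countable additivity is
  known.\<close>

definition variation :: "('a::topological_space set \<Rightarrow> 'b::real_normed_vector) \<Rightarrow> 'a set \<Rightarrow> ennreal" where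
  "variation \<mu> A = (SUP E \<in> {E::nat \<Rightarrow> 'a set. range E \<subseteq> sets borel \<and> disjoint_family E \<and> (\<Union>i. E i) = A}.
      \<Sum>i. ennreal (norm (\<mu> (E i))))"

lemma variation_upper:
  fixes E :: "nat \<Rightarrow> 'a::topological_space set"
  assumes "range E \<subseteq> sets borel" "disjoint_family E" "(\<Union>i. E i) = A"
  shows "(\<Sum>i. ennreal (norm (\<mu> (E i)))) \<le> variation \<mu> A"
  unfolding variation_def using assms by (intro SUP_upper) auto

lemma variation_least:
  fixes \<mu> :: "'a::topological_space set \<Rightarrow> 'b::real_normed_vector"
  assumes "\<And>E::nat \<Rightarrow> 'a set. range E \<subseteq> sets borel \<Longrightarrow> disjoint_family E \<Longrightarrow> (\<Union>i. E i) = A \<Longrightarrow>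
    (\<Sum>i. ennreal (norm (\<mu> (E i)))) \<le> c"
  shows "variation \<mu> A \<le> c"
  unfolding variation_def using assms by (intro SUP_least) auto

text \<open>A finite family is padded to a countable partition of \<open>A\<close>: the remainder of
  \<open>A\<close> takes the index \<open>card I\<close>, and all later sets are empty.\<close>

lemma variation_finite_upper:
  fixes E :: "'i \<Rightarrow> 'a::topological_space set"
  assumes I: "finite I" and E: "\<And>i. i \<in> I \<Longrightarrow> E i \<in> sets borel" "\<And>i. i \<in> I \<Longrightarrow> E i \<subseteq> A"
    and disj: "disjoint_family_on E I" and A: "A \<in> sets borel"
  shows "(\<Sum>i\<in>I. ennreal (norm (\<mu> (E i)))) \<le> variation \<mu> A"
proof -
  obtain h where h: "bij_betw h {..<card I} I"
    using ex_bij_betw_nat_finite[OF I] by (auto simp: atLeast0LessThan)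
  let ?n = "card I"
  define G where "G = (\<lambda>k. if k < ?n then E (h k) else if k = ?n then A - (\<Union>i\<in>I. E i) else {})"
  have hI: "h k \<in> I" if "k < ?n" for k
    using h that by (auto simp: bij_betw_def)
  have surj: "\<exists>k<?n. i = h k" if "i \<in> I" for i
    using h that by (auto simp: bij_betw_def image_iff)
  have "(\<Sum>i\<in>I. ennreal (norm (\<mu> (E i)))) = (\<Sum>k<?n. ennreal (norm (\<mu> (G k))))"
    by (subst sum.reindex_bij_betw[OF h, symmetric]) (simp add: G_def)
  also have "\<dots> \<le> (\<Sum>k. ennreal (norm (\<mu> (G k))))"
    by (rule sum_le_suminf) auto
  also have "\<dots> \<le> variation \<mu> A"
  proof (rule variation_upper)
    show "range G \<subseteq> sets borel"
      using E hI I A by (auto simp: G_def intro!: sets.Diff sets.finite_UN)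
    show "disjoint_family G"
      unfolding disjoint_family_on_def
    proof (intro ballI impI)
      fix k l :: nat assume "k \<noteq> l"
      have "E (h k) \<inter> E (h l) = {}" if "k < ?n" "l < ?n"
        using disj hI[OF that(1)] hI[OF that(2)] h \<open>k \<noteq> l\<close> that
        by (auto simp: disjoint_family_on_def bij_betw_def inj_on_def)
      then show "G k \<inter> G l = {}"
        using hI \<open>k \<noteq> l\<close> by (auto simp: G_def)
    qed
    show "(\<Union>k. G k) = A"
    proof
      show "(\<Union>k. G k) \<subseteq> A"
        using E(2) hI by (fastforce simp: G_def split: if_splits)
      show "A \<subseteq> (\<Union>k. G k)"
      proof
        fix x assume "x \<in> A"
        show "x \<in> (\<Union>k. G k)"
        proof (cases "x \<in> (\<Union>i\<in>I. E i)")
          case True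
          then obtain i where "i \<in> I" "x \<in> E i" by blast
          moreover then obtain k where "k < ?n" "i = h k"
            using surj by blast
          ultimately have "x \<in> G k" by (simp add: G_def)
          then show ?thesis by blast
        next
          case False
          with \<open>x \<in> A\<close> have "x \<in> G ?n" by (simp add: G_def)
          then show ?thesis by blast
        qed
      qed
    qed
  qed
  finally show ?thesis .
qed

lemma norm_le_variation:
  assumes "A \<in> sets borel"
  shows "ennreal (norm (\<mu> A)) \<le> variation \<mu> A"
  using variation_finite_upper[of "{()}" "\<lambda>_. A" A \<mu>] assms by (simp add: disjoint_family_on_def)

lemma norm_sums_le_suminf:
  fixes f :: "nat \<Rightarrow> 'a::real_normed_vector"
  assumes "f sums s"
  shows "ennreal (norm s) \<le> (\<Sum>i. ennreal (norm (f i)))"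
proof (rule LIMSEQ_le_const2)
  show "(\<lambda>n. ennreal (norm (\<Sum>i<n. f i))) \<longlonglongrightarrow> ennreal (norm s)"
    using assms by (intro tendsto_ennrealI tendsto_norm) (simp add: sums_def)
  have "ennreal (norm (\<Sum>i<n. f i)) \<le> (\<Sum>i. ennreal (norm (f i)))" for n
  proof -
    have "ennreal (norm (\<Sum>i<n. f i)) \<le> ennreal (\<Sum>i<n. norm (f i))"
      by (intro ennreal_leI norm_sum)
    also have "\<dots> = (\<Sum>i<n. ennreal (norm (f i)))"
      by simp
    also have "\<dots> \<le> (\<Sum>i. ennreal (norm (f i)))"
      by (rule sum_le_suminf) auto
    finally show ?thesis .
  qed
  then show "\<exists>N. \<forall>n\<ge>N. ennreal (norm (\<Sum>i<n. f i)) \<le> (\<Sum>i. ennreal (norm (f i)))"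
    by blast
qed

lemma suminf_swap_ennreal:
  fixes f :: "nat \<Rightarrow> nat \<Rightarrow> ennreal"
  shows "(\<Sum>i. \<Sum>j. f i j) = (\<Sum>j. \<Sum>i. f i j)"
  using nn_integral_suminf[of f "count_space UNIV"] by (simp add: nn_integral_count_space_nat)

text \<open>Partitions of two disjoint sets combine to a disjoint family in the union. Partial sums
  are compared, so the combined family is finite, indexed by a disjoint sum.\<close>

lemma variation_superadditive_finite:
  fixes A :: "'i \<Rightarrow> 'a::topological_space set"
  assumes "finite I" "\<And>i. i \<in> I \<Longrightarrow> A i \<in> sets borel" "disjoint_family_on A I"
  shows "(\<Sum>i\<in>I. variation \<mu> (A i)) \<le> variation \<mu> (\<Union>i\<in>I. A i)"
proof -
  have two: "variation \<mu> A + variation \<mu> B \<le> variation \<mu> (A \<union> B)"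
    if A: "A \<in> sets borel" and B: "B \<in> sets borel" and AB: "A \<inter> B = {}" for A B :: "'a set"
  proof -
    have *: "(\<Sum>i. ennreal (norm (\<mu> (E i)))) + (\<Sum>i. ennreal (norm (\<mu> (F i)))) \<le> variation \<mu> (A \<union> B)"
      if E: "range E \<subseteq> sets borel" "disjoint_family E" "(\<Union>i. E i) = A"
        and F: "range F \<subseteq> sets borel" "disjoint_family F" "(\<Union>i. F i) = B" for E F :: "nat \<Rightarrow> 'a set"
    proof -
      have "(\<Sum>i. ennreal (norm (\<mu> (E i)))) + (\<Sum>i. ennreal (norm (\<mu> (F i)))) =
          (\<Sum>i. ennreal (norm (\<mu> (E i))) + ennreal (norm (\<mu> (F i))))"
        by (rule suminf_add) auto
      also have "\<dots> \<le> variation \<mu> (A \<union> B)"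
      proof (rule suminf_le_const[OF summableI])
        fix n
        let ?G = "case_sum E F"
        have disj: "disjoint_family_on ?G ({..<n} <+> {..<n})"
          unfolding disjoint_family_on_def
        proof (intro ballI impI)
          fix a b assume ab: "a \<in> {..<n} <+> {..<n}" "b \<in> {..<n} <+> {..<n}" "a \<noteq> b"
          have "E i \<subseteq> A" "F i \<subseteq> B" for i
            using E(3) F(3) by auto
          then have EF: "E i \<inter> F j = {}" "F j \<inter> E i = {}" for i j
            using AB by blast+
          show "?G a \<inter> ?G b = {}"
            using ab EF E(2) F(2) by (cases a; cases b) (auto simp: disjoint_family_on_def)
        qed
        have "(\<Sum>i<n. ennreal (norm (\<mu> (E i))) + ennreal (norm (\<mu> (F i)))) =
            (\<Sum>i\<in>{..<n} <+> {..<n}. ennreal (norm (\<mu> (?G i))))"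
          by (simp add: sum.distrib sum.Plus comp_def del: sum_ennreal)
        also have "\<dots> \<le> variation \<mu> (A \<union> B)"
          using E F A B by (intro variation_finite_upper disj) (auto split: sum.split)
        finally show "(\<Sum>i<n. ennreal (norm (\<mu> (E i))) + ennreal (norm (\<mu> (F i)))) \<le> variation \<mu> (A \<union> B)" .
      qed
      finally show ?thesis .
    qed
    have ne: "{E::nat \<Rightarrow> 'a set. range E \<subseteq> sets borel \<and> disjoint_family E \<and> (\<Union>i. E i) = C} \<noteq> {}"
      if "C \<in> sets borel" for C
    proof -
      have "binaryset C {} \<in> {E. range E \<subseteq> sets borel \<and> disjoint_family E \<and> (\<Union>i. E i) = C}"
        using that by (auto simp: range_binaryset_eq UN_binaryset_eq disjoint_family_on_def binaryset_def)
      then show ?thesis by blast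
    qed
    let ?P = "\<lambda>C. {E::nat \<Rightarrow> 'a set. range E \<subseteq> sets borel \<and> disjoint_family E \<and> (\<Union>i. E i) = C}"
    let ?s = "\<lambda>E. \<Sum>i. ennreal (norm (\<mu> (E i)))"
    have "variation \<mu> A + variation \<mu> B = (SUP E\<in>?P A. ?s E + variation \<mu> B)"
      unfolding variation_def[of \<mu> A] by (rule ennreal_SUP_add_left[OF ne[OF A], symmetric])
    also have "\<dots> \<le> variation \<mu> (A \<union> B)"
    proof (rule SUP_least)
      fix E assume E: "E \<in> ?P A"
      have "?s E + variation \<mu> B = (SUP F\<in>?P B. ?s E + ?s F)"
        unfolding variation_def[of \<mu> B] by (rule ennreal_SUP_add_right[OF ne[OF B]])
      also have "\<dots> \<le> variation \<mu> (A \<union> B)"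
      proof (rule SUP_least)
        fix F assume F: "F \<in> ?P B"
        show "?s E + ?s F \<le> variation \<mu> (A \<union> B)"
          by (rule *) (use E F in \<open>blast+\<close>)
      qed
      finally show "?s E + variation \<mu> B \<le> variation \<mu> (A \<union> B)" .
    qed
    finally show ?thesis .
  qed
  show ?thesis
    using assms
  proof (induction I rule: finite_induct)
    case (insert i I)
    have dj: "A i \<inter> (\<Union>i\<in>I. A i) = {}"
      using insert by (auto simp: disjoint_family_on_def)
    have "(\<Sum>i\<in>insert i I. variation \<mu> (A i)) = variation \<mu> (A i) + (\<Sum>i\<in>I. variation \<mu> (A i))"
      using insert by simp
    also have "\<dots> \<le> variation \<mu> (A i) + variation \<mu> (\<Union>i\<in>I. A i)"
      using insert by (intro add_left_mono) (auto simp: disjoint_family_on_def)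
    also have "\<dots> \<le> variation \<mu> (A i \<union> (\<Union>i\<in>I. A i))"
      using insert dj by (intro two sets.finite_UN) auto
    finally show ?case by simp
  qed simp
qed

lemma variation_mono:
  assumes "A \<in> sets borel" "B \<in> sets borel" "A \<subseteq> B"
  shows "variation \<mu> A \<le> variation \<mu> B"
proof -
  have "(\<Sum>b\<in>UNIV. variation \<mu> (if b then A else B - A)) \<le> variation \<mu> (\<Union>b\<in>UNIV. if b then A else B - A)"
    using assms by (intro variation_superadditive_finite) (auto simp: disjoint_family_on_def)
  moreover have "(\<Union>b\<in>UNIV. if b then A else B - A) = B"
    using assms(3) by (auto simp: UNIV_bool)
  ultimately have "variation \<mu> (B - A) + variation \<mu> A \<le> variation \<mu> B"
    by (simp add: UNIV_bool)
  then show ?thesis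
    by (metis add.commute le_iff_add order_trans)
qed

text \<open>One inequality is superadditivity on finite unions. For the other, a partition of the
  union is cut along the sets \<open>A i\<close>; the triangle inequality and an exchange of sums
  compare it with the partitions induced in each \<open>A i\<close>.\<close>

lemma countably_additive_variation:
  fixes \<mu> :: "'a::topological_space set \<Rightarrow> 'b::real_normed_vector"
  assumes \<mu>: "vector_measure \<mu>"
  shows "countably_additive (sets borel) (variation \<mu>)"
proof (rule countably_additiveI)
  fix A :: "nat \<Rightarrow> 'a set"
  assume A: "range A \<subseteq> sets borel" "disjoint_family A" "(\<Union>i. A i) \<in> sets borel"
  show "(\<Sum>i. variation \<mu> (A i)) = variation \<mu> (\<Union>i. A i)"
  proof (rule antisym)
    show "(\<Sum>i. variation \<mu> (A i)) \<le> variation \<mu> (\<Union>i. A i)"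
    proof (rule suminf_le_const[OF summableI])
      fix n
      have "(\<Sum>i<n. variation \<mu> (A i)) \<le> variation \<mu> (\<Union>i<n. A i)"
        using A by (intro variation_superadditive_finite) (auto simp: disjoint_family_on_def)
      also have "\<dots> \<le> variation \<mu> (\<Union>i. A i)"
        using A by (intro variation_mono A(3)) auto
      finally show "(\<Sum>i<n. variation \<mu> (A i)) \<le> variation \<mu> (\<Union>i. A i)" .
    qed
    show "variation \<mu> (\<Union>i. A i) \<le> (\<Sum>i. variation \<mu> (A i))"
    proof (rule variation_least)
      fix E :: "nat \<Rightarrow> 'a set"
      assume E: "range E \<subseteq> sets borel" "disjoint_family E" "(\<Union>i. E i) = (\<Union>i. A i)"
      have "(\<Sum>j. ennreal (norm (\<mu> (E j)))) \<le> (\<Sum>j. \<Sum>i. ennreal (norm (\<mu> (E j \<inter> A i))))"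
      proof (intro suminf_le summableI)
        fix j
        have "(\<lambda>i. \<mu> (E j \<inter> A i)) sums \<mu> (\<Union>i. E j \<inter> A i)"
          using A E by (intro vm_sums[OF \<mu>]) (auto simp: disjoint_family_on_def)
        moreover have "(\<Union>i. E j \<inter> A i) = E j"
          using E(3) by auto
        ultimately show "ennreal (norm (\<mu> (E j))) \<le> (\<Sum>i. ennreal (norm (\<mu> (E j \<inter> A i))))"
          using norm_sums_le_suminf by force
      qed
      also have "\<dots> = (\<Sum>i. \<Sum>j. ennreal (norm (\<mu> (E j \<inter> A i))))"
        by (rule suminf_swap_ennreal)
      also have "\<dots> \<le> (\<Sum>i. variation \<mu> (A i))"
      proof (intro suminf_le summableI)
        fix i
        show "(\<Sum>j. ennreal (norm (\<mu> (E j \<inter> A i)))) \<le> variation \<mu> (A i)"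
        proof (rule variation_upper)
          show "disjoint_family (\<lambda>j. E j \<inter> A i)"
            using E(2) unfolding disjoint_family_on_def by blast
        qed (use A E in auto)
      qed
      finally show "(\<Sum>j. ennreal (norm (\<mu> (E j)))) \<le> (\<Sum>i. variation \<mu> (A i))" .
    qed
  qed
qed

lemma sets_total_variation [simp, measurable_cong]:
  "sets (total_variation (\<mu> :: 'a::topological_space set \<Rightarrow> 'b::real_normed_vector)) = sets borel"
  using sets.sigma_sets_eq[of "borel :: 'a measure"] by (simp add: total_variation_def)

lemma space_total_variation [simp]: "space (total_variation \<mu>) = UNIV"
  by (simp add: total_variation_def)

lemma variation_empty: "vector_measure \<mu> \<Longrightarrow> variation \<mu> {} = 0"
  by (rule antisym[OF variation_least]) auto

lemma emeasure_total_variation: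
  fixes \<mu> :: "'a::topological_space set \<Rightarrow> 'b::real_normed_vector"
  assumes "vector_measure \<mu>" "A \<in> sets borel"
  shows "emeasure (total_variation \<mu>) A = variation \<mu> A"
proof -
  have "total_variation \<mu> = measure_of UNIV (sets borel) (variation \<mu>)"
    unfolding total_variation_def variation_def ..
  moreover have "emeasure (measure_of UNIV (sets borel) (variation \<mu>)) A = variation \<mu> A"
  proof (rule emeasure_measure_of_sigma)
    show "sigma_algebra UNIV (sets (borel :: 'a measure))"
      using sets.sigma_algebra_axioms[of "borel :: 'a measure"] by simp
    show "positive (sets borel) (variation \<mu>)"
      by (simp add: positive_def variation_empty assms(1))
  qed (use assms countably_additive_variation in auto)
  ultimately show ?thesis
    by simp
qed

lemma norm_le_total_variation:
  assumes "vector_measure \<mu>" "A \<in> sets borel"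
  shows "ennreal (norm (\<mu> A)) \<le> emeasure (total_variation \<mu>) A"
  using norm_le_variation[OF assms(2)] emeasure_total_variation[OF assms] by simp

text \<open>The total variation is the least measure dominating the norms. Upper bounds on transport
  costs are obtained by exhibiting some dominating measure.\<close>

lemma total_variation_minimal:
  assumes \<mu>: "vector_measure \<mu>" and M: "sets M = sets borel" and A: "A \<in> sets borel"
    and le: "\<And>B. B \<in> sets borel \<Longrightarrow> ennreal (norm (\<mu> B)) \<le> emeasure M B"
  shows "emeasure (total_variation \<mu>) A \<le> emeasure M A"
  unfolding emeasure_total_variation[OF \<mu> A]
proof (rule variation_least)
  fix E :: "nat \<Rightarrow> _ set"
  assume E: "range E \<subseteq> sets borel" "disjoint_family E" "(\<Union>i. E i) = A"
  have "(\<Sum>i. ennreal (norm (\<mu> (E i)))) \<le> (\<Sum>i. emeasure M (E i))"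
    using E by (intro suminf_le summableI le) auto
  also have "\<dots> = emeasure M A"
    using E M by (subst suminf_emeasure) auto
  finally show "(\<Sum>i. ennreal (norm (\<mu> (E i)))) \<le> emeasure M A" .
qed

lemma total_variation_cong:
  assumes "\<And>A. A \<in> sets borel \<Longrightarrow> \<mu> A = \<nu> A"
  shows "total_variation \<mu> = total_variation \<nu>"
proof -
  have "(\<Sum>i. ennreal (norm (\<mu> (E i)))) = (\<Sum>i. ennreal (norm (\<nu> (E i))))"
    if "range E \<subseteq> sets borel" for E :: "nat \<Rightarrow> _"
    using that assms by (metis rangeI subsetD)
  then show ?thesis
    unfolding total_variation_def
    by (intro arg_cong[where f = "measure_of UNIV (sets borel)"] ext SUP_cong) auto
qed

text \<open>Some coordinate with a fixed sign carries a large share of a finite partition sum, and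
  values with the same sign in that coordinate do not cancel. So \<open>A\<close> splits into two
  pieces of norm at least 1, one of which still has infinite variation.\<close>

lemma vm_large_piece:
  fixes \<mu> :: "'a::topological_space set \<Rightarrow> 'b::euclidean_space"
  assumes \<mu>: "vector_measure \<mu>" and A: "A \<in> sets borel" and inf: "variation \<mu> A = \<infinity>"
  obtains B where "B \<in> sets borel" "B \<subseteq> A" "variation \<mu> B = \<infinity>" "1 \<le> norm (\<mu> (A - B))"
proof -
  \<comment> \<open>The factor \<open>DIM('b)\<close> in \<open>t\<close> pays for singling out a
    coordinate, the factor 2 for singling out a sign, and \<open>1 + norm (\<mu> A)\<close> gives
    the complement \<open>A - B\<close> norm at least 1 too.\<close>
  define s where "s = 2 * (1 + norm (\<mu> A))"
  define t where "t = DIM('b) * s"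
  have s: "s > 0" by (auto simp: s_def intro: add_pos_nonneg)
  have "ennreal t < variation \<mu> A"
    using inf by simp
  then obtain E :: "nat \<Rightarrow> 'a set" where E: "range E \<subseteq> sets borel" "disjoint_family E" "(\<Union>i. E i) = A"
    and "ennreal t < (\<Sum>i. ennreal (norm (\<mu> (E i))))"
    unfolding variation_def less_SUP_iff by auto
  then obtain n where "ennreal t < (\<Sum>i<n. ennreal (norm (\<mu> (E i))))"
    unfolding suminf_eq_SUP less_SUP_iff by auto
  then have n: "t < (\<Sum>i<n. norm (\<mu> (E i)))"
    by (simp add: ennreal_less_iff t_def s_def)
  have "(\<Sum>i<n. norm (\<mu> (E i))) \<le> (\<Sum>i<n. \<Sum>b\<in>Basis. \<bar>\<mu> (E i) \<bullet> b\<bar>)"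
    by (intro sum_mono norm_le_l1)
  also have "\<dots> = (\<Sum>b\<in>Basis. \<Sum>i<n. \<bar>\<mu> (E i) \<bullet> b\<bar>)"
    by (rule sum.swap)
  finally have "\<exists>b\<in>Basis. s < (\<Sum>i<n. \<bar>\<mu> (E i) \<bullet> b\<bar>)"
    using n sum_bounded_above[of "Basis::'b set" "\<lambda>b. \<Sum>i<n. \<bar>\<mu> (E i) \<bullet> b\<bar>" s]
    by (fastforce simp: t_def not_less)
  then obtain b where b: "b \<in> Basis" "s < (\<Sum>i<n. \<bar>\<mu> (E i) \<bullet> b\<bar>)"
    by blast
  define P where "P = {i. i < n \<and> 0 \<le> \<mu> (E i) \<bullet> b}"
  define R where "R = {i. i < n \<and> \<mu> (E i) \<bullet> b < 0}"
  have fin: "finite P" "finite R" by (auto simp: P_def R_def)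
  have "(\<Sum>i<n. \<bar>\<mu> (E i) \<bullet> b\<bar>) = (\<Sum>i\<in>P \<union> R. \<bar>\<mu> (E i) \<bullet> b\<bar>)"
    by (rule sum.cong) (auto simp: P_def R_def)
  also have "\<dots> = (\<Sum>i\<in>P. \<bar>\<mu> (E i) \<bullet> b\<bar>) + (\<Sum>i\<in>R. \<bar>\<mu> (E i) \<bullet> b\<bar>)"
    by (rule sum.union_disjoint) (auto simp: P_def R_def)
  also have "(\<Sum>i\<in>P. \<bar>\<mu> (E i) \<bullet> b\<bar>) = \<bar>\<Sum>i\<in>P. \<mu> (E i) \<bullet> b\<bar>"
    by (subst abs_of_nonneg) (auto simp: P_def intro!: sum_nonneg)
  also have "(\<Sum>i\<in>R. \<bar>\<mu> (E i) \<bullet> b\<bar>) = \<bar>\<Sum>i\<in>R. \<mu> (E i) \<bullet> b\<bar>"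
    by (subst abs_of_nonpos) (auto simp: R_def sum_negf[symmetric] intro!: sum_nonpos)
  finally have "\<exists>J. finite J \<and> s / 2 < \<bar>\<Sum>i\<in>J. \<mu> (E i) \<bullet> b\<bar>"
    using b(2) fin by (smt (verit) field_sum_of_halves)
  then obtain J where J: "finite J" "s / 2 < \<bar>\<Sum>i\<in>J. \<mu> (E i) \<bullet> b\<bar>"
    by blast
  define B where "B = (\<Union>i\<in>J. E i)"
  have B: "B \<in> sets borel" "B \<subseteq> A"
    using E J(1) by (auto simp: B_def intro!: sets.finite_UN)
  have "\<mu> B = (\<Sum>i\<in>J. \<mu> (E i))"
    unfolding B_def using E J(1) by (intro vm_finite_UN[OF \<mu>]) (auto simp: disjoint_family_on_def)
  then have "s / 2 < \<bar>\<mu> B \<bullet> b\<bar>"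
    using J(2) by (simp add: inner_sum_left)
  also have "\<dots> \<le> norm (\<mu> B)"
    by (rule Basis_le_norm[OF b(1)])
  finally have nB: "1 + norm (\<mu> A) < norm (\<mu> B)"
    by (simp add: s_def)
  have nAB: "1 \<le> norm (\<mu> (A - B))"
    using nB norm_triangle_ineq2[of "\<mu> B" "\<mu> A"] vm_Diff[OF \<mu> A B] by (simp add: norm_minus_commute)
  have "emeasure (total_variation \<mu>) (B \<union> (A - B)) =
      emeasure (total_variation \<mu>) B + emeasure (total_variation \<mu>) (A - B)"
    using A B by (intro plus_emeasure[symmetric]) auto
  then have "variation \<mu> A = variation \<mu> B + variation \<mu> (A - B)"
    using A B by (simp add: emeasure_total_variation \<mu> Un_absorb1)
  then have "variation \<mu> B = \<infinity> \<or> variation \<mu> (A - B) = \<infinity>"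
    using inf by (metis ennreal_add_eq_top infinity_ennreal_def)
  then show ?thesis
  proof
    assume "variation \<mu> B = \<infinity>"
    with B nAB show ?thesis by (intro that[of B])
  next
    assume "variation \<mu> (A - B) = \<infinity>"
    moreover have "A - (A - B) = B"
      using B(2) by auto
    ultimately show ?thesis
      using A B nB by (intro that[of "A - B"]) (auto intro: order_trans[OF _ less_imp_le[OF nB]])
  qed
qed

text \<open>Otherwise pieces of norm at least 1 could be split off forever; they are disjoint, and
  countable additivity makes their values tend to 0.\<close>

lemma finite_total_variation:
  fixes \<mu> :: "'a::topological_space set \<Rightarrow> 'b::euclidean_space"
  assumes \<mu>: "vector_measure \<mu>"
  shows "finite_measure (total_variation \<mu>)"
proof (rule ccontr)
  assume "\<not> ?thesis"
  then have inf: "variation \<mu> UNIV = \<infinity>"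
    using emeasure_total_variation[OF \<mu>, of UNIV] by (auto intro: finite_measureI)
  have "\<exists>B. \<forall>n::nat. (B n \<in> sets borel \<and> variation \<mu> (B n) = \<infinity>) \<and>
      (B (Suc n) \<subseteq> B n \<and> 1 \<le> norm (\<mu> (B n - B (Suc n))))"
  proof (rule dependent_nat_choice)
    show "\<exists>B. B \<in> sets borel \<and> variation \<mu> B = \<infinity>"
      using inf by auto
    fix A n assume "A \<in> sets borel \<and> variation \<mu> A = \<infinity>"
    then show "\<exists>B. (B \<in> sets borel \<and> variation \<mu> B = \<infinity>) \<and> (B \<subseteq> A \<and> 1 \<le> norm (\<mu> (A - B)))"
      using vm_large_piece[OF \<mu>, of A] by metis
  qed
  then obtain B :: "nat \<Rightarrow> 'a set" where B: "\<And>n. B n \<in> sets borel" "\<And>n. B (Suc n) \<subseteq> B n"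
    "\<And>n. 1 \<le> norm (\<mu> (B n - B (Suc n)))"
    by blast
  have dec: "B n \<subseteq> B m" if "m \<le> n" for m n
    using lift_Suc_antimono_le[of B] B(2) that by blast
  have "(\<lambda>n. \<mu> (B n - B (Suc n))) sums \<mu> (\<Union>n. B n - B (Suc n))"
  proof (rule vm_sums[OF \<mu>])
    show "disjoint_family (\<lambda>n. B n - B (Suc n))"
      unfolding disjoint_family_on_def
    proof (intro ballI impI)
      fix m n :: nat assume "m \<noteq> n"
      then have "Suc m \<le> n \<or> Suc n \<le> m" by linarith
      then show "(B m - B (Suc m)) \<inter> (B n - B (Suc n)) = {}"
        using dec by blast
    qed
  qed (use B(1) in auto)
  then have "(\<lambda>n. \<mu> (B n - B (Suc n))) \<longlonglongrightarrow> 0"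
    by (simp add: summable_LIMSEQ_zero sums_iff)
  then have "(\<lambda>n. norm (\<mu> (B n - B (Suc n)))) \<longlonglongrightarrow> norm (0::'b)"
    by (rule tendsto_norm)
  then have "1 \<le> norm (0::'b)"
    using B(3) by (intro LIMSEQ_le_const) auto
  then show False by simp
qed

section \<open>Densities, Radon-Nikodym and the polar decomposition\<close>

lemma set_lebesgue_integral_sums:
  fixes g :: "'a \<Rightarrow> 'b::{banach, second_countable_topology}"
  assumes g: "integrable M g" and A: "range A \<subseteq> sets M" "disjoint_family (A :: nat \<Rightarrow> 'a set)"
  shows "(\<lambda>i. LINT x:A i|M. g x) sums (LINT x:(\<Union>i. A i)|M. g x)"
proof -
  have int: "set_integrable M B g" if "B \<in> sets M" for B
    using g that by (simp add: set_integrable_def integrable_mult_indicator)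
  have "(\<Sum>i<n. LINT x:A i|M. g x) = (LINT x:(\<Union>i<n. A i)|M. g x)" for n
    using A by (intro set_integral_finite_Union[symmetric] int) (auto simp: disjoint_family_on_def)
  moreover have "(\<lambda>n. LINT x:(\<Union>i<n. A i)|M. g x) \<longlonglongrightarrow> (LINT x:(\<Union>n. \<Union>i<n. A i)|M. g x)"
  proof (rule set_integral_cont_up)
    show "incseq (\<lambda>n. \<Union>i<n. A i)"
      by (intro monoI UN_mono) auto
    show "set_integrable M (\<Union>n. \<Union>i<n. A i) g"
      using A(1) by (intro int) auto
  qed (use A(1) in auto)
  moreover have "(\<Union>n. \<Union>i<n. A i) = (\<Union>i. A i)"
    by auto
  ultimately show ?thesis
    by (simp add: sums_def)
qed

lemma vector_measure_density:
  assumes "integrable M g" "sets M = sets borel"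
  shows "vector_measure (vm_density M g)"
  unfolding vector_measure_def vm_density_def
  using assms(2) by (intro allI impI set_lebesgue_integral_sums[OF assms(1)]) simp_all

lemma vector_measure_cong:
  assumes "\<And>A. A \<in> sets borel \<Longrightarrow> \<mu> A = \<nu> A"
  shows "vector_measure \<mu> \<longleftrightarrow> vector_measure \<nu>"
proof -
  have "\<mu> (A i) = \<nu> (A i)" "\<mu> (\<Union>i. A i) = \<nu> (\<Union>i. A i)" if "range A \<subseteq> sets borel" for A :: "nat \<Rightarrow> _" and i
    using that by (auto intro!: assms sets.countable_UN)
  then show ?thesis
    unfolding vector_measure_def by (intro arg_cong[where f = All] ext imp_cong) auto
qed

lemma norm_set_integral_le:
  fixes g :: "'a \<Rightarrow> 'b::{banach, second_countable_topology}"
  assumes "integrable M g" "A \<in> sets M"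
  shows "ennreal (norm (LINT x:A|M. g x)) \<le> emeasure (density M (\<lambda>x. norm (g x))) A"
proof -
  have "norm (LINT x:A|M. g x) \<le> (\<integral>x. norm (indicator A x *\<^sub>R g x) \<partial>M)"
    unfolding set_lebesgue_integral_def by (rule integral_norm_bound)
  then have "ennreal (norm (LINT x:A|M. g x)) \<le> ennreal (\<integral>x. norm (indicator A x *\<^sub>R g x) \<partial>M)"
    by (rule ennreal_leI)
  also have "\<dots> = (\<integral>\<^sup>+x. norm (indicator A x *\<^sub>R g x) \<partial>M)"
    using assms by (intro nn_integral_eq_integral[symmetric] integrable_norm integrable_mult_indicator) auto
  also have "\<dots> = (\<integral>\<^sup>+x. ennreal (norm (g x)) * indicator A x \<partial>M)"
    by (intro nn_integral_cong) (auto simp: indicator_def)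
  also have "\<dots> = emeasure (density M (\<lambda>x. norm (g x))) A"
    using assms by (subst emeasure_density) auto
  finally show ?thesis .
qed

lemma emeasure_density_norm_le_variation:
  fixes g :: "'a::topological_space \<Rightarrow> 'b::euclidean_space"
  assumes M: "finite_measure M" "sets M = sets borel" and g: "integrable M g" and A: "A \<in> sets borel"
  shows "emeasure (density M (\<lambda>x. norm (g x))) A \<le> variation (vm_density M g) A"
proof (rule ennreal_le_epsilon)
  interpret finite_measure M by fact
  note [measurable_cong] = M(2)
  have [measurable]: "g \<in> borel_measurable M" "A \<in> sets M"
    using g A M(2) by auto
  fix e :: real assume "0 < e"
  \<comment> \<open>The total error \<open>2 * d * measure M A\<close> is at most \<open>e\<close>;
    adding 1 avoids division by zero for a null measure.\<close>
  define d where "d = e / (2 * (1 + measure M UNIV))"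
  have d: "d > 0" using \<open>0 < e\<close> by (auto simp: d_def intro!: divide_pos_pos add_pos_nonneg)
  obtain Q :: "'b set" where Q: "countable Q" "\<And>x e. 0 < e \<Longrightarrow> \<exists>q\<in>Q. dist q x < e"
    using countable_dense_points[where 'a='b] by metis
  have Qne: "Q \<noteq> {}" using Q(2)[of 1] by auto
  define q where "q = from_nat_into Q"
  have q: "\<exists>i. dist (q i) x < d" for x
    using Q(2)[OF d] from_nat_into_surj[OF Q(1)] unfolding q_def by metis
  define idx where "idx = (\<lambda>x. LEAST i. dist (q i) (g x) < d)"
  have [measurable]: "idx \<in> M \<rightarrow>\<^sub>M count_space UNIV"
    unfolding idx_def by measurable
  define E where "E = (\<lambda>i. A \<inter> {x \<in> space M. idx x = i})"
  have E_M: "E i \<in> sets M" for i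
    unfolding E_def by measurable
  have spM: "space M = UNIV"
    using sets_eq_imp_space_eq[OF M(2)] by simp
  have E: "range E \<subseteq> sets borel" "disjoint_family E" "(\<Union>i. E i) = A"
  proof -
    show "range E \<subseteq> sets borel"
      using E_M M(2) by blast
    show "disjoint_family E"
      unfolding disjoint_family_on_def E_def by blast
    show "(\<Union>i. E i) = A"
      unfolding E_def spM by blast
  qed
  have near: "dist (q i) (g x) < d" if "x \<in> E i" for i x
    using that LeastI_ex[OF q[of "g x"]] by (auto simp: E_def idx_def)
  have piece: "(\<integral>\<^sup>+x. ennreal (norm (g x)) * indicator (E i) x \<partial>M)
      \<le> ennreal (norm (vm_density M g (E i))) + ennreal (2 * d) * emeasure M (E i)" for i
  proof -
    have int: "set_integrable M (E i) g" "set_integrable M (E i) (\<lambda>x. q i)"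
      using g E_M[of i] by (auto simp: set_integrable_def integrable_mult_indicator)
    have intE: "integrable M (indicator (E i) :: 'a \<Rightarrow> real)"
      using E_M[of i] by (simp add: less_top[symmetric])
    have c: "(LINT x:E i|M. q i) = measure M (E i) *\<^sub>R q i"
      using intE by (simp add: set_lebesgue_integral_def spM)
    have "norm ((LINT x:E i|M. g x) - (LINT x:E i|M. q i)) \<le> measure M (E i) * d"
    proof -
      have "norm ((LINT x:E i|M. g x) - (LINT x:E i|M. q i)) = norm (LINT x:E i|M. g x - q i)"
        using int by (simp add: set_integral_diff)
      also have "\<dots> \<le> (\<integral>x. norm (indicator (E i) x *\<^sub>R (g x - q i)) \<partial>M)"
        unfolding set_lebesgue_integral_def by (rule integral_norm_bound)
      also have "\<dots> \<le> (\<integral>x. indicator (E i) x * d \<partial>M)"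
      proof (rule integral_mono)
        show "integrable M (\<lambda>x. norm (indicator (E i) x *\<^sub>R (g x - q i)))"
          using set_integral_diff(1)[OF int] unfolding set_integrable_def by (rule integrable_norm)
        show "integrable M (\<lambda>x. indicator (E i) x * d)"
          using intE by (rule integrable_mult_left)
        show "norm (indicator (E i) x *\<^sub>R (g x - q i)) \<le> indicator (E i) x * d" for x
          using near[of x i] by (cases "x \<in> E i") (simp_all add: dist_norm norm_minus_commute less_imp_le)
      qed
      finally show ?thesis
        using E_M[of i] by (simp add: spM)
    qed
    moreover have "norm (LINT x:E i|M. q i) - norm (LINT x:E i|M. g x)
        \<le> norm ((LINT x:E i|M. g x) - (LINT x:E i|M. q i))"
      by (subst norm_minus_commute) (rule norm_triangle_ineq2)
    moreover have "norm (LINT x:E i|M. q i) = norm (q i) * measure M (E i)"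
      by (simp add: c)
    ultimately have *: "norm (q i) * measure M (E i) \<le> norm (vm_density M g (E i)) + d * measure M (E i)"
      by (simp add: vm_density_def mult.commute)
    have "(\<integral>\<^sup>+x. ennreal (norm (g x)) * indicator (E i) x \<partial>M) \<le> (\<integral>\<^sup>+x. ennreal (norm (q i) + d) * indicator (E i) x \<partial>M)"
    proof (intro nn_integral_mono)
      fix x
      show "ennreal (norm (g x)) * indicator (E i) x \<le> ennreal (norm (q i) + d) * indicator (E i) x"
        using near[of x i] norm_triangle_ineq2[of "g x" "q i"]
        by (auto simp: indicator_def dist_norm norm_minus_commute intro!: ennreal_leI)
    qed
    also have "\<dots> = ennreal (norm (q i) + d) * emeasure M (E i)"
      using E_M[of i] by (rule nn_integral_cmult_indicator)
    also have "\<dots> = ennreal ((norm (q i) + d) * measure M (E i))"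
      using d by (simp add: emeasure_eq_measure ennreal_mult)
    also have "\<dots> \<le> ennreal (norm (vm_density M g (E i)) + 2 * d * measure M (E i))"
      using * by (intro ennreal_leI) (simp add: algebra_simps)
    also have "\<dots> = ennreal (norm (vm_density M g (E i))) + ennreal (2 * d) * emeasure M (E i)"
      using d by (simp add: emeasure_eq_measure ennreal_mult)
    finally show ?thesis .
  qed
  have "emeasure (density M (\<lambda>x. norm (g x))) A = (\<Sum>i. emeasure (density M (\<lambda>x. norm (g x))) (E i))"
    using E M(2) by (subst suminf_emeasure) auto
  also have "\<dots> = (\<Sum>i. \<integral>\<^sup>+x. ennreal (norm (g x)) * indicator (E i) x \<partial>M)"
    using E_M by (simp add: emeasure_density)
  also have "\<dots> \<le> (\<Sum>i. ennreal (norm (vm_density M g (E i))) + ennreal (2 * d) * emeasure M (E i))"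
    by (intro suminf_le summableI piece)
  also have "\<dots> = (\<Sum>i. ennreal (norm (vm_density M g (E i)))) + ennreal (2 * d) * (\<Sum>i. emeasure M (E i))"
    by (simp add: suminf_add[symmetric])
  also have "(\<Sum>i. emeasure M (E i)) = emeasure M A"
    using E M(2) by (subst suminf_emeasure) auto
  also have "(\<Sum>i. ennreal (norm (vm_density M g (E i)))) \<le> variation (vm_density M g) A"
    by (rule variation_upper[OF E])
  also have "ennreal (2 * d) * emeasure M A \<le> ennreal e"
  proof -
    have "2 * d * measure M A \<le> 2 * d * (1 + measure M UNIV)"
      using d bounded_measure[of A] spM by (intro mult_left_mono) auto
    also have "\<dots> = e"
      using measure_nonneg[of M UNIV] by (simp add: d_def divide_simps) (smt (verit) measure_nonneg)
    finally show ?thesis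
      using d by (simp add: emeasure_eq_measure ennreal_leI flip: ennreal_mult)
  qed
  finally show "emeasure (density M (\<lambda>x. norm (g x))) A \<le> variation (vm_density M g) A + ennreal e"
    by (simp add: add_left_mono add_right_mono)
qed

theorem total_variation_density:
  fixes g :: "'a::topological_space \<Rightarrow> 'b::euclidean_space"
  assumes M: "finite_measure M" "sets M = sets borel" and g: "integrable M g"
  shows "total_variation (vm_density M g) = density M (\<lambda>x. norm (g x))"
proof (rule measure_eqI)
  note vm = vector_measure_density[OF g M(2)]
  fix A assume "A \<in> sets (total_variation (vm_density M g))"
  then have A: "A \<in> sets borel" by simp
  show "emeasure (total_variation (vm_density M g)) A = emeasure (density M (\<lambda>x. norm (g x))) A"
  proof (rule antisym)
    show "emeasure (total_variation (vm_density M g)) A \<le> emeasure (density M (\<lambda>x. norm (g x))) A"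
      using M(2) g by (intro total_variation_minimal[OF vm _ A])
        (auto simp: vm_density_def intro!: norm_set_integral_le)
    show "emeasure (density M (\<lambda>x. norm (g x))) A \<le> emeasure (total_variation (vm_density M g)) A"
      using emeasure_density_norm_le_variation[OF M g A] by (simp add: emeasure_total_variation[OF vm A])
  qed
qed (simp add: M(2))

text \<open>Adding \<open>M\<close> to \<open>\<rho>\<close> gives a non-negative measure that is
  absolutely continuous with respect to \<open>M\<close>; subtracting 1 from its density recovers
  \<open>\<rho>\<close>.\<close>

lemma vm_radon_nikodym_component:
  fixes \<rho> :: "'a::topological_space set \<Rightarrow> real"
  assumes M: "finite_measure M" "sets M = sets borel"
    and sums: "\<And>A::nat \<Rightarrow> 'a set. range A \<subseteq> sets borel \<Longrightarrow> disjoint_family A \<Longrightarrow> (\<lambda>i. \<rho> (A i)) sums \<rho> (\<Union>i. A i)"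
    and le: "\<And>A. A \<in> sets borel \<Longrightarrow> \<bar>\<rho> A\<bar> \<le> measure M A"
  obtains g where "integrable M g" "\<And>A. A \<in> sets borel \<Longrightarrow> (LINT x:A|M. g x) = \<rho> A"
proof -
  interpret finite_measure M by fact
  have spM: "space M = UNIV"
    using sets_eq_imp_space_eq[OF M(2)] by simp
  define N where "N = measure_of UNIV (sets borel) (\<lambda>A. ennreal (\<rho> A + measure M A))"
  have N: "sets N = sets borel"
    using sets.sigma_sets_eq[of "borel :: 'a measure"] by (simp add: N_def)
  have spN: "space N = UNIV"
    by (simp add: N_def)
  have nonneg: "0 \<le> \<rho> A + measure M A" if "A \<in> sets borel" for A
    using le[OF that] by simp
  have emN: "emeasure N A = ennreal (\<rho> A + measure M A)" if A: "A \<in> sets borel" for A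
    unfolding N_def
  proof (rule emeasure_measure_of_sigma)
    show "sigma_algebra UNIV (sets (borel :: 'a measure))"
      using sets.sigma_algebra_axioms[of "borel :: 'a measure"] by simp
    show "positive (sets borel) (\<lambda>A. ennreal (\<rho> A + measure M A))"
      using le[of "{}"] by (simp add: positive_def)
    show "countably_additive (sets borel) (\<lambda>A. ennreal (\<rho> A + measure M A))"
    proof (rule countably_additiveI)
      fix A :: "nat \<Rightarrow> 'a set"
      assume A: "range A \<subseteq> sets borel" "disjoint_family A"
      have "(\<lambda>i. \<rho> (A i) + measure M (A i)) sums (\<rho> (\<Union>i. A i) + measure M (\<Union>i. A i))"
        using A M(2) by (intro sums_add sums finite_measure_UNION) auto
      then show "(\<Sum>i. ennreal (\<rho> (A i) + measure M (A i))) = ennreal (\<rho> (\<Union>(range A)) + measure M (\<Union>(range A)))"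
        using A by (intro suminf_ennreal_eq nonneg) auto
    qed
  qed (rule A)
  have fN: "finite_measure N"
    by (rule finite_measureI) (simp add: spN emN)
  have ac: "absolutely_continuous M N"
    unfolding absolutely_continuous_def
  proof
    fix A assume "A \<in> null_sets M"
    then have A: "A \<in> sets borel" "measure M A = 0"
      using M(2) by (auto simp: null_sets_def measure_def)
    with le[of A] show "A \<in> null_sets N"
      using N emN[of A] by (auto simp: null_sets_def)
  qed
  obtain D where D[measurable]: "D \<in> borel_measurable M" "\<And>x. 0 \<le> D x"
    and RN: "AE x in M. RN_deriv M N x = ennreal (D x)"
    using real_RN_deriv[OF fN ac] N M(2) by metis
  have "density M (RN_deriv M N) = N"
    using density_RN_deriv[OF ac] N M(2) by simp
  then have dens: "density M (\<lambda>x. ennreal (D x)) = N"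
    using density_cong[OF _ _ RN] by auto
  have intA: "integrable M (\<lambda>x. indicator A x *\<^sub>R D x)" and intvA: "(LINT x:A|M. D x) = measure N A" if A: "A \<in> sets borel" for A
  proof -
    have [measurable]: "A \<in> sets M" using A M(2) by simp
    have "integrable N (indicator A :: 'a \<Rightarrow> real)"
      using A N fN by (simp add: finite_measure.emeasure_finite less_top[symmetric])
    then show "integrable M (\<lambda>x. indicator A x *\<^sub>R D x)"
      unfolding dens[symmetric] by (subst (asm) integrable_density) (auto simp: D mult.commute)
    have "measure N A = (\<integral>x. indicator A x \<partial>N)"
      using A N spN by simp
    also have "\<dots> = (LINT x:A|M. D x)"
      unfolding dens[symmetric] set_lebesgue_integral_def
      by (subst integral_density) (auto simp: D mult.commute)
    finally show "(LINT x:A|M. D x) = measure N A" ..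
  qed
  show ?thesis
  proof (rule that[of "\<lambda>x. D x - 1"])
    have D': "integrable M D"
      using intA[of UNIV] by simp
    then show int: "integrable M (\<lambda>x. D x - 1)"
      by simp
    fix A :: "'a set" assume A: "A \<in> sets borel"
    then have AM: "A \<in> sets M" using M(2) by simp
    have "(LINT x:A|M. D x - 1) = (LINT x:A|M. D x) - (LINT x:A|M. 1)"
      unfolding set_lebesgue_integral_def
      using integrable_mult_indicator[OF AM D'] integrable_mult_indicator[OF AM, of "\<lambda>_. 1::real"]
      by (subst Bochner_Integration.integral_diff[symmetric]) (simp_all add: algebra_simps)
    also have "(LINT x:A|M. 1) = measure M A"
      using AM by (simp add: set_lebesgue_integral_def spM)
    also have "measure N A = \<rho> A + measure M A"
      using emN[OF A] nonneg[OF A] by (simp add: measure_def)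
    ultimately show "(LINT x:A|M. D x - 1) = \<rho> A"
      using intvA[OF A] \<open>measure N A = \<rho> A + measure M A\<close> by simp
  qed
qed

text \<open>The components are found separately, which gives no sharp bound on the norm of
  \<open>g\<close>; that bound comes from the averages of \<open>g\<close>, which lie in the closed
  unit ball.\<close>

theorem vm_radon_nikodym:
  fixes \<mu> :: "'a::topological_space set \<Rightarrow> 'b::euclidean_space"
  assumes M: "finite_measure M" "sets M = sets borel" and \<mu>: "vector_measure \<mu>"
    and le: "\<And>A. A \<in> sets borel \<Longrightarrow> ennreal (norm (\<mu> A)) \<le> emeasure M A"
  obtains g where "integrable M g" "\<And>A. A \<in> sets borel \<Longrightarrow> vm_density M g A = \<mu> A"
    "AE x in M. norm (g x) \<le> 1"
proof -
  interpret finite_measure M by fact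
  have spM: "space M = UNIV"
    using sets_eq_imp_space_eq[OF M(2)] by simp
  have nle: "norm (\<mu> A) \<le> measure M A" if "A \<in> sets borel" for A
    using le[OF that] by (simp add: emeasure_eq_measure)
  have "\<exists>g. integrable M g \<and> (\<forall>A\<in>sets borel. (LINT x:A|M. g x) = \<mu> A \<bullet> b)" if b: "b \<in> Basis" for b
  proof -
    have "\<bar>\<mu> A \<bullet> b\<bar> \<le> measure M A" if "A \<in> sets borel" for A
      using Basis_le_norm[OF b] nle[OF that] by (rule order_trans)
    moreover have "(\<lambda>i. \<mu> (A i) \<bullet> b) sums (\<mu> (\<Union>i. A i) \<bullet> b)"
      if "range A \<subseteq> sets borel" "disjoint_family A" for A :: "nat \<Rightarrow> 'a set"
      using vm_sums[OF \<mu> that] by (rule bounded_linear.sums[OF bounded_linear_inner_left])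
    ultimately show ?thesis
      by (rule_tac vm_radon_nikodym_component[OF M, where \<rho> = "\<lambda>A. \<mu> A \<bullet> b"]) auto
  qed
  then obtain G where G: "\<And>b. b \<in> Basis \<Longrightarrow> integrable M (G b)"
    "\<And>b A. b \<in> Basis \<Longrightarrow> A \<in> sets borel \<Longrightarrow> (LINT x:A|M. G b x) = \<mu> A \<bullet> b"
    by metis
  define g where "g = (\<lambda>x. \<Sum>b\<in>Basis. G b x *\<^sub>R b)"
  have int: "integrable M g"
    unfolding g_def using G(1) by auto
  have dens: "vm_density M g A = \<mu> A" if A: "A \<in> sets borel" for A
  proof -
    have "vm_density M g A = (\<integral>x. (\<Sum>b\<in>Basis. (indicator A x *\<^sub>R G b x) *\<^sub>R b) \<partial>M)"
      by (simp add: vm_density_def set_lebesgue_integral_def g_def scaleR_sum_right)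
    also have "\<dots> = (\<Sum>b\<in>Basis. (LINT x:A|M. G b x) *\<^sub>R b)"
      unfolding set_lebesgue_integral_def using A M(2) G(1)
      by (subst Bochner_Integration.integral_sum) (auto intro!: sum.cong integral_scaleR_left integrable_scaleR_left integrable_mult_indicator simp del: real_scaleR_def)
    also have "\<dots> = \<mu> A"
      using G(2)[OF _ A] by (simp add: euclidean_representation)
    finally show ?thesis .
  qed
  have "AE x in M. g x \<in> cball 0 1"
  proof (rule averaging_theorem[OF int])
    fix A assume A: "A \<in> sets M" "0 < measure M A"
    then have "norm (LINT x:A|M. g x) \<le> measure M A"
      using dens[of A] nle[of A] M(2) by (simp add: vm_density_def)
    with A(2) show "(1 / measure M A) *\<^sub>R (LINT x:A|M. g x) \<in> cball 0 1"
      by (simp add: field_simps)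
  qed simp
  then show ?thesis
    using int dens by (intro that[of g]) auto
qed

text \<open>\<open>vm_radon_nikodym\<close> shows that the choice in \<open>vm_RN_deriv\<close>
  succeeds. Norm 1 follows from uniqueness of densities: by \<open>total_variation_density\<close>,
  the norm of the polar density is a density of the total variation with respect to itself.\<close>

lemma polar_density:
  fixes \<mu> :: "'a::topological_space set \<Rightarrow> 'b::euclidean_space"
  assumes \<mu>: "vector_measure \<mu>"
  shows integrable_polar_density: "integrable (total_variation \<mu>) (polar_density \<mu>)"
    and vm_density_polar: "\<And>A. A \<in> sets borel \<Longrightarrow> vm_density (total_variation \<mu>) (polar_density \<mu>) A = \<mu> A"
    and norm_polar_density: "AE x in total_variation \<mu>. norm (polar_density \<mu> x) = 1"
proof -
  let ?M = "total_variation \<mu>"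
  interpret finite_measure ?M
    by (rule finite_total_variation[OF \<mu>])
  have "\<exists>g. integrable ?M g \<and> (\<forall>A\<in>sets ?M. vm_density ?M g A = \<mu> A)"
    by (rule vm_radon_nikodym[OF finite_measure_axioms _ \<mu> norm_le_total_variation[OF \<mu>]]) auto
  then have *: "integrable ?M (polar_density \<mu>) \<and> (\<forall>A\<in>sets ?M. vm_density ?M (polar_density \<mu>) A = \<mu> A)"
    unfolding vm_RN_deriv_def by (rule someI_ex)
  then show int: "integrable ?M (polar_density \<mu>)"
    and dens: "\<And>A. A \<in> sets borel \<Longrightarrow> vm_density ?M (polar_density \<mu>) A = \<mu> A"
    by auto
  have "density ?M (\<lambda>x. norm (polar_density \<mu> x)) = total_variation (vm_density ?M (polar_density \<mu>))"
    by (rule total_variation_density[symmetric]) (auto simp: int finite_measure_axioms)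
  also have "\<dots> = ?M"
    by (rule total_variation_cong) (rule dens)
  also have "\<dots> = density ?M (\<lambda>x. 1)"
    by (simp add: density_1)
  finally have "AE x in ?M. ennreal (norm (polar_density \<mu> x)) = 1"
    using int by (subst (asm) density_unique_iff) auto
  then show "AE x in ?M. norm (polar_density \<mu> x) = 1"
    by eventually_elim (simp add: ennreal_eq_1)
qed

text \<open>\<open>vm_integral\<close> is defined through the polar density, but restrictions and
  leaf measures come with other densities. Comparing integrals over all sets shows that
  \<open>g\<close> is \<open>norm (g x)\<close> times the polar density almost everywhere.\<close>

theorem vm_integral_density:
  fixes \<mu> :: "'a::topological_space set \<Rightarrow> 'b::euclidean_space"
  assumes M: "finite_measure M" "sets M = sets borel" and g: "integrable M g"
    and dens: "\<And>A. A \<in> sets borel \<Longrightarrow> \<mu> A = vm_density M g A"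
    and v[measurable]: "v \<in> borel_measurable borel"
  shows "vm_integral \<mu> v = (\<integral>x. v x \<bullet> g x \<partial>M)"
proof -
  note [measurable_cong] = M(2)
  have g'[measurable]: "g \<in> borel_measurable M" using g by auto
  have \<mu>: "vector_measure \<mu>"
    using vector_measure_cong[of \<mu> "vm_density M g", OF dens] vector_measure_density[OF g M(2)] by simp
  have TV: "total_variation \<mu> = density M (\<lambda>x. norm (g x))"
    using total_variation_cong[of \<mu> "vm_density M g", OF dens] total_variation_density[OF M g] by simp
  let ?h = "polar_density \<mu>"
  have inth: "integrable (density M (\<lambda>x. norm (g x))) ?h"
    using integrable_polar_density[OF \<mu>] TV by simp
  then have h[measurable]: "?h \<in> borel_measurable M"
    by (auto dest!: borel_measurable_integrable simp: measurable_density_eq1)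
  have int': "integrable M (\<lambda>x. norm (g x) *\<^sub>R ?h x)"
    using inth by (subst (asm) integrable_density) auto
  have "AE x in M. norm (g x) *\<^sub>R ?h x = g x"
  proof (rule sigma_finite_measure.density_unique_banach[OF _ int' g])
    show "sigma_finite_measure M"
      using M(1) by (simp add: finite_measure_def)
    fix A assume A: "A \<in> sets M"
    have "(LINT x:A|M. g x) = vm_density (total_variation \<mu>) ?h A"
      using vm_density_polar[OF \<mu>, of A] dens[of A] A M(2) by (simp add: vm_density_def)
    also have "\<dots> = (\<integral>x. indicator A x *\<^sub>R ?h x \<partial>density M (\<lambda>x. norm (g x)))"
      by (simp add: vm_density_def set_lebesgue_integral_def TV)
    also have "\<dots> = (\<integral>x. norm (g x) *\<^sub>R indicator A x *\<^sub>R ?h x \<partial>M)"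
      using A by (subst integral_density) auto
    also have "\<dots> = (LINT x:A|M. norm (g x) *\<^sub>R ?h x)"
      by (simp add: set_lebesgue_integral_def mult.commute)
    finally show "(LINT x:A|M. norm (g x) *\<^sub>R ?h x) = (LINT x:A|M. g x)" ..
  qed
  then have "AE x in M. v x \<bullet> g x = norm (g x) * (v x \<bullet> ?h x)"
    by eventually_elim (metis inner_scaleR_right)
  then have "(\<integral>x. v x \<bullet> g x \<partial>M) = (\<integral>x. norm (g x) * (v x \<bullet> ?h x) \<partial>M)"
    by (intro integral_cong_AE) auto
  also have "\<dots> = (\<integral>x. v x \<bullet> ?h x \<partial>density M (\<lambda>x. norm (g x)))"
    by (subst integral_density) auto
  finally show ?thesis
    unfolding vm_integral_def TV ..
qed

section \<open>Integration against transports\<close>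

text \<open>The constant \<open>c\<close> covers two uses: \<open>c = 1\<close> for the difference
  of the marginals of a transport, \<open>c = 0\<close> for an image measure. The weights
  \<open>k\<close> and \<open>l\<close> are signed, so the limit step of the induction on
  \<open>f\<close> uses dominated convergence, and \<open>f\<close> is kept bounded.\<close>

lemma marginal_integral_real:
  fixes f :: "'a::topological_space \<Rightarrow> real" and k :: "'a \<Rightarrow> real" and l :: "'c \<Rightarrow> real"
  assumes c: "\<bar>c\<bar> \<le> 1" and k: "integrable M k" and l: "integrable N l" and M: "sets M = sets borel"
    and p[measurable]: "p \<in> N \<rightarrow>\<^sub>M borel" and q[measurable]: "q \<in> N \<rightarrow>\<^sub>M borel"
    and ind: "\<And>A. A \<in> sets borel \<Longrightarrow>
      (\<integral>x. indicator A x * k x \<partial>M) = (\<integral>z. (indicator A (p z) - c * indicator A (q z)) * l z \<partial>N)"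
    and f: "f \<in> borel_measurable borel" and bdd: "\<And>x. \<bar>f x\<bar> \<le> B"
  shows "(\<integral>x. f x * k x \<partial>M) = (\<integral>z. (f (p z) - c * f (q z)) * l z \<partial>N)"
proof -
  note [measurable_cong] = M
  have [measurable]: "k \<in> borel_measurable M" "l \<in> borel_measurable N"
    using k l by auto
  have intM: "integrable M (\<lambda>x. f x * k x)" if [measurable]: "f \<in> borel_measurable borel" and b: "\<And>x. \<bar>f x\<bar> \<le> B" for f B
  proof (rule Bochner_Integration.integrable_bound[OF integrable_mult_right[OF integrable_norm[OF k], of B]])
    show "AE x in M. norm (f x * k x) \<le> norm (B * norm (k x))"
      by (auto simp: abs_mult intro!: mult_right_mono order_trans[OF b abs_ge_self])
  qed measurable
  have intN: "integrable N (\<lambda>z. (f (p z) - c * f (q z)) * l z)" if [measurable]: "f \<in> borel_measurable borel" and b: "\<And>x. \<bar>f x\<bar> \<le> B" for f B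
  proof (rule Bochner_Integration.integrable_bound[OF integrable_mult_right[OF integrable_norm[OF l], of "2 * B"]])
    have "\<bar>f (p z) - c * f (q z)\<bar> \<le> \<bar>2 * B\<bar>" for z
      using b[of "p z"] mult_mono[OF c b[of "q z"]] abs_triangle_ineq4[of "f (p z)" "c * f (q z)"]
      by (simp add: abs_mult)
    then show "AE z in N. norm ((f (p z) - c * f (q z)) * l z) \<le> norm (2 * B * norm (l z))"
      by (auto simp: abs_mult intro!: mult_right_mono)
  qed measurable
  have nonneg: "(\<integral>x. f x * k x \<partial>M) = (\<integral>z. (f (p z) - c * f (q z)) * l z \<partial>N)"
    if f: "f \<in> borel_measurable borel" "\<And>x. 0 \<le> f x" and "\<exists>B. \<forall>x. f x \<le> B" for f
    using f that(3)
  proof (induction f rule: borel_measurable_induct_real)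
    case (set A)
    then show ?case by (simp add: ind)
  next
    case (mult f a)
    show ?case
    proof (cases "a = 0")
      case False
      obtain B where B: "\<And>x. a * f x \<le> B"
        using mult.prems by blast
      have "f x \<le> B / a" for x
        using B[of x] False mult.hyps(1) by (simp add: field_simps)
      then have IH: "(\<integral>x. f x * k x \<partial>M) = (\<integral>z. (f (p z) - c * f (q z)) * l z \<partial>N)"
        using mult.IH by blast
      have "(\<integral>x. a * f x * k x \<partial>M) = a * (\<integral>x. f x * k x \<partial>M)"
        by (simp add: mult.assoc)
      also have "\<dots> = (\<integral>z. a * ((f (p z) - c * f (q z)) * l z) \<partial>N)"
        by (simp add: IH)
      also have "\<dots> = (\<integral>z. (a * f (p z) - c * (a * f (q z))) * l z \<partial>N)"
        by (intro Bochner_Integration.integral_cong) (auto simp: algebra_simps)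
      finally show ?thesis .
    qed simp
  next
    case (add f g)
    obtain B where B: "\<And>x. g x + f x \<le> B"
      using add.prems by blast
    have bf: "\<bar>f x\<bar> \<le> B" "\<bar>g x\<bar> \<le> B" for x
      using B[of x] add.hyps(2)[of x] add.hyps(4)[of x] by auto
    note m = add.hyps(1) add.hyps(3)
    have IH: "(\<integral>x. f x * k x \<partial>M) = (\<integral>z. (f (p z) - c * f (q z)) * l z \<partial>N)"
      using add.IH(1) bf(1) abs_le_D1 by blast
    have IH': "(\<integral>x. g x * k x \<partial>M) = (\<integral>z. (g (p z) - c * g (q z)) * l z \<partial>N)"
      using add.IH(2) bf(2) abs_le_D1 by blast
    have "(\<integral>x. (g x + f x) * k x \<partial>M) = (\<integral>x. g x * k x \<partial>M) + (\<integral>x. f x * k x \<partial>M)"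
      unfolding distrib_right
      by (rule Bochner_Integration.integral_add[OF intM[OF m(2) bf(2)] intM[OF m(1) bf(1)]])
    also have "\<dots> = (\<integral>z. (g (p z) - c * g (q z)) * l z + (f (p z) - c * f (q z)) * l z \<partial>N)"
      unfolding IH IH'
      by (rule Bochner_Integration.integral_add[OF intN[OF m(2) bf(2)] intN[OF m(1) bf(1)], symmetric])
    also have "\<dots> = (\<integral>z. ((g (p z) + f (p z)) - c * (g (q z) + f (q z))) * l z \<partial>N)"
      by (simp add: algebra_simps)
    finally show ?case .
  next
    case (seq U)
    obtain B where B: "\<And>x. f x \<le> B"
      using seq.prems by blast
    have [measurable]: "U i \<in> borel_measurable borel" for i using seq.hyps(1) .
    have [measurable]: "f \<in> borel_measurable borel"
      by (rule that(1))
    have U_le: "U i x \<le> f x" for i x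
      using seq.hyps(3,4) by (intro incseq_le[of "\<lambda>i. U i x"]) (auto simp: mono_def le_fun_def)
    have bU: "\<bar>U i x\<bar> \<le> B" "\<bar>f x\<bar> \<le> B" for i x
      using U_le[of i x] B[of x] seq.hyps(2)[of i x] by auto
    have eq: "(\<integral>x. U i x * k x \<partial>M) = (\<integral>z. (U i (p z) - c * U i (q z)) * l z \<partial>N)" for i
      using seq.IH[of i] bU(1)[of i] abs_le_D1 by blast
    have 1: "(\<lambda>i. \<integral>x. U i x * k x \<partial>M) \<longlonglongrightarrow> (\<integral>x. f x * k x \<partial>M)"
    proof (rule integral_dominated_convergence[where w = "\<lambda>x. B * norm (k x)"])
      show "AE x in M. (\<lambda>i. U i x * k x) \<longlonglongrightarrow> f x * k x"
        using seq.hyps(4) by (auto intro!: tendsto_intros)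
      show "AE x in M. norm (U i x * k x) \<le> B * norm (k x)" for i
        using bU by (auto simp: abs_mult intro!: mult_right_mono)
    qed (use k in \<open>auto intro!: integrable_mult_right\<close>)
    have 2: "(\<lambda>i. \<integral>z. (U i (p z) - c * U i (q z)) * l z \<partial>N) \<longlonglongrightarrow> (\<integral>z. (f (p z) - c * f (q z)) * l z \<partial>N)"
    proof (rule integral_dominated_convergence[where w = "\<lambda>x. (2 * B) * norm (l x)"])
      show "AE z in N. (\<lambda>i. (U i (p z) - c * U i (q z)) * l z) \<longlonglongrightarrow> (f (p z) - c * f (q z)) * l z"
        using seq.hyps(4) by (auto intro!: tendsto_intros)
      have "\<bar>U i (p z) - c * U i (q z)\<bar> \<le> 2 * B" for i z
        using bU(1)[of i "p z"] mult_mono[OF c bU(1)[of i "q z"]] abs_triangle_ineq4[of "U i (p z)" "c * U i (q z)"]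
        by (simp add: abs_mult)
      then show "AE z in N. norm ((U i (p z) - c * U i (q z)) * l z) \<le> 2 * B * norm (l z)" for i
        by (auto simp: abs_mult intro!: mult_right_mono)
    qed (use l in \<open>auto intro!: integrable_mult_right\<close>)
    show ?case
      using LIMSEQ_unique[OF 1] 2 by (simp add: eq)
  qed
  have [measurable]: "f \<in> borel_measurable borel" by fact
  have B: "0 \<le> B" using bdd[of undefined] by simp
  \<comment> \<open>The induction covers non-negative functions; a bounded \<open>f\<close> is
    reached from \<open>f + B\<close> by subtracting the constant \<open>B\<close>.\<close>
  have cB: "(\<integral>x. B * k x \<partial>M) = (\<integral>z. (B - c * B) * l z \<partial>N)"
    by (rule nonneg) (use B in auto)
  have fB: "0 \<le> f x + B" "f x + B \<le> 2 * B" for x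
    using bdd[of x] by auto
  have "(\<integral>x. (f x + B) * k x \<partial>M) = (\<integral>z. ((f (p z) + B) - c * (f (q z) + B)) * l z \<partial>N)"
  proof (rule nonneg)
    show "\<exists>C. \<forall>x. f x + B \<le> C"
      using fB(2) by (intro exI[of _ "2 * B"]) simp
  qed (use fB(1) in auto)
  also have "\<dots> = (\<integral>z. (f (p z) - c * f (q z)) * l z + (B - c * B) * l z \<partial>N)"
    by (intro Bochner_Integration.integral_cong) (auto simp: algebra_simps)
  also have "\<dots> = (\<integral>z. (f (p z) - c * f (q z)) * l z \<partial>N) + (\<integral>z. (B - c * B) * l z \<partial>N)"
    by (rule Bochner_Integration.integral_add[OF intN[OF f bdd] integrable_mult_right[OF l]])
  finally have "(\<integral>x. (f x + B) * k x \<partial>M) = (\<integral>z. (f (p z) - c * f (q z)) * l z \<partial>N) + (\<integral>z. (B - c * B) * l z \<partial>N)" .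
  moreover have "(\<integral>x. (f x + B) * k x \<partial>M) = (\<integral>x. f x * k x \<partial>M) + (\<integral>x. B * k x \<partial>M)"
    unfolding distrib_right
    by (rule Bochner_Integration.integral_add[OF intM[OF f bdd] integrable_mult_right[OF k]])
  ultimately show ?thesis
    using cB by linarith
qed

lemma set_integral_inner_right:
  fixes g :: "'a \<Rightarrow> 'b::euclidean_space"
  assumes "integrable M g" "A \<in> sets M"
  shows "(\<integral>x. indicator A x * (g x \<bullet> b) \<partial>M) = (LINT x:A|M. g x) \<bullet> b"
proof -
  have "integrable M (\<lambda>x. indicator A x *\<^sub>R g x)"
    using assms by (intro integrable_mult_indicator)
  then have "(\<integral>x. (indicator A x *\<^sub>R g x) \<bullet> b \<partial>M) = (\<integral>x. indicator A x *\<^sub>R g x \<partial>M) \<bullet> b"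
    by (intro integral_inner_left)
  then show ?thesis
    by (simp add: set_lebesgue_integral_def)
qed

lemma inner_Basis_integral:
  fixes w g :: "'a \<Rightarrow> 'b::euclidean_space"
  assumes "\<And>b. b \<in> Basis \<Longrightarrow> integrable M (\<lambda>x. (w x \<bullet> b) * (g x \<bullet> b))"
  shows "(\<integral>x. w x \<bullet> g x \<partial>M) = (\<Sum>b\<in>Basis. \<integral>x. (w x \<bullet> b) * (g x \<bullet> b) \<partial>M)"
proof -
  have "(\<integral>x. w x \<bullet> g x \<partial>M) = (\<integral>x. (\<Sum>b\<in>Basis. (w x \<bullet> b) * (g x \<bullet> b)) \<partial>M)"
    by (intro Bochner_Integration.integral_cong refl euclidean_inner)
  also have "\<dots> = (\<Sum>b\<in>Basis. \<integral>x. (w x \<bullet> b) * (g x \<bullet> b) \<partial>M)"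
    using assms by (rule Bochner_Integration.integral_sum)
  finally show ?thesis .
qed

lemma integrable_bounded_inner:
  fixes w g :: "'a \<Rightarrow> 'b::euclidean_space"
  assumes g: "integrable M g" and [measurable]: "w \<in> borel_measurable M" and B: "\<And>x. norm (w x) \<le> B"
  shows "integrable M (\<lambda>x. w x \<bullet> g x)"
proof (rule Bochner_Integration.integrable_bound[OF integrable_mult_right[OF integrable_norm[OF g], of B]])
  have [measurable]: "g \<in> borel_measurable M" using g by auto
  show "(\<lambda>x. w x \<bullet> g x) \<in> borel_measurable M" by measurable
  show "AE x in M. norm (w x \<bullet> g x) \<le> norm (B * norm (g x))"
    using B Cauchy_Schwarz_ineq2[of "w _" "g _"]
    by (auto simp: abs_mult intro!: order_trans[OF Cauchy_Schwarz_ineq2] mult_right_mono order_trans[OF B])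
qed

lemma marginal_integral:
  fixes w k :: "'a::topological_space \<Rightarrow> 'b::euclidean_space"
  assumes c: "\<bar>c\<bar> \<le> 1" and k: "integrable M k" and l: "integrable N l" and M: "sets M = sets borel"
    and p[measurable]: "p \<in> N \<rightarrow>\<^sub>M borel" and q[measurable]: "q \<in> N \<rightarrow>\<^sub>M borel"
    and ind: "\<And>A. A \<in> sets borel \<Longrightarrow>
      (LINT x:A|M. k x) = (\<integral>z. (indicator A (p z) - c * indicator A (q z)) *\<^sub>R l z \<partial>N)"
    and w[measurable]: "w \<in> borel_measurable borel" and bdd: "\<And>x. norm (w x) \<le> B"
  shows "(\<integral>x. w x \<bullet> k x \<partial>M) = (\<integral>z. (w (p z) - c *\<^sub>R w (q z)) \<bullet> l z \<partial>N)"
proof -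
  note [measurable_cong] = M
  have [measurable]: "k \<in> borel_measurable M" "l \<in> borel_measurable N"
    using k l by auto
  have comp: "(\<integral>x. (w x \<bullet> b) * (k x \<bullet> b) \<partial>M) = (\<integral>z. (w (p z) \<bullet> b - c * (w (q z) \<bullet> b)) * (l z \<bullet> b) \<partial>N)"
    if b: "b \<in> Basis" for b
  proof (rule marginal_integral_real[OF c _ _ M p q])
    show "integrable M (\<lambda>x. k x \<bullet> b)" "integrable N (\<lambda>x. l x \<bullet> b)"
      using k l by auto
    show "\<bar>w x \<bullet> b\<bar> \<le> B" for x
      using Basis_le_norm[OF b] bdd by (rule order_trans)
    show "(\<lambda>x. w x \<bullet> b) \<in> borel_measurable borel" by measurable
    fix A :: "'a set" assume A: "A \<in> sets borel"
    then have [measurable]: "A \<in> sets M" "A \<in> sets borel" using M by auto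
    have "integrable N (\<lambda>z. (indicator A (p z) - c * indicator A (q z)) *\<^sub>R l z)"
    proof (rule Bochner_Integration.integrable_bound[OF integrable_scaleR_right[OF l, of 2]])
      have "\<bar>indicator A (p z) - c * indicator A (q z)\<bar> \<le> 2" for z
        using c by (auto simp: indicator_def)
      then show "AE z in N. norm ((indicator A (p z) - c * indicator A (q z)) *\<^sub>R l z) \<le> norm (2 *\<^sub>R l z)"
        by (auto intro!: mult_right_mono)
    qed measurable
    then have "(\<integral>z. (indicator A (p z) - c * indicator A (q z)) *\<^sub>R l z \<partial>N) \<bullet> b =
        (\<integral>z. (indicator A (p z) - c * indicator A (q z)) * (l z \<bullet> b) \<partial>N)"
      using integral_inner_left[of b N "\<lambda>z. (indicator A (p z) - c * indicator A (q z)) *\<^sub>R l z"] by simp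
    then show "(\<integral>x. indicator A x * (k x \<bullet> b) \<partial>M) = (\<integral>z. (indicator A (p z) - c * indicator A (q z)) * (l z \<bullet> b) \<partial>N)"
      using set_integral_inner_right[OF k, of A b] A M ind[OF A] by simp
  qed
  have intM: "integrable M (\<lambda>x. (w x \<bullet> b) * (k x \<bullet> b))" if b: "b \<in> Basis" for b
  proof -
    have "integrable M (\<lambda>x. (w x \<bullet> b) *\<^sub>R b \<bullet> k x)"
    proof (rule integrable_bounded_inner[OF k, where B = B])
      show "norm ((w x \<bullet> b) *\<^sub>R b) \<le> B" for x
        using Basis_le_norm[OF b, of "w x"] bdd[of x] b by simp
    qed measurable
    then show ?thesis
      by (simp add: inner_commute)
  qed
  have intN: "integrable N (\<lambda>z. ((w (p z) - c *\<^sub>R w (q z)) \<bullet> b) * (l z \<bullet> b))" if b: "b \<in> Basis" for b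
  proof -
    have "integrable N (\<lambda>z. ((w (p z) - c *\<^sub>R w (q z)) \<bullet> b) *\<^sub>R b \<bullet> l z)"
    proof (rule integrable_bounded_inner[OF l, where B = "2 * B"])
      have "norm (w (p z) - c *\<^sub>R w (q z)) \<le> 2 * B" for z
        using norm_triangle_ineq4[of "w (p z)" "c *\<^sub>R w (q z)"] bdd[of "p z"] mult_mono[OF c bdd[of "q z"]] by simp
      then show "norm (((w (p z) - c *\<^sub>R w (q z)) \<bullet> b) *\<^sub>R b) \<le> 2 * B" for z
        using Basis_le_norm[OF b, of "w (p z) - c *\<^sub>R w (q z)"] b by (auto intro: order_trans)
    qed measurable
    then show ?thesis
      by (simp add: inner_commute)
  qed
  have "(\<integral>x. w x \<bullet> k x \<partial>M) = (\<Sum>b\<in>Basis. \<integral>x. (w x \<bullet> b) * (k x \<bullet> b) \<partial>M)"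
    by (rule inner_Basis_integral[OF intM])
  also have "\<dots> = (\<Sum>b\<in>Basis. \<integral>z. ((w (p z) - c *\<^sub>R w (q z)) \<bullet> b) * (l z \<bullet> b) \<partial>N)"
    by (intro sum.cong refl) (simp add: comp inner_diff_left)
  also have "\<dots> = (\<integral>z. (w (p z) - c *\<^sub>R w (q z)) \<bullet> l z \<partial>N)"
    by (rule inner_Basis_integral[OF intN, symmetric])
  finally show ?thesis .
qed

lemma borel_measurable_fst_snd [measurable]:
  "fst \<in> borel_measurable (borel :: ('a::euclidean_space \<times> 'b::euclidean_space) measure)"
  "snd \<in> borel_measurable (borel :: ('a::euclidean_space \<times> 'b::euclidean_space) measure)"
  by (rule borel_measurable_continuous_onI[OF continuous_on_fst[OF continuous_on_id]])
     (rule borel_measurable_continuous_onI[OF continuous_on_snd[OF continuous_on_id]])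

lemma transport_sets_borel:
  fixes A :: "'a::euclidean_space set"
  assumes "A \<in> sets borel"
  shows "A \<times> UNIV \<in> sets (borel :: ('a \<times> 'a) measure)" "UNIV \<times> A \<in> sets (borel :: ('a \<times> 'a) measure)"
  by (rule borel_Times[OF assms], simp) (rule borel_Times[OF _ assms], simp)

lemma transport_integral_bounded:
  fixes \<mu> :: "'a::euclidean_space set \<Rightarrow> 'b::euclidean_space"
  assumes \<mu>: "vector_measure \<mu>" and \<pi>: "\<pi> \<in> transports \<mu>"
    and w: "w \<in> borel_measurable borel" and bdd: "\<And>x. norm (w x) \<le> B"
  shows "(\<integral>x. w x \<bullet> polar_density \<mu> x \<partial>total_variation \<mu>) =
    (\<integral>z. (w (fst z) - w (snd z)) \<bullet> polar_density \<pi> z \<partial>total_variation \<pi>)"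
proof (rule marginal_integral[where c = 1, OF _ _ _ _ _ _ _ w bdd, simplified])
  have \<pi>': "vector_measure \<pi>" "\<And>A. A \<in> sets borel \<Longrightarrow> \<pi> (A \<times> UNIV) - \<pi> (UNIV \<times> A) = \<mu> A"
    using \<pi> by (auto simp: transports_def)
  let ?N = "total_variation \<pi>"
  show "integrable (total_variation \<mu>) (polar_density \<mu>)" "integrable ?N (polar_density \<pi>)"
    by (rule integrable_polar_density[OF \<mu>], rule integrable_polar_density[OF \<pi>'(1)])
  fix A :: "'a set" assume A: "A \<in> sets borel"
  note AB = transport_sets_borel[OF A]
  have int: "integrable ?N (\<lambda>z. indicator C z *\<^sub>R polar_density \<pi> z)" if "C \<in> sets borel" for C
    using that integrable_polar_density[OF \<pi>'(1)] by (intro integrable_mult_indicator) auto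
  have "(LINT x:A|total_variation \<mu>. polar_density \<mu> x) = \<mu> A"
    using vm_density_polar[OF \<mu> A] by (simp add: vm_density_def)
  also have "\<dots> = \<pi> (A \<times> UNIV) - \<pi> (UNIV \<times> A)"
    using \<pi>'(2)[OF A] ..
  also have "\<dots> = (LINT z:A \<times> UNIV|?N. polar_density \<pi> z) - (LINT z:UNIV \<times> A|?N. polar_density \<pi> z)"
    using vm_density_polar[OF \<pi>'(1)] AB by (simp add: vm_density_def)
  also have "\<dots> = (\<integral>z. indicator (A \<times> UNIV) z *\<^sub>R polar_density \<pi> z - indicator (UNIV \<times> A) z *\<^sub>R polar_density \<pi> z \<partial>?N)"
    unfolding set_lebesgue_integral_def by (intro Bochner_Integration.integral_diff[symmetric] int AB)
  also have "\<dots> = (\<integral>z. (indicator A (fst z) - indicator A (snd z)) *\<^sub>R polar_density \<pi> z \<partial>?N)"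
    by (intro Bochner_Integration.integral_cong) (auto simp: indicator_def scaleR_diff_left)
  finally show "(LINT x:A|total_variation \<mu>. polar_density \<mu> x) =
    (\<integral>z. (indicator A (fst z) - indicator A (snd z)) *\<^sub>R polar_density \<pi> z \<partial>?N)" .
qed auto

section \<open>Lipschitz integrands and weak duality\<close>

lemma integrable_lipschitz_of_norm:
  fixes v :: "'a::euclidean_space \<Rightarrow> 'b::euclidean_space"
  assumes M: "finite_measure M" "sets M = sets borel" and x0: "integrable M (\<lambda>x. norm (x - x0))"
    and v: "L-lipschitz_on UNIV v"
  shows "integrable M (\<lambda>x. norm (v x))"
proof -
  interpret finite_measure M by fact
  note [measurable_cong] = M(2)
  have [measurable]: "v \<in> borel_measurable borel"
    using lipschitz_on_continuous_on[OF v] by (rule borel_measurable_continuous_onI)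
  show ?thesis
  proof (rule Bochner_Integration.integrable_bound)
    show "integrable M (\<lambda>x. norm (v x0) + L * norm (x - x0))"
      using x0 by auto
    have "norm (v x) \<le> norm (v x0) + L * norm (x - x0)" for x
      using lipschitz_onD[OF v, of x x0] norm_triangle_sub[of "v x" "v x0"] by (simp add: dist_norm)
    then show "AE x in M. norm (norm (v x)) \<le> norm (norm (v x0) + L * norm (x - x0))"
      using lipschitz_on_nonneg[OF v] by auto
  qed measurable
qed

text \<open>The base point in \<open>W1_space\<close> can be moved, because the total variation is
  finite and a change of \<open>x0\<close> alters the distance by a bounded amount.\<close>

lemma W1_spaceD:
  assumes "\<mu> \<in> W1_space"
  shows "vector_measure \<mu>" "\<mu> UNIV = 0" "integrable (total_variation \<mu>) (\<lambda>x. norm (x - x0))"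
proof -
  show vm: "vector_measure \<mu>" and "\<mu> UNIV = 0"
    using assms by (auto simp: W1_space_def)
  obtain x1 where x1: "integrable (total_variation \<mu>) (\<lambda>x. norm (x - x1))"
    using assms by (auto simp: W1_space_def)
  have lip: "1-lipschitz_on UNIV (\<lambda>x. x - x0)"
    by (intro lipschitz_onI) (auto simp: dist_norm)
  show "integrable (total_variation \<mu>) (\<lambda>x. norm (x - x0))"
    by (rule integrable_lipschitz_of_norm[OF finite_total_variation[OF vm] _ x1 lip]) simp
qed

lemma integrable_lipschitz_inner:
  fixes v :: "'a::euclidean_space \<Rightarrow> 'b::euclidean_space"
  assumes \<mu>: "\<mu> \<in> W1_space" and v: "L-lipschitz_on UNIV v"
  shows "integrable (total_variation \<mu>) (\<lambda>x. v x \<bullet> polar_density \<mu> x)"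
proof (rule Bochner_Integration.integrable_bound)
  note vm = W1_spaceD(1)[OF \<mu>]
  have [measurable]: "v \<in> borel_measurable borel" "polar_density \<mu> \<in> borel_measurable borel"
    using lipschitz_on_continuous_on[OF v] integrable_polar_density[OF vm]
    by (auto intro: borel_measurable_continuous_onI)
  show "integrable (total_variation \<mu>) (\<lambda>x. norm (v x))"
    using integrable_lipschitz_of_norm[OF finite_total_variation[OF vm] _ W1_spaceD(3)[OF \<mu>, of 0] v] by simp
  show "(\<lambda>x. v x \<bullet> polar_density \<mu> x) \<in> borel_measurable (total_variation \<mu>)"
    by measurable
  show "AE x in total_variation \<mu>. norm (v x \<bullet> polar_density \<mu> x) \<le> norm (norm (v x))"
    using norm_polar_density[OF vm]
  proof eventually_elim
    case (elim x)
    then show ?case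
      using Cauchy_Schwarz_ineq2[of "v x" "polar_density \<mu> x"] by simp
  qed
qed

lemma integrable_transport_distance:
  fixes \<pi> :: "('a::euclidean_space \<times> 'a) set \<Rightarrow> 'b::euclidean_space"
  assumes "transport_cost \<pi> < \<infinity>"
  shows "integrable (total_variation \<pi>) (\<lambda>z. norm (fst z - snd z))"
    and "transport_cost \<pi> = ennreal (\<integral>z. norm (fst z - snd z) \<partial>total_variation \<pi>)"
proof -
  have *: "transport_cost \<pi> = (\<integral>\<^sup>+z. ennreal (norm (fst z - snd z)) \<partial>total_variation \<pi>)"
    unfolding transport_cost_def case_prod_unfold ..
  have meas: "(\<lambda>z. norm (fst z - snd z)) \<in> borel_measurable (total_variation \<pi>)"
    by measurable
  then show int: "integrable (total_variation \<pi>) (\<lambda>z. norm (fst z - snd z))"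
    using assms by (intro integrableI_bounded) (auto simp: *)
  show "transport_cost \<pi> = ennreal (\<integral>z. norm (fst z - snd z) \<partial>total_variation \<pi>)"
    unfolding * using int by (intro nn_integral_eq_integral) auto
qed

text \<open>The separate integrals of \<open>v (fst z)\<close> and \<open>v (snd z)\<close> need not exist, hence the truncation
  of \<open>v\<close> by the projection onto a large ball.\<close>

theorem transport_integral_lipschitz:
  fixes \<mu> :: "'a::euclidean_space set \<Rightarrow> 'b::euclidean_space"
  assumes \<mu>: "\<mu> \<in> W1_space" and \<pi>: "\<pi> \<in> transports \<mu>" and fin: "transport_cost \<pi> < \<infinity>"
    and v: "1-lipschitz_on UNIV v"
  shows "integrable (total_variation \<pi>) (\<lambda>z. (v (fst z) - v (snd z)) \<bullet> polar_density \<pi> z)"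
    and "vm_integral \<mu> v = (\<integral>z. (v (fst z) - v (snd z)) \<bullet> polar_density \<pi> z \<partial>total_variation \<pi>)"
proof -
  note vm = W1_spaceD(1)[OF \<mu>]
  have vm\<pi>: "vector_measure \<pi>" using \<pi> by (simp add: transports_def)
  let ?M = "total_variation \<mu>" and ?N = "total_variation \<pi>"
  have v_m[measurable]: "v \<in> borel_measurable borel"
    using lipschitz_on_continuous_on[OF v] by (rule borel_measurable_continuous_onI)
  have [measurable]: "polar_density \<mu> \<in> borel_measurable borel" "polar_density \<pi> \<in> borel_measurable borel"
    using integrable_polar_density[OF vm] integrable_polar_density[OF vm\<pi>] by auto
  define w where "w = (\<lambda>(n::nat) x. closest_point (cball 0 (real n)) (v x))"
  have cp: "dist (closest_point (cball 0 (real n)) x) (closest_point (cball 0 (real n)) y) \<le> dist x y" for n and x y :: 'b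
    by (rule closest_point_lipschitz) auto
  have w_m[measurable]: "w n \<in> borel_measurable borel" for n
  proof -
    have "1-lipschitz_on UNIV (w n)"
      unfolding w_def
    proof (rule lipschitz_onI)
      show "dist (closest_point (cball 0 (real n)) (v x)) (closest_point (cball 0 (real n)) (v y)) \<le> 1 * dist x y" for x y
        using cp[of n "v x" "v y"] lipschitz_onD[OF v, of x y] by simp
    qed simp
    then show ?thesis
      using lipschitz_on_continuous_on by (auto intro: borel_measurable_continuous_onI)
  qed
  have w_bdd: "norm (w n x) \<le> n" for n x
    using closest_point_in_set[of "cball (0::'b) (real n)" "v x"] by (simp add: w_def)
  have w_le: "norm (w n x) \<le> norm (v x)" for n x
    using cp[of n "v x" 0] closest_point_self[of "0::'b" "cball 0 (real n)"] by (simp add: w_def)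
  have w_lip: "norm (w n x - w n y) \<le> norm (x - y)" for n x y
    using cp[of n "v x" "v y"] lipschitz_onD[OF v, of x y] by (simp add: w_def dist_norm)
  have w_lim: "(\<lambda>n. w n x) \<longlonglongrightarrow> v x" for x
  proof (rule tendsto_eventually)
    obtain N :: nat where N: "norm (v x) \<le> N" using real_arch_simple by blast
    have "w n x = v x" if "n \<ge> N" for n
      unfolding w_def by (rule closest_point_self) (use N that in auto)
    then show "\<forall>\<^sub>F n in sequentially. w n x = v x"
      by (auto simp: eventually_sequentially)
  qed
  have 1: "(\<lambda>n. \<integral>x. w n x \<bullet> polar_density \<mu> x \<partial>?M) \<longlonglongrightarrow> (\<integral>x. v x \<bullet> polar_density \<mu> x \<partial>?M)"
  proof (rule integral_dominated_convergence[where w = "\<lambda>x. norm (v x)"])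
    show "integrable ?M (\<lambda>x. norm (v x))"
      using integrable_lipschitz_of_norm[OF finite_total_variation[OF vm] _ W1_spaceD(3)[OF \<mu>, of 0] v] by simp
    show "AE x in ?M. (\<lambda>n. w n x \<bullet> polar_density \<mu> x) \<longlonglongrightarrow> v x \<bullet> polar_density \<mu> x"
      using w_lim by (auto intro!: tendsto_intros)
    show "AE x in ?M. norm (w n x \<bullet> polar_density \<mu> x) \<le> norm (v x)" for n
      using norm_polar_density[OF vm]
    proof eventually_elim
      case (elim x)
      then show ?case
        using Cauchy_Schwarz_ineq2[of "w n x" "polar_density \<mu> x"] w_le[of n x] by simp
    qed
  qed measurable
  \<comment> \<open>Non-expansiveness of the projection bounds all truncated differences by
    \<open>norm (fst z - snd z)\<close>, which is integrable by finiteness of the cost. A cut-off by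
    an indicator would not preserve this bound.\<close>
  have dom: "AE z in ?N. norm ((w n (fst z) - w n (snd z)) \<bullet> polar_density \<pi> z) \<le> norm (fst z - snd z)" for n
    using norm_polar_density[OF vm\<pi>]
  proof eventually_elim
    case (elim z)
    then show ?case
      using Cauchy_Schwarz_ineq2[of "w n (fst z) - w n (snd z)" "polar_density \<pi> z"] w_lip[of n "fst z" "snd z"] by simp
  qed
  have lim: "AE z in ?N. (\<lambda>n. (w n (fst z) - w n (snd z)) \<bullet> polar_density \<pi> z) \<longlonglongrightarrow> (v (fst z) - v (snd z)) \<bullet> polar_density \<pi> z"
    using w_lim by (auto intro!: tendsto_intros)
  have m1: "(\<lambda>z. (v (fst z) - v (snd z)) \<bullet> polar_density \<pi> z) \<in> borel_measurable ?N"
    and m2: "\<And>n. (\<lambda>z. (w n (fst z) - w n (snd z)) \<bullet> polar_density \<pi> z) \<in> borel_measurable ?N"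
    by measurable
  have 2: "(\<lambda>n. \<integral>z. (w n (fst z) - w n (snd z)) \<bullet> polar_density \<pi> z \<partial>?N) \<longlonglongrightarrow>
      (\<integral>z. (v (fst z) - v (snd z)) \<bullet> polar_density \<pi> z \<partial>?N)"
    by (rule integral_dominated_convergence[OF m1 m2 integrable_transport_distance(1)[OF fin] lim dom])
  show "integrable ?N (\<lambda>z. (v (fst z) - v (snd z)) \<bullet> polar_density \<pi> z)"
    by (rule integrable_dominated_convergence[OF m1 m2 integrable_transport_distance(1)[OF fin] lim dom])
  show "vm_integral \<mu> v = (\<integral>z. (v (fst z) - v (snd z)) \<bullet> polar_density \<pi> z \<partial>?N)"
    unfolding vm_integral_def
    using LIMSEQ_unique[OF 1] 2 transport_integral_bounded[OF vm \<pi> w_m w_bdd] by simp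
qed

lemma weak_duality:
  fixes \<mu> :: "'a::euclidean_space set \<Rightarrow> 'b::euclidean_space"
  assumes \<mu>: "\<mu> \<in> W1_space" and \<pi>: "\<pi> \<in> transports \<mu>" and v: "1-lipschitz_on UNIV v"
  shows "ennreal (vm_integral \<mu> v) \<le> transport_cost \<pi>"
proof (cases "transport_cost \<pi> < \<infinity>")
  case True
  have vm\<pi>: "vector_measure \<pi>" using \<pi> by (simp add: transports_def)
  have "vm_integral \<mu> v \<le> (\<integral>z. norm (fst z - snd z) \<partial>total_variation \<pi>)"
    unfolding transport_integral_lipschitz(2)[OF \<mu> \<pi> True v]
  proof (intro integral_mono_AE transport_integral_lipschitz(1)[OF \<mu> \<pi> True v] integrable_transport_distance(1)[OF True])
    show "AE z in total_variation \<pi>. (v (fst z) - v (snd z)) \<bullet> polar_density \<pi> z \<le> norm (fst z - snd z)"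
      using norm_polar_density[OF vm\<pi>]
    proof eventually_elim
      case (elim z)
      then show ?case
        using norm_cauchy_schwarz[of "v (fst z) - v (snd z)" "polar_density \<pi> z"] lipschitz_onD[OF v, of "fst z" "snd z"]
        by (simp add: dist_norm)
    qed
  qed
  then show ?thesis
    by (simp add: integrable_transport_distance(2)[OF True] ennreal_leI)
qed (simp add: not_less top.extremum_unique)

section \<open>Strong duality\<close>

text \<open>Finite sums of dipoles are handled as functions on points, and Hahn-Banach is stated for
  a real vector space; pointwise scaling turns the functions into one.\<close>

instantiation "fun" :: (type, real_vector) real_vector
begin

definition scaleR_fun :: "real \<Rightarrow> ('a \<Rightarrow> 'b) \<Rightarrow> 'a \<Rightarrow> 'b" where
  "scaleR_fun c f = (\<lambda>x. c *\<^sub>R f x)"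

instance
  by standard (auto simp: scaleR_fun_def fun_eq_iff scaleR_add_right scaleR_add_left)

end

lemma scaleR_fun_apply [simp]: "(c *\<^sub>R f) x = c *\<^sub>R f x"
  by (simp add: scaleR_fun_def)

text \<open>Homogeneity is demanded as an inequality for positive factors; scaling back by the
  inverse gives equality in \<open>sublinear_on_scale\<close>.\<close>

definition sublinear_on :: "'v::real_vector set \<Rightarrow> ('v \<Rightarrow> real) \<Rightarrow> bool" where
  "sublinear_on S q \<longleftrightarrow> (\<forall>f\<in>S. \<forall>g\<in>S. q (f + g) \<le> q f + q g) \<and> (\<forall>c>0. \<forall>f\<in>S. q (c *\<^sub>R f) \<le> c * q f)"

lemma sublinear_on_add: "sublinear_on S q \<Longrightarrow> f \<in> S \<Longrightarrow> g \<in> S \<Longrightarrow> q (f + g) \<le> q f + q g"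
  by (simp add: sublinear_on_def)

lemma sublinear_on_scale:
  assumes "subspace S" "sublinear_on S q" "f \<in> S" "0 < c"
  shows "q (c *\<^sub>R f) = c * q f"
proof (rule antisym)
  show "q (c *\<^sub>R f) \<le> c * q f"
    using assms by (simp add: sublinear_on_def)
  have "q (inverse c *\<^sub>R (c *\<^sub>R f)) \<le> inverse c * q (c *\<^sub>R f)"
    using assms subspace_scale[OF assms(1,3), of c] unfolding sublinear_on_def by (meson positive_imp_inverse_positive)
  then show "c * q f \<le> q (c *\<^sub>R f)"
    using assms(4) by (simp add: field_simps)
qed

lemma sublinear_on_0:
  assumes "subspace S" "sublinear_on S q"
  shows "q 0 = 0"
  using sublinear_on_scale[OF assms subspace_0[OF assms(1)], of 2] by simp

lemma sublinear_on_minus: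
  assumes "subspace S" "sublinear_on S q" "f \<in> S"
  shows "- q (- f) \<le> q f"
  using sublinear_on_add[OF assms(2,3) subspace_neg[OF assms(1,3)]] sublinear_on_0[OF assms(1,2)] by simp

lemma le_cINF_add:
  fixes a :: "'i \<Rightarrow> real" and b :: "'j \<Rightarrow> real"
  assumes "X \<noteq> {}" "Y \<noteq> {}" "\<And>s t. s \<in> X \<Longrightarrow> t \<in> Y \<Longrightarrow> c \<le> a s + b t"
  shows "c \<le> (INF s\<in>X. a s) + (INF t\<in>Y. b t)"
proof -
  have "c - a s \<le> (INF t\<in>Y. b t)" if "s \<in> X" for s
    using assms(3)[OF that] by (intro cINF_greatest assms(2)) (simp add: algebra_simps)
  then have "c - (INF t\<in>Y. b t) \<le> (INF s\<in>X. a s)"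
    by (intro cINF_greatest assms(1)) (simp add: algebra_simps)
  then show ?thesis
    by simp
qed

text \<open>A sublinear functional that admits no smaller one is additive: otherwise it could be lowered
  along some direction \<open>y\<close>.\<close>

lemma sublinear_on_lower:
  assumes S: "subspace S" and q: "sublinear_on S q" and y: "y \<in> S"
  obtains r where "sublinear_on S r" "\<And>f. f \<in> S \<Longrightarrow> r f \<le> q f" "\<And>f. f \<in> S \<Longrightarrow> r f \<le> q (f + y) - q y"
    "\<And>f. f \<notin> S \<Longrightarrow> r f = 0"
proof -
  define a where "a = (\<lambda>f t. q (f + t *\<^sub>R y) - t * q y)"
  \<comment> \<open>The parameter \<open>t = 0\<close> shows that \<open>r\<close> lies below
    \<open>q\<close>, \<open>t = 1\<close> gives the bound by \<open>q (f + y) - q y\<close>, and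
    subadditivity bounds the infimum from below by \<open>- q (- f)\<close>.\<close>
  define r where "r = (\<lambda>f. if f \<in> S then (INF t\<in>{0..}. a f t) else 0)"
  have in_S: "f + t *\<^sub>R y \<in> S" if "f \<in> S" for f t
    using S y that by (intro subspace_add subspace_scale)
  have lower: "- q (- f) \<le> a f t" if f: "f \<in> S" and t: "0 \<le> t" for f t
  proof (cases "t = 0")
    case True
    then show ?thesis
      using sublinear_on_minus[OF S q f] by (simp add: a_def)
  next
    case False
    then have "q (t *\<^sub>R y) = t * q y"
      using t by (intro sublinear_on_scale[OF S q y]) auto
    moreover have "q ((f + t *\<^sub>R y) + (- f)) \<le> q (f + t *\<^sub>R y) + q (- f)"
      by (intro sublinear_on_add[OF q] in_S f subspace_neg[OF S])
    ultimately show ?thesis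
      by (simp add: a_def)
  qed
  then have bdd: "bdd_below (a f ` {0..})" if "f \<in> S" for f
    using that by (intro bdd_belowI[of _ "- q (- f)"]) auto
  have le: "r f \<le> a f t" if "f \<in> S" "0 \<le> t" for f t
    using that bdd[OF that(1)] by (simp add: r_def cINF_lower)
  show ?thesis
  proof (rule that[of r])
    show "sublinear_on S r"
      unfolding sublinear_on_def
    proof (intro conjI ballI allI impI)
      fix f g assume f: "f \<in> S" and g: "g \<in> S"
      have fg: "f + g \<in> S" using S f g by (rule subspace_add)
      have "r (f + g) \<le> a f s + a g t" if "0 \<le> s" "0 \<le> t" for s t
      proof -
        have "r (f + g) \<le> a (f + g) (s + t)"
          using that by (intro le fg) simp
        also have "\<dots> = q ((f + s *\<^sub>R y) + (g + t *\<^sub>R y)) - (s + t) * q y"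
          by (simp add: a_def algebra_simps)
        also have "\<dots> \<le> a f s + a g t"
          using sublinear_on_add[OF q in_S[OF f, of s] in_S[OF g, of t]] by (simp add: a_def algebra_simps)
        finally show ?thesis .
      qed
      then have "r (f + g) \<le> (INF t\<in>{0..}. a f t) + (INF t\<in>{0..}. a g t)"
        by (intro le_cINF_add) auto
      then show "r (f + g) \<le> r f + r g"
        using f g by (simp add: r_def)
    next
      fix c :: real and f assume c: "0 < c" and f: "f \<in> S"
      have cf: "c *\<^sub>R f \<in> S" using S f by (rule subspace_scale)
      have "r (c *\<^sub>R f) / c \<le> a f t" if "0 \<le> t" for t
      proof -
        have "r (c *\<^sub>R f) \<le> a (c *\<^sub>R f) (c * t)"
          using c that by (intro le cf) simp
        also have "\<dots> = q (c *\<^sub>R (f + t *\<^sub>R y)) - c * t * q y"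
          by (simp add: a_def algebra_simps)
        also have "\<dots> = c * a f t"
          by (simp add: sublinear_on_scale[OF S q in_S[OF f] c] a_def right_diff_distrib)
        finally show ?thesis
          using c by (simp add: field_simps)
      qed
      then have "r (c *\<^sub>R f) / c \<le> (INF t\<in>{0..}. a f t)"
        by (intro cINF_greatest) auto
      then show "r (c *\<^sub>R f) \<le> c * r f"
        using c f by (simp add: r_def field_simps)
    qed
    show "r f \<le> q f" if "f \<in> S" for f
      using le[OF that, of 0] by (simp add: a_def)
    show "r f \<le> q (f + y) - q y" if "f \<in> S" for f
      using le[OF that, of 1] by (simp add: a_def)
    show "r f = 0" if "f \<notin> S" for f
      using that by (simp add: r_def)
  qed
qed

text \<open>Lowering \<open>p\<close> along \<open>y\<close> in advance forces every sublinear
  minorant \<open>m\<close> of the result to satisfy \<open>m (- y) \<le> - p y\<close>. A minimal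
  one is additive by \<open>sublinear_on_lower\<close>, hence reaches the full value
  \<open>p y\<close> at \<open>y\<close>.\<close>

theorem hahn_banach_norming:
  fixes p :: "'v::real_vector \<Rightarrow> real"
  assumes S: "subspace S" and p: "sublinear_on S p" and y: "y \<in> S"
  obtains L where "\<And>f g. f \<in> S \<Longrightarrow> g \<in> S \<Longrightarrow> L (f + g) = L f + L g"
    "\<And>c f. f \<in> S \<Longrightarrow> L (c *\<^sub>R f) = c * L f" "\<And>f. f \<in> S \<Longrightarrow> L f \<le> p f" "L y = p y"
proof -
  obtain p' where p': "sublinear_on S p'" "\<And>f. f \<in> S \<Longrightarrow> p' f \<le> p f"
    "\<And>f. f \<in> S \<Longrightarrow> p' f \<le> p (f + y) - p y" "\<And>f. f \<notin> S \<Longrightarrow> p' f = 0"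
    using sublinear_on_lower[OF S p y] by blast
  \<comment> \<open>Fixing the value 0 outside \<open>S\<close> makes the pointwise order on total
    functions agree with the order on \<open>S\<close>, so that minimality determines the whole
    function.\<close>
  define A where "A = {q. sublinear_on S q \<and> (\<forall>f\<in>S. q f \<le> p' f) \<and> (\<forall>f. f \<notin> S \<longrightarrow> q f = 0)}"
  have "\<exists>m\<in>A. \<forall>q\<in>A. q \<le> m \<longrightarrow> q = m"
  proof (rule predicate_Zorn[where P = "\<lambda>q1 q2. q2 \<le> q1"])
    show "partial_order_on A (relation_of (\<lambda>q1 q2. q2 \<le> q1) A)"
      by (auto simp: partial_order_on_def preorder_on_def refl_on_def trans_def antisym_def relation_of_def)
    fix C assume C: "C \<in> Chains (relation_of (\<lambda>q1 q2. q2 \<le> q1) A)"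
    have CA: "C \<subseteq> A" and chain: "\<And>q1 q2. q1 \<in> C \<Longrightarrow> q2 \<in> C \<Longrightarrow> q1 \<le> q2 \<or> q2 \<le> q1"
      using C by (auto simp: Chains_def relation_of_def)
    show "\<exists>u\<in>A. \<forall>a\<in>C. u \<le> a"
    proof (cases "C = {}")
      case True
      have "p' \<in> A" using p' by (simp add: A_def)
      with True show ?thesis by blast
    next
      case False
      define u where "u = (\<lambda>f. if f \<in> S then (INF q\<in>C. q f) else 0)"
      have sub: "sublinear_on S q" "\<And>f. f \<in> S \<Longrightarrow> q f \<le> p' f" "\<And>f. f \<notin> S \<Longrightarrow> q f = 0" if "q \<in> C" for q
        using that CA by (auto simp: A_def)
      have bdd: "bdd_below ((\<lambda>q. q f) ` C)" if f: "f \<in> S" for f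
      proof (intro bdd_belowI[of _ "- p' (- f)"])
        fix z assume "z \<in> (\<lambda>q. q f) ` C"
        then obtain q where q: "q \<in> C" "z = q f" by blast
        have "q (- f) \<le> p' (- f)"
          using sub(2)[OF q(1)] subspace_neg[OF S f] by blast
        then show "- p' (- f) \<le> z"
          using sublinear_on_minus[OF S sub(1)[OF q(1)] f] q(2) by simp
      qed
      have u_le: "u f \<le> q f" if "q \<in> C" "f \<in> S" for q f
        using cINF_lower[OF bdd[OF that(2)] that(1)] that(2) by (simp add: u_def)
      have "sublinear_on S u"
        unfolding sublinear_on_def
      proof (intro conjI ballI allI impI)
        fix f g assume f: "f \<in> S" and g: "g \<in> S"
        have fg: "f + g \<in> S" using S f g by (rule subspace_add)
        have "u (f + g) \<le> q1 f + q2 g" if q: "q1 \<in> C" "q2 \<in> C" for q1 q2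
        proof -
          obtain q where "q \<in> C" "q \<le> q1" "q \<le> q2"
            using chain[OF q] q by blast
          then have "u (f + g) \<le> q f + q g" "q f \<le> q1 f" "q g \<le> q2 g"
            using u_le[OF _ fg, of q] sublinear_on_add[OF sub(1) f g, of q] by (auto simp: le_fun_def intro: order_trans)
          then show ?thesis by linarith
        qed
        then have "u (f + g) \<le> (INF q\<in>C. q f) + (INF q\<in>C. q g)"
          using False by (intro le_cINF_add) auto
        then show "u (f + g) \<le> u f + u g"
          using f g by (simp add: u_def)
      next
        fix c :: real and f assume c: "0 < c" and f: "f \<in> S"
        have cf: "c *\<^sub>R f \<in> S" using S f by (rule subspace_scale)
        have "u (c *\<^sub>R f) / c \<le> q f" if "q \<in> C" for q
          using u_le[OF that cf] sublinear_on_scale[OF S sub(1)[OF that] f c] c by (simp add: field_simps)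
        then have "u (c *\<^sub>R f) / c \<le> (INF q\<in>C. q f)"
          using False by (intro cINF_greatest) auto
        then show "u (c *\<^sub>R f) \<le> c * u f"
          using c f by (simp add: u_def field_simps)
      qed
      moreover have "u f \<le> p' f" if "f \<in> S" for f
      proof -
        obtain q where "q \<in> C" using False by blast
        then show ?thesis
          using u_le[of q f] sub(2)[of q f] that by linarith
      qed
      ultimately have "u \<in> A"
        by (simp add: A_def u_def)
      moreover have "u \<le> q" if "q \<in> C" for q
        using u_le[OF that] sub(3)[OF that] by (auto simp: le_fun_def u_def)
      ultimately show ?thesis by blast
    qed
  qed
  then obtain m where m: "m \<in> A" and min: "\<And>q. q \<in> A \<Longrightarrow> q \<le> m \<Longrightarrow> q = m"
    by blast
  have m': "sublinear_on S m" "\<And>f. f \<in> S \<Longrightarrow> m f \<le> p' f" "\<And>f. f \<notin> S \<Longrightarrow> m f = 0"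
    using m by (auto simp: A_def)
  have add: "m (f + g) = m f + m g" if f: "f \<in> S" and g: "g \<in> S" for f g
  proof (rule antisym)
    show "m (f + g) \<le> m f + m g"
      by (rule sublinear_on_add[OF m'(1) f g])
    obtain r where r: "sublinear_on S r" "\<And>f. f \<in> S \<Longrightarrow> r f \<le> m f"
      "\<And>f. f \<in> S \<Longrightarrow> r f \<le> m (f + g) - m g" "\<And>f. f \<notin> S \<Longrightarrow> r f = 0"
      using sublinear_on_lower[OF S m'(1) g] by blast
    have "r \<in> A"
      using r m'(2) by (fastforce simp: A_def)
    moreover have "r h \<le> m h" for h
      using r(2)[of h] r(4)[of h] m'(3)[of h] by (cases "h \<in> S") auto
    ultimately have "r = m"
      by (intro min) (auto simp: le_fun_def)
    then show "m f + m g \<le> m (f + g)"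
      using r(3)[OF f] by simp
  qed
  have neg: "m (- f) = - m f" if "f \<in> S" for f
    using add[OF that subspace_neg[OF S that]] sublinear_on_0[OF S m'(1)] by simp
  have scale: "m (c *\<^sub>R f) = c * m f" if f: "f \<in> S" for c f
  proof -
    consider "c > 0" | "c = 0" | "- c > 0" by linarith
    then show ?thesis
    proof cases
      case 1
      then show ?thesis by (rule sublinear_on_scale[OF S m'(1) f])
    next
      case 2
      then show ?thesis by (simp add: sublinear_on_0[OF S m'(1)])
    next
      case 3
      then show ?thesis
        using sublinear_on_scale[OF S m'(1) f 3] neg[OF subspace_scale[OF S f, of c]] by simp
    qed
  qed
  have le: "m f \<le> p f" if "f \<in> S" for f
    using m'(2)[OF that] p'(2)[OF that] by linarith
  have "m (- y) \<le> p (- y + y) - p y"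
    using m'(2) p'(3) subspace_neg[OF S y] by (blast intro: order_trans)
  then have "p y \<le> m y"
    using neg[OF y] sublinear_on_0[OF S p] by simp
  then show ?thesis
    using add scale le y by (intro that[of m]) (auto intro: antisym)
qed

section \<open>Molecules of dipoles and duality for finitely supported data\<close>

text \<open>A list is a discrete transport plan moving vectors \<open>w\<close> between points
  \<open>x\<close> and \<open>y\<close>. The function records the difference of its marginals, so
  equal functions mean plans for the same data.\<close>

definition dipoles :: "('b::real_normed_vector \<times> 'a \<times> 'a) list \<Rightarrow> 'a \<Rightarrow> 'b" where
  "dipoles l = (\<lambda>z. \<Sum>(w, x, y)\<leftarrow>l. (if z = x then w else 0) - (if z = y then w else 0))"

definition dipole_cost :: "('b::real_normed_vector \<times> 'a::real_normed_vector \<times> 'a) list \<Rightarrow> real" where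
  "dipole_cost l = (\<Sum>(w, x, y)\<leftarrow>l. norm w * norm (x - y))"

text \<open>The vector-valued form of the Arens-Eells norm. Outside \<open>range dipoles\<close> it
  would be the infimum of an empty set, hence the restriction to that subspace below.\<close>

definition dipole_norm :: "('a::real_normed_vector \<Rightarrow> 'b::real_normed_vector) \<Rightarrow> real" where
  "dipole_norm f = (INF l\<in>{l. dipoles l = f}. dipole_cost l)"

lemma dipoles_Nil: "dipoles [] = 0"
  by (auto simp: dipoles_def fun_eq_iff)

lemma dipoles_append: "dipoles (l @ l') = dipoles l + dipoles l'"
  by (auto simp: dipoles_def fun_eq_iff)

lemma dipoles_Cons: "dipoles (a # l) = dipoles [a] + dipoles l"
  using dipoles_append[of "[a]" l] by simp

lemma dipoles_scale: "dipoles (map (\<lambda>(w, x, y). (c *\<^sub>R w, x, y)) l) = c *\<^sub>R dipoles l"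
proof (induction l)
  case (Cons a l)
  have "dipoles [(c *\<^sub>R w, x, y)] = c *\<^sub>R dipoles [(w, x, y)]" for w :: 'b and x y :: 'a
    by (auto simp: dipoles_def fun_eq_iff)
  then have "dipoles [case a of (w, x, y) \<Rightarrow> (c *\<^sub>R w, x, y)] = c *\<^sub>R dipoles [a]"
    by (cases a) auto
  with Cons show ?case
    by (simp only: list.map dipoles_Cons[of _ "map _ _"] dipoles_Cons[of a l] scaleR_add_right)
qed (simp add: dipoles_Nil)

lemma dipole_cost_append: "dipole_cost (l @ l') = dipole_cost l + dipole_cost l'"
  by (simp add: dipole_cost_def)

lemma dipole_cost_scale: "dipole_cost (map (\<lambda>(w, x, y). (c *\<^sub>R w, x, y)) l) = \<bar>c\<bar> * dipole_cost l"
  by (induction l) (auto simp: dipole_cost_def algebra_simps)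

lemma dipole_cost_nonneg: "0 \<le> dipole_cost l"
  unfolding dipole_cost_def by (intro sum_list_nonneg) auto

lemma subspace_dipoles: "subspace (range dipoles)"
proof (rule subspaceI)
  show "0 \<in> range dipoles"
    using dipoles_Nil by (rule range_eqI[OF sym])
  show "f + g \<in> range dipoles" if "f \<in> range dipoles" "g \<in> range dipoles" for f g :: "'a \<Rightarrow> 'b"
  proof -
    obtain l l' where "f = dipoles l" "g = dipoles l'" using \<open>f \<in> _\<close> \<open>g \<in> _\<close> by blast
    then show ?thesis by (simp only: dipoles_append[symmetric] rangeI)
  qed
  show "c *\<^sub>R f \<in> range dipoles" if "f \<in> range dipoles" for c and f :: "'a \<Rightarrow> 'b"
  proof -
    obtain l where "f = dipoles l" using \<open>f \<in> _\<close> by blast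
    then show ?thesis by (simp only: dipoles_scale[symmetric] rangeI)
  qed
qed

lemma bdd_below_dipole_cost: "bdd_below (dipole_cost ` X)"
  by (intro bdd_belowI[of _ 0]) (auto simp: dipole_cost_nonneg)

lemma dipole_norm_le: "dipole_norm (dipoles l) \<le> dipole_cost l"
  unfolding dipole_norm_def by (intro cINF_lower bdd_below_dipole_cost) auto

lemma sublinear_dipole_norm:
  "sublinear_on (range (dipoles :: ('b::real_normed_vector \<times> 'a::real_normed_vector \<times> 'a) list \<Rightarrow> 'a \<Rightarrow> 'b)) dipole_norm"
  unfolding sublinear_on_def
proof (intro conjI ballI allI impI)
  fix f g :: "'a \<Rightarrow> 'b"
  assume f: "f \<in> range dipoles" and g: "g \<in> range dipoles"
  show "dipole_norm (f + g) \<le> dipole_norm f + dipole_norm g"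
    unfolding dipole_norm_def[of f] dipole_norm_def[of g]
  proof (rule le_cINF_add)
    fix l l' assume "l \<in> {l. dipoles l = f}" "l' \<in> {l. dipoles l = g}"
    then show "dipole_norm (f + g) \<le> dipole_cost l + dipole_cost l'"
      using dipole_norm_le[of "l @ l'"] by (simp add: dipoles_append dipole_cost_append)
  qed (use f g in auto)
next
  fix c :: real and f :: "'a \<Rightarrow> 'b"
  assume c: "0 < c" and f: "f \<in> range dipoles"
  have "dipole_norm (c *\<^sub>R f) / c \<le> (INF l\<in>{l. dipoles l = f}. dipole_cost l)"
  proof (rule cINF_greatest)
    fix l assume "l \<in> {l. dipoles l = f}"
    then have "dipole_norm (c *\<^sub>R f) \<le> c * dipole_cost l"
      using dipole_norm_le[of "map (\<lambda>(w, x, y). (c *\<^sub>R w, x, y)) l"] c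
      by (simp only: dipoles_scale dipole_cost_scale) simp
    with c show "dipole_norm (c *\<^sub>R f) / c \<le> dipole_cost l"
      by (simp add: field_simps)
  qed (use f in auto)
  then show "dipole_norm (c *\<^sub>R f) \<le> c * dipole_norm f"
    using c by (simp add: dipole_norm_def[of f] field_simps)
qed

text \<open>The right-hand side integrates \<open>g\<close> against the molecule, so the left-hand
  side depends on \<open>dipoles l\<close> and not on the list. This transfers marginals from one
  plan to another.\<close>

lemma dipoles_test:
  fixes g :: "'a \<Rightarrow> real"
  assumes "finite Z" "\<And>w x y. (w, x, y) \<in> set l \<Longrightarrow> x \<in> Z \<and> y \<in> Z"
  shows "(\<Sum>(w, x, y)\<leftarrow>l. (g x - g y) *\<^sub>R w) = (\<Sum>z\<in>Z. g z *\<^sub>R dipoles l z)"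
  using assms(2)
proof (induction l)
  case (Cons a l)
  obtain w x y where a: "a = (w, x, y)" by (cases a)
  have xy: "x \<in> Z" "y \<in> Z"
    using Cons.prems[of w x y] a by auto
  have "(\<Sum>z\<in>Z. g z *\<^sub>R dipoles [a] z) = (\<Sum>z\<in>Z. (if z = x then g x *\<^sub>R w else 0) - (if z = y then g y *\<^sub>R w else 0))"
    by (rule sum.cong) (auto simp: dipoles_def a scaleR_diff_right)
  also have "\<dots> = (g x - g y) *\<^sub>R w"
    using xy assms(1) by (simp add: sum_subtractf scaleR_diff_left)
  finally have 1: "(\<Sum>z\<in>Z. g z *\<^sub>R dipoles [a] z) = (g x - g y) *\<^sub>R w" .
  have "(\<Sum>z\<in>Z. g z *\<^sub>R dipoles (a # l) z) = (\<Sum>z\<in>Z. g z *\<^sub>R dipoles [a] z) + (\<Sum>z\<in>Z. g z *\<^sub>R dipoles l z)"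
    by (subst dipoles_Cons) (simp add: scaleR_add_right sum.distrib)
  moreover have "(\<Sum>(w, x, y)\<leftarrow>l. (g x - g y) *\<^sub>R w) = (\<Sum>z\<in>Z. g z *\<^sub>R dipoles l z)"
    using Cons.IH Cons.prems list.set_intros(2) by metis
  ultimately show ?case
    using 1 by (simp add: a)
qed (simp add: dipoles_Nil)

text \<open>A functional norming \<open>dipoles l0\<close> is given on dipoles
  \<open>(w, x, 0)\<close> by the inner product of \<open>w\<close> with a vector
  \<open>v x\<close>. Its bound by the cost, tested with \<open>w = v x - v y\<close>, says that
  \<open>v\<close> is 1-Lipschitz. The slack \<open>e\<close> pays for an infimum that need not be
  attained.\<close>

lemma dipole_norm_dual:
  fixes l0 :: "('b::euclidean_space \<times> 'a::real_normed_vector \<times> 'a) list"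
  assumes "0 < e"
  obtains v l where "1-lipschitz_on UNIV v" "dipoles l = dipoles l0"
    "dipole_cost l \<le> (\<Sum>(w, x, y)\<leftarrow>l0. w \<bullet> (v x - v y)) + e"
proof -
  let ?S = "range (dipoles :: ('b \<times> 'a \<times> 'a) list \<Rightarrow> 'a \<Rightarrow> 'b)"
  obtain L where L: "\<And>f g. f \<in> ?S \<Longrightarrow> g \<in> ?S \<Longrightarrow> L (f + g) = L f + L g"
    "\<And>c f. f \<in> ?S \<Longrightarrow> L (c *\<^sub>R f) = c * L f" "\<And>f. f \<in> ?S \<Longrightarrow> L f \<le> dipole_norm f"
    "L (dipoles l0) = dipole_norm (dipoles l0)"
    by (rule hahn_banach_norming[OF subspace_dipoles sublinear_dipole_norm, of "dipoles l0"]) blast+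
  define K where "K = (\<lambda>x w. L (dipoles [(w, x, 0)]))"
  define v where "v = (\<lambda>x. adjoint (K x) 1)"
  have "linear (K x)" for x
  proof (rule linearI)
    show "K x (w + w') = K x w + K x w'" for w w'
    proof -
      have "dipoles [(w + w', x, 0)] = dipoles [(w, x, 0)] + dipoles [(w', x, 0)]"
        by (auto simp: dipoles_def fun_eq_iff)
      then show ?thesis
        using L(1) by (simp add: K_def)
    qed
    show "K x (c *\<^sub>R w) = c *\<^sub>R K x w" for c w
    proof -
      have "dipoles [(c *\<^sub>R w, x, 0)] = c *\<^sub>R dipoles [(w, x, 0)]"
        by (auto simp: dipoles_def fun_eq_iff)
      then show ?thesis
        using L(2) by (simp add: K_def)
    qed
  qed
  then have K: "K x w = w \<bullet> v x" for x w
    using adjoint_works[of "K x" w 1] by (simp add: v_def)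
  have single: "L (dipoles [(w, x, y)]) = w \<bullet> (v x - v y)" for w x y
  proof -
    have "dipoles [(w, x, y)] = dipoles [(w, x, 0)] + (- 1) *\<^sub>R dipoles [(w, y, 0)]"
      by (auto simp: dipoles_def fun_eq_iff)
    then have "L (dipoles [(w, x, y)]) = L (dipoles [(w, x, 0)]) + (- 1) * L (dipoles [(w, y, 0)])"
      using L(1)[of "dipoles [(w, x, 0)]" "(- 1) *\<^sub>R dipoles [(w, y, 0)]"] L(2)[of "dipoles [(w, y, 0)]" "- 1"]
        subspace_scale[OF subspace_dipoles, of "dipoles [(w, y, 0)]" "- 1"] by simp
    then show ?thesis
      using K by (simp add: K_def inner_diff_right)
  qed
  have lip: "1-lipschitz_on UNIV v"
  proof (rule lipschitz_onI)
    fix x y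
    let ?w = "v x - v y"
    have "?w \<bullet> ?w \<le> norm ?w * norm (x - y)"
      using L(3)[of "dipoles [(?w, x, y)]"] dipole_norm_le[of "[(?w, x, y)]"]
      unfolding single by (simp add: dipole_cost_def)
    then have "norm ?w * norm ?w \<le> norm ?w * norm (x - y)"
      by (simp add: power2_norm_eq_inner[symmetric] power2_eq_square)
    then show "dist (v x) (v y) \<le> 1 * dist x y"
      by (cases "norm ?w = 0") (auto simp: dist_norm)
  qed simp
  have "L (dipoles l) = (\<Sum>(w, x, y)\<leftarrow>l. w \<bullet> (v x - v y))" for l
  proof (induction l)
    case Nil
    have "(0 :: real) *\<^sub>R dipoles [] = (dipoles [] :: 'a \<Rightarrow> 'b)"
      by (simp add: fun_eq_iff dipoles_def)
    then have "L (dipoles []) = 0"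
      using L(2)[of "dipoles []" 0] by (metis mult_zero_left rangeI)
    then show ?case by simp
  next
    case (Cons a l)
    have "L (dipoles (a # l)) = L (dipoles [a]) + L (dipoles l)"
      by (subst dipoles_Cons) (intro L(1) rangeI)
    with Cons single show ?case
      by (cases a) simp
  qed
  then have Ll0: "dipole_norm (dipoles l0) = (\<Sum>(w, x, y)\<leftarrow>l0. w \<bullet> (v x - v y))"
    using L(4) by simp
  have "\<exists>l\<in>{l. dipoles l = dipoles l0}. dipole_cost l < dipole_norm (dipoles l0) + e"
    using cInf_lessD[of "dipole_cost ` {l. dipoles l = dipoles l0}" "dipole_norm (dipoles l0) + e"] assms
    by (auto simp: dipole_norm_def)
  then show ?thesis
    using that[OF lip] Ll0 by force
qed

section \<open>From molecules to measures\<close>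

lemma nn_integral_sum_measure:
  assumes P: "sets P = sets M" and N: "sets N = sets M"
    and em: "\<And>A. A \<in> sets M \<Longrightarrow> emeasure P A = emeasure M A + emeasure N A"
    and f: "f \<in> borel_measurable M"
  shows "nn_integral P f = nn_integral M f + nn_integral N f"
  using f
proof (induction rule: borel_measurable_induct)
  case (cong f g)
  have sp: "space P = space M" "space N = space M"
    using sets_eq_imp_space_eq P N by auto
  have "nn_integral P f = nn_integral P g" "nn_integral M f = nn_integral M g" "nn_integral N f = nn_integral N g"
    using cong(3) sp by (auto intro!: nn_integral_cong)
  with cong show ?case by simp
next
  case (set A)
  then show ?case using P N by (simp add: em)
next
  case (mult u c)
  then have "u \<in> borel_measurable P" "u \<in> borel_measurable N"
    using P N measurable_cong_sets[OF P refl] measurable_cong_sets[OF N refl] by blast+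
  with mult show ?case
    by (simp add: nn_integral_cmult distrib_left)
next
  case (add u v)
  then have "u \<in> borel_measurable P" "u \<in> borel_measurable N" "v \<in> borel_measurable P" "v \<in> borel_measurable N"
    using P N measurable_cong_sets[OF P refl] measurable_cong_sets[OF N refl] by blast+
  with add show ?case
    by (simp add: nn_integral_add ac_simps)
next
  case (seq U)
  have m: "U i \<in> borel_measurable M" "U i \<in> borel_measurable P" "U i \<in> borel_measurable N" for i
    using seq.hyps(1) measurable_cong_sets[OF P refl] measurable_cong_sets[OF N refl] by blast+
  have lim: "(\<lambda>i. U i x) \<longlonglongrightarrow> (SUP i. U i) x" for x
    using LIMSEQ_SUP[of "\<lambda>i. U i x"] seq.hyps(3) by (simp add: image_comp incseq_def le_fun_def)
  have 1: "(\<lambda>i. nn_integral P (U i)) \<longlonglongrightarrow> nn_integral P (SUP i. U i)"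
    by (rule nn_integral_LIMSEQ[OF seq.hyps(3) m(2) lim])
  have 2: "(\<lambda>i. nn_integral M (U i) + nn_integral N (U i)) \<longlonglongrightarrow> nn_integral M (SUP i. U i) + nn_integral N (SUP i. U i)"
    by (intro tendsto_add nn_integral_LIMSEQ[OF seq.hyps(3) _ lim] m)
  show ?case
    by (rule LIMSEQ_unique[OF 1[unfolded seq.IH] 2])
qed

lemma vector_measure_add:
  assumes "vector_measure \<mu>" "vector_measure \<nu>"
  shows "vector_measure (\<lambda>E. \<mu> E + \<nu> E)"
  using assms unfolding vector_measure_def by (simp add: sums_add)

lemma vector_measure_point: "vector_measure (\<lambda>E. indicator E p *\<^sub>R w)"
  unfolding vector_measure_def by (auto intro!: sums_scaleR_left indicator_sums simp: disjoint_family_on_def)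

lemma vector_measure_vimage:
  assumes \<mu>: "vector_measure \<mu>" and f: "f \<in> borel \<rightarrow>\<^sub>M borel"
  shows "vector_measure (\<lambda>E. \<mu> (f -` E))"
  unfolding vector_measure_def
proof (intro allI impI)
  fix A :: "nat \<Rightarrow> 'c set"
  assume A: "range A \<subseteq> sets borel \<and> disjoint_family A"
  have "(\<lambda>i. \<mu> (f -` A i)) sums \<mu> (\<Union>i. f -` A i)"
  proof (rule vm_sums[OF \<mu>])
    show "range (\<lambda>i. f -` A i) \<subseteq> sets borel"
      using A measurable_sets[OF f] by auto
    show "disjoint_family (\<lambda>i. f -` A i)"
      using A unfolding disjoint_family_on_def by blast
  qed
  then show "(\<lambda>i. \<mu> (f -` A i)) sums \<mu> (f -` (\<Union>i. A i))"
    by (simp add: vimage_UN)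
qed

text \<open>The variation of the sum is not computed: a measure \<open>M'\<close> dominating its
  norms is carried along the list, and \<open>total_variation_minimal\<close> later turns the bound
  on \<open>M'\<close> into a bound on the transport cost.\<close>

lemma dominated_add_dipoles:
  fixes \<pi> :: "('a::euclidean_space \<times> 'a) set \<Rightarrow> 'b::euclidean_space"
  assumes "vector_measure \<pi>" "sets M = sets borel" "\<And>E. E \<in> sets borel \<Longrightarrow> ennreal (norm (\<pi> E)) \<le> emeasure M E"
  shows "\<exists>M'. sets M' = sets borel \<and>
    vector_measure (\<lambda>E. \<pi> E + (\<Sum>(w, x, y)\<leftarrow>l. indicator E (x, y) *\<^sub>R w)) \<and>
    (\<forall>E\<in>sets borel. ennreal (norm (\<pi> E + (\<Sum>(w, x, y)\<leftarrow>l. indicator E (x, y) *\<^sub>R w))) \<le> emeasure M' E) \<and>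
    (\<integral>\<^sup>+z. norm (fst z - snd z) \<partial>M') \<le> (\<integral>\<^sup>+z. norm (fst z - snd z) \<partial>M) + ennreal (dipole_cost l)"
proof (induction l)
  case Nil
  then show ?case using assms by (intro exI[of _ M]) (simp add: dipole_cost_def)
next
  case (Cons a l)
  obtain w x y where a: "a = (w, x, y)" by (cases a)
  define F where "F = (\<lambda>E. \<pi> E + (\<Sum>(w, x, y)\<leftarrow>l. indicator E (x, y) *\<^sub>R w))"
  obtain M' where M': "sets M' = sets borel" "vector_measure F"
    "\<And>E. E \<in> sets borel \<Longrightarrow> ennreal (norm (F E)) \<le> emeasure M' E"
    "(\<integral>\<^sup>+z. norm (fst z - snd z) \<partial>M') \<le> (\<integral>\<^sup>+z. norm (fst z - snd z) \<partial>M) + ennreal (dipole_cost l)"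
    using Cons.IH unfolding F_def by blast
  have F': "\<pi> E + (\<Sum>(w, x, y)\<leftarrow>a # l. indicator E (x, y) *\<^sub>R w) = F E + indicator E (x, y) *\<^sub>R w" for E
    by (simp add: F_def a)
  define D where "D = density (return borel (x, y)) (\<lambda>_. ennreal (norm w))"
  have D: "sets D = sets borel" by (simp add: D_def)
  have emD: "emeasure D E = ennreal (norm w) * indicator E (x, y)" if "E \<in> sets borel" for E
    using that by (simp add: D_def emeasure_density nn_integral_return)
  have meas: "(\<lambda>z. ennreal (norm (fst z - snd z))) \<in> borel_measurable (borel :: ('a \<times> 'a) measure)"
    by measurable
  obtain P where P: "sets P = sets M'" "\<And>E. E \<in> sets M' \<Longrightarrow> emeasure P E = emeasure M' E + emeasure D E"
    using ex_sum_measure[of D M'] D M'(1) by auto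
  have "ennreal (norm (F E + indicator E (x, y) *\<^sub>R w)) \<le> emeasure P E" if E: "E \<in> sets borel" for E
  proof -
    have "ennreal (norm (F E + indicator E (x, y) *\<^sub>R w)) \<le> ennreal (norm (F E) + norm w * indicator E (x, y))"
      by (intro ennreal_leI order_trans[OF norm_triangle_ineq]) (simp add: mult.commute)
    also have "\<dots> = ennreal (norm (F E)) + ennreal (norm w) * indicator E (x, y)"
      by (simp add: indicator_def)
    also have "\<dots> \<le> emeasure P E"
      using P(2)[of E] M'(1,3) E by (simp add: emD add_right_mono)
    finally show ?thesis .
  qed
  moreover have "(\<integral>\<^sup>+z. norm (fst z - snd z) \<partial>P) \<le> (\<integral>\<^sup>+z. norm (fst z - snd z) \<partial>M) + ennreal (dipole_cost (a # l))"
  proof -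
    have "(\<integral>\<^sup>+z. norm (fst z - snd z) \<partial>P) = (\<integral>\<^sup>+z. norm (fst z - snd z) \<partial>M') + (\<integral>\<^sup>+z. norm (fst z - snd z) \<partial>D)"
      using meas M'(1) D P measurable_cong_sets[OF M'(1) refl, of borel] by (intro nn_integral_sum_measure) auto
    also have "(\<integral>\<^sup>+z. norm (fst z - snd z) \<partial>D) = ennreal (norm w * norm (x - y))"
      using meas by (simp add: D_def nn_integral_density nn_integral_return ennreal_mult)
    also have "(\<integral>\<^sup>+z. norm (fst z - snd z) \<partial>M') + \<dots> \<le> (\<integral>\<^sup>+z. norm (fst z - snd z) \<partial>M) + ennreal (dipole_cost l) + ennreal (norm w * norm (x - y))"
      by (intro add_right_mono M'(4))
    also have "\<dots> = (\<integral>\<^sup>+z. norm (fst z - snd z) \<partial>M) + ennreal (dipole_cost (a # l))"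
      using dipole_cost_nonneg[of l] by (simp add: a dipole_cost_def add.assoc add.commute flip: ennreal_plus)
    finally show ?thesis .
  qed
  moreover have "vector_measure (\<lambda>E. F E + indicator E (x, y) *\<^sub>R w)"
    by (intro vector_measure_add M'(2) vector_measure_point)
  ultimately show ?case
    unfolding F' using P(1) M'(1) by (intro exI[of _ P]) simp
qed

text \<open>A simple function \<open>T\<close> near the identity collapses \<open>\<mu>\<close> to
  finitely many point masses. The plan consists of the graph of \<open>T\<close>, which pays for the
  collapse, and a nearly optimal molecule for the collapsed measure.\<close>

theorem strong_duality:
  fixes \<mu> :: "'a::euclidean_space set \<Rightarrow> 'b::euclidean_space"
  assumes \<mu>: "\<mu> \<in> W1_space" and "0 < e"
  obtains v \<pi> where "1-lipschitz_on UNIV v" "\<pi> \<in> transports \<mu>"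
    "transport_cost \<pi> \<le> ennreal (vm_integral \<mu> v + e)"
proof -
  note vm = W1_spaceD(1)[OF \<mu>]
  let ?M = "total_variation \<mu>" and ?h = "polar_density \<mu>"
  \<comment> \<open>Three losses: the cost of moving \<open>x\<close> to \<open>T x\<close>, the
    change from \<open>v (T x)\<close> to \<open>v x\<close> in the integral, and the slack in
    \<open>dipole_norm_dual\<close>.\<close>
  define \<epsilon> where "\<epsilon> = e / 3"
  have \<epsilon>: "\<epsilon> > 0" using \<open>0 < e\<close> by (simp add: \<epsilon>_def)
  have [measurable]: "?h \<in> borel_measurable borel"
    using integrable_polar_density[OF vm] by auto
  have "\<exists>T. simple_function ?M T \<and> integrable ?M (\<lambda>x. norm (x - T x)) \<and> (\<integral>x. norm (x - T x) \<partial>?M) < \<epsilon>"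
  proof -
    obtain F where F: "\<And>i. simple_function ?M (F i)" "\<And>x. (\<lambda>i. F i x) \<longlonglongrightarrow> x"
      "\<And>i x. dist (F i x) 0 \<le> 2 * dist x 0"
      using borel_measurable_implies_sequence_metric[of "\<lambda>x. x" ?M 0] by auto
    have m: "(\<lambda>x. norm (x - F i x)) \<in> borel_measurable ?M" for i
      using borel_measurable_simple_function[OF F(1)[of i]] by simp
    \<comment> \<open>The simple approximations satisfy
      \<open>norm (F i x) \<le> 2 * norm x\<close>, so \<open>3 * norm x\<close> dominates the
      error.\<close>
    have w: "integrable ?M (\<lambda>x. 3 * norm x)"
      using W1_spaceD(3)[OF \<mu>, of 0] by simp
    have lim: "AE x in ?M. (\<lambda>i. norm (x - F i x)) \<longlonglongrightarrow> 0"
    proof (rule AE_I2)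
      show "(\<lambda>i. norm (x - F i x)) \<longlonglongrightarrow> 0" for x
        using tendsto_norm[OF tendsto_diff[OF tendsto_const[of x] F(2)[of x]]] by simp
    qed
    have b: "AE x in ?M. norm (norm (x - F i x)) \<le> 3 * norm x" for i
    proof (rule AE_I2)
      show "norm (norm (x - F i x)) \<le> 3 * norm x" for x
        using norm_triangle_ineq4[of x "F i x"] F(3)[of i x] by (simp add: dist_norm)
    qed
    have "(\<lambda>i. \<integral>x. norm (x - F i x) \<partial>?M) \<longlonglongrightarrow> (\<integral>x. 0 \<partial>?M)"
      by (rule integral_dominated_convergence[OF _ m w lim b]) simp
    then have "\<forall>\<^sub>F i in sequentially. (\<integral>x. norm (x - F i x) \<partial>?M) < \<epsilon>"
      using \<epsilon> by (intro order_tendstoD(2)[where y = 0]) auto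
    then obtain i where "(\<integral>x. norm (x - F i x) \<partial>?M) < \<epsilon>"
      by (auto simp: eventually_sequentially)
    moreover have "integrable ?M (\<lambda>x. norm (x - F i x))"
      by (rule integrable_dominated_convergence2[OF _ m w lim b]) simp
    ultimately show ?thesis using F(1) by blast
  qed
  then obtain T where T: "simple_function ?M T" and intT: "integrable ?M (\<lambda>x. norm (x - T x))"
    and T\<epsilon>: "(\<integral>x. norm (x - T x) \<partial>?M) < \<epsilon>" by blast
  have Tm[measurable]: "T \<in> borel_measurable borel"
    using borel_measurable_simple_function[OF T] by simp
  have finT: "finite (range T)"
    using T by (simp add: simple_function_def)
  have fib: "T -` B \<in> sets borel" if "B \<in> sets borel" for B
    using measurable_sets[OF Tm that] by simp
  have fibs: "T -` {s} \<in> sets borel" for s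
    by (rule fib) simp
  define f where "f = (\<lambda>s. \<mu> (T -` {s}))"
  have sum_f: "(\<Sum>s\<in>range T \<inter> B. f s) = \<mu> (T -` B)" for B
  proof -
    have "\<mu> (\<Union>s\<in>range T \<inter> B. T -` {s}) = (\<Sum>s\<in>range T \<inter> B. \<mu> (T -` {s}))"
      using finT fibs by (intro vm_finite_UN[OF vm]) (auto simp: disjoint_family_on_def)
    moreover have "(\<Union>s\<in>range T \<inter> B. T -` {s}) = T -` B"
      by auto
    ultimately show ?thesis by (simp add: f_def)
  qed
  have f0: "(\<Sum>s\<in>range T. f s) = 0"
    using sum_f[of UNIV] W1_spaceD(2)[OF \<mu>] by simp
  obtain zs where zs: "set zs = range T" "distinct zs"
    using finite_distinct_list[OF finT] by blast
  \<comment> \<open>Every point mass is paired with the origin. The opposite masses at the origin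
    cancel, because the values \<open>f s\<close> sum to 0.\<close>
  define l0 where "l0 = map (\<lambda>s. (f s, s, 0::'a)) zs"
  have l0_sum: "(\<Sum>(w, x, y)\<leftarrow>l0. G w x y) = (\<Sum>s\<in>range T. G (f s) s 0)" for G :: "'b \<Rightarrow> 'a \<Rightarrow> 'a \<Rightarrow> 'c::comm_monoid_add"
    using zs by (simp add: l0_def comp_def sum_list_distinct_conv_sum_set)
  obtain v l where v: "1-lipschitz_on UNIV v" and l: "dipoles l = dipoles l0"
    and cost: "dipole_cost l \<le> (\<Sum>(w, x, y)\<leftarrow>l0. w \<bullet> (v x - v y)) + \<epsilon>"
    using dipole_norm_dual[OF \<epsilon>] by blast
  have vb[measurable]: "v \<in> borel_measurable borel"
    using lipschitz_on_continuous_on[OF v] by (rule borel_measurable_continuous_onI)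
  have "(\<Sum>(w, x, y)\<leftarrow>l0. w \<bullet> (v x - v y)) = (\<Sum>s\<in>range T. f s \<bullet> v s) - (\<Sum>s\<in>range T. f s) \<bullet> v 0"
    by (simp add: l0_sum inner_diff_right sum_subtractf inner_sum_left)
  then have cost': "dipole_cost l \<le> (\<Sum>s\<in>range T. f s \<bullet> v s) + \<epsilon>"
    using cost f0 by simp
  have vT: "integrable ?M (\<lambda>x. v (T x) \<bullet> ?h x)" "(\<integral>x. v (T x) \<bullet> ?h x \<partial>?M) = (\<Sum>s\<in>range T. f s \<bullet> v s)"
  proof -
    have eq: "v (T x) \<bullet> ?h x = (\<Sum>s\<in>range T. indicator (T -` {s}) x * (?h x \<bullet> v s))" for x
    proof -
      have "(\<Sum>s\<in>range T. indicator (T -` {s}) x * (?h x \<bullet> v s)) = (\<Sum>s\<in>range T. if s = T x then ?h x \<bullet> v (T x) else 0)"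
        by (rule sum.cong) (auto simp: indicator_def)
      then show ?thesis
        using finT by (simp add: inner_commute)
    qed
    have int: "integrable ?M (\<lambda>x. indicator (T -` {s}) x * (?h x \<bullet> v s))" for s
      using integrable_mult_indicator[of "T -` {s}" ?M "\<lambda>x. ?h x \<bullet> v s"] fibs integrable_polar_density[OF vm] by simp
    show "integrable ?M (\<lambda>x. v (T x) \<bullet> ?h x)"
      unfolding eq by (intro Bochner_Integration.integrable_sum int)
    have "(\<integral>x. v (T x) \<bullet> ?h x \<partial>?M) = (\<Sum>s\<in>range T. \<integral>x. indicator (T -` {s}) x * (?h x \<bullet> v s) \<partial>?M)"
      unfolding eq by (intro Bochner_Integration.integral_sum int)
    also have "\<dots> = (\<Sum>s\<in>range T. f s \<bullet> v s)"
    proof (rule sum.cong[OF refl])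
      fix s
      have "(\<integral>x. indicator (T -` {s}) x * (?h x \<bullet> v s) \<partial>?M) = (LINT x:T -` {s}|?M. ?h x) \<bullet> v s"
        using fibs by (intro set_integral_inner_right integrable_polar_density[OF vm]) simp
      also have "(LINT x:T -` {s}|?M. ?h x) = f s"
        using vm_density_polar[OF vm fibs[of s]] by (simp add: f_def vm_density_def)
      finally show "(\<integral>x. indicator (T -` {s}) x * (?h x \<bullet> v s) \<partial>?M) = f s \<bullet> v s" .
    qed
    finally show "(\<integral>x. v (T x) \<bullet> ?h x \<partial>?M) = (\<Sum>s\<in>range T. f s \<bullet> v s)" .
  qed
  have intv: "integrable ?M (\<lambda>x. v x \<bullet> ?h x)"
    by (rule integrable_lipschitz_inner[OF \<mu> v])
  have "(\<Sum>s\<in>range T. f s \<bullet> v s) - vm_integral \<mu> v = (\<integral>x. v (T x) \<bullet> ?h x - v x \<bullet> ?h x \<partial>?M)"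
    unfolding vm_integral_def vT(2)[symmetric] by (rule Bochner_Integration.integral_diff[OF vT(1) intv, symmetric])
  also have "\<dots> \<le> (\<integral>x. norm (x - T x) \<partial>?M)"
  proof (rule integral_mono_AE)
    show "AE x in ?M. v (T x) \<bullet> ?h x - v x \<bullet> ?h x \<le> norm (x - T x)"
      using norm_polar_density[OF vm]
    proof eventually_elim
      case (elim x)
      then show ?case
        using norm_cauchy_schwarz[of "v (T x) - v x" "?h x"] lipschitz_onD[OF v, of "T x" x]
        by (simp add: dist_norm inner_diff_left norm_minus_commute)
    qed
  qed (use vT(1) intv intT in auto)
  finally have cost'': "dipole_cost l \<le> vm_integral \<mu> v + 2 * \<epsilon>"
    using cost' T\<epsilon> by simp
  \<comment> \<open>The image of \<open>\<mu>\<close> under the graph map; its marginals differ by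
    \<open>\<mu>\<close> minus the collapsed measure, and the molecule supplies the rest.\<close>
  define \<pi>0 where "\<pi>0 = (\<lambda>E. \<mu> ((\<lambda>x. (x, T x)) -` E))"
  define M0 where "M0 = distr ?M borel (\<lambda>x. (x, T x))"
  define \<pi> where "\<pi> = (\<lambda>E. \<pi>0 E + (\<Sum>(w, x, y)\<leftarrow>l. indicator E (x, y) *\<^sub>R w))"
  have pair[measurable]: "(\<lambda>x. (x, T x)) \<in> borel \<rightarrow>\<^sub>M borel"
    unfolding borel_prod[symmetric] by measurable
  have "vector_measure \<pi>0"
    unfolding \<pi>0_def by (rule vector_measure_vimage[OF vm pair])
  moreover have "ennreal (norm (\<pi>0 E)) \<le> emeasure M0 E" if E: "E \<in> sets borel" for E
  proof -
    have "(\<lambda>x. (x, T x)) -` E \<in> sets borel"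
      using measurable_sets[OF pair E] by simp
    then show ?thesis
      using norm_le_total_variation[OF vm] E by (simp add: \<pi>0_def M0_def emeasure_distr)
  qed
  moreover have "sets M0 = sets borel" by (simp add: M0_def)
  ultimately obtain M' where M': "sets M' = sets borel" "vector_measure \<pi>"
    "\<And>E. E \<in> sets borel \<Longrightarrow> ennreal (norm (\<pi> E)) \<le> emeasure M' E"
    "(\<integral>\<^sup>+z. norm (fst z - snd z) \<partial>M') \<le> (\<integral>\<^sup>+z. norm (fst z - snd z) \<partial>M0) + ennreal (dipole_cost l)"
    using dominated_add_dipoles[of \<pi>0 M0 l] unfolding \<pi>_def by blast
  have "transport_cost \<pi> = (\<integral>\<^sup>+z. norm (fst z - snd z) \<partial>total_variation \<pi>)"
    unfolding transport_cost_def case_prod_unfold ..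
  also have "\<dots> \<le> (\<integral>\<^sup>+z. norm (fst z - snd z) \<partial>M')"
  proof (rule nn_integral_mono_measure)
    show "total_variation \<pi> \<le> M'"
      using M' total_variation_minimal[OF M'(2,1)] by (subst le_measure) auto
  qed (simp add: M'(1))
  also note M'(4)
  also have "(\<integral>\<^sup>+z. norm (fst z - snd z) \<partial>M0) = (\<integral>\<^sup>+x. norm (x - T x) \<partial>?M)"
    unfolding M0_def by (subst nn_integral_distr) auto
  also have "\<dots> = ennreal (\<integral>x. norm (x - T x) \<partial>?M)"
    using intT by (intro nn_integral_eq_integral) auto
  also have "\<dots> + ennreal (dipole_cost l) = ennreal ((\<integral>x. norm (x - T x) \<partial>?M) + dipole_cost l)"
    using dipole_cost_nonneg[of l] by (intro ennreal_plus[symmetric]) auto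
  also have "\<dots> \<le> ennreal (vm_integral \<mu> v + e)"
    using T\<epsilon> cost'' by (intro ennreal_leI) (simp add: \<epsilon>_def)
  finally have "transport_cost \<pi> \<le> ennreal (vm_integral \<mu> v + e)" .
  moreover have "\<pi> \<in> transports \<mu>"
    unfolding transports_def
  proof (intro CollectI conjI ballI M'(2))
    fix A :: "'a set" assume A: "A \<in> sets borel"
    define Z where "Z = (\<Union>(w, x, y)\<in>set l \<union> set l0. {x, y})"
    have Z: "finite Z" "\<And>w x y. (w, x, y) \<in> set l \<Longrightarrow> x \<in> Z \<and> y \<in> Z" "\<And>w x y. (w, x, y) \<in> set l0 \<Longrightarrow> x \<in> Z \<and> y \<in> Z"
      by (auto simp: Z_def)
    have "(\<Sum>(w, x, y)\<leftarrow>l. (indicator A x - indicator A y) *\<^sub>R w) = (\<Sum>z\<in>Z. indicator A z *\<^sub>R dipoles l z)"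
      by (rule dipoles_test[OF Z(1,2)])
    also have "\<dots> = (\<Sum>(w, x, y)\<leftarrow>l0. (indicator A x - indicator A y) *\<^sub>R w)"
      unfolding l by (rule dipoles_test[OF Z(1,3), symmetric])
    also have "\<dots> = (\<Sum>s\<in>range T. indicator A s *\<^sub>R f s) - indicator A 0 *\<^sub>R (\<Sum>s\<in>range T. f s)"
      by (simp add: l0_sum scaleR_diff_left sum_subtractf scaleR_sum_right)
    also have "(\<Sum>s\<in>range T. indicator A s *\<^sub>R f s) = (\<Sum>s\<in>range T \<inter> A. f s)"
      using finT by (subst sum.inter_restrict) (auto intro!: sum.cong simp: indicator_def)
    finally have dip: "(\<Sum>(w, x, y)\<leftarrow>l. (indicator A x - indicator A y) *\<^sub>R w) = \<mu> (T -` A)"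
      using f0 sum_f[of A] by simp
    have "\<pi> (A \<times> UNIV) - \<pi> (UNIV \<times> A) = \<mu> A - \<mu> (T -` A) +
        ((\<Sum>(w, x, y)\<leftarrow>l. indicator A x *\<^sub>R w) - (\<Sum>(w, x, y)\<leftarrow>l. indicator A y *\<^sub>R w))"
      by (simp add: \<pi>_def \<pi>0_def vimage_def indicator_def)
    also have "(\<Sum>(w, x, y)\<leftarrow>l. indicator A x *\<^sub>R w) - (\<Sum>(w, x, y)\<leftarrow>l. indicator A y *\<^sub>R w) =
        (\<Sum>(w, x, y)\<leftarrow>l. (indicator A x - indicator A y) *\<^sub>R w)"
      by (simp add: sum_list_subtractf[symmetric] scaleR_diff_left case_prod_unfold)
    finally show "\<pi> (A \<times> UNIV) - \<pi> (UNIV \<times> A) = \<mu> A"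
      by (simp add: dip)
  qed
  ultimately show ?thesis
    using v by (intro that)
qed

section \<open>Equality in the duality for optimal pairs\<close>

text \<open>\<open>strong_duality\<close> gives pairs up to a slack \<open>e\<close>; optimality of
  \<open>\<pi>\<close> and \<open>u\<close> replaces them by the fixed pair, and then
  \<open>e\<close> tends to 0.\<close>

lemma optimal_transport_integral:
  fixes \<mu> :: "'a::euclidean_space set \<Rightarrow> 'b::euclidean_space"
  assumes \<pi>: "optimal_transport \<mu> \<pi>" and u: "optimal_potential \<mu> u"
  shows "transport_cost \<pi> < \<infinity>" "transport_cost \<pi> \<le> ennreal (vm_integral \<mu> u)"
proof -
  have \<mu>: "\<mu> \<in> W1_space" and \<pi>': "\<And>\<pi>'. \<pi>' \<in> transports \<mu> \<Longrightarrow> transport_cost \<pi> \<le> transport_cost \<pi>'"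
    and u': "\<And>v. 1-lipschitz_on UNIV v \<Longrightarrow> vm_integral \<mu> v \<le> vm_integral \<mu> u"
    using \<pi> u by (auto simp: optimal_transport_def optimal_potential_def is_arg_min_def is_arg_max_def not_less)
  have le: "transport_cost \<pi> \<le> ennreal (vm_integral \<mu> u + e)" if e: "0 < e" for e
  proof -
    obtain v \<pi>' where "1-lipschitz_on UNIV v" "\<pi>' \<in> transports \<mu>" "transport_cost \<pi>' \<le> ennreal (vm_integral \<mu> v + e)"
      by (rule strong_duality[OF \<mu> e])
    with \<pi>'[of \<pi>'] u'[of v] show ?thesis
      by (intro order_trans[OF \<pi>' order_trans[OF _ ennreal_leI]]) auto
  qed
  show "transport_cost \<pi> < \<infinity>"
    using le[of 1] by (auto intro: le_less_trans)
  have lim: "(\<lambda>n. ennreal (vm_integral \<mu> u + inverse (real (Suc n)))) \<longlonglongrightarrow> ennreal (vm_integral \<mu> u + 0)"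
    by (intro tendsto_ennrealI tendsto_add tendsto_const LIMSEQ_inverse_real_of_nat)
  show "transport_cost \<pi> \<le> ennreal (vm_integral \<mu> u)"
    using LIMSEQ_le_const[OF lim] le by (simp add: exI[of _ 0])
qed

text \<open>Equality of cost and dual value leaves no room in the pointwise inequality between
  \<open>(u x - u y) \<bullet> \<theta>\<close> and the distance. Equality in Cauchy-Schwarz then
  fixes the vector \<open>u x - u y\<close> and not just its length.\<close>

theorem optimal_transport_direction:
  fixes \<mu> :: "'a::euclidean_space set \<Rightarrow> 'b::euclidean_space"
  assumes \<pi>: "optimal_transport \<mu> \<pi>" and u: "optimal_potential \<mu> u"
  shows "AE z in total_variation \<pi>. u (fst z) - u (snd z) = norm (fst z - snd z) *\<^sub>R polar_density \<pi> z"
proof -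
  let ?N = "total_variation \<pi>" and ?\<theta> = "polar_density \<pi>"
  have \<mu>: "\<mu> \<in> W1_space" and \<pi>t: "\<pi> \<in> transports \<mu>" and lip: "1-lipschitz_on UNIV u"
    using \<pi> u by (auto simp: optimal_transport_def optimal_potential_def is_arg_min_def is_arg_max_def)
  have vm\<pi>: "vector_measure \<pi>" using \<pi>t by (simp add: transports_def)
  note fin = optimal_transport_integral(1)[OF \<pi> u]
  let ?g = "\<lambda>z. norm (fst z - snd z) - (u (fst z) - u (snd z)) \<bullet> ?\<theta> z"
  note ints = integrable_transport_distance(1)[OF fin] transport_integral_lipschitz(1)[OF \<mu> \<pi>t fin lip]
  have vi: "vm_integral \<mu> u = (\<integral>z. (u (fst z) - u (snd z)) \<bullet> ?\<theta> z \<partial>?N)"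
    by (rule transport_integral_lipschitz(2)[OF \<mu> \<pi>t fin lip])
  have bound: "AE z in ?N. norm (u (fst z) - u (snd z)) \<le> norm (fst z - snd z) \<and> norm (?\<theta> z) = 1"
    using norm_polar_density[OF vm\<pi>] lipschitz_onD[OF lip] by (auto simp: dist_norm)
  then have nonneg: "AE z in ?N. 0 \<le> ?g z"
  proof eventually_elim
    case (elim z)
    then show ?case
      using norm_cauchy_schwarz[of "u (fst z) - u (snd z)" "?\<theta> z"] by simp
  qed
  have "(\<integral>z. ?g z \<partial>?N) = (\<integral>z. norm (fst z - snd z) \<partial>?N) - vm_integral \<mu> u"
    unfolding vi by (rule Bochner_Integration.integral_diff[OF ints])
  also have "\<dots> \<le> 0"
  proof -
    have "0 \<le> (\<integral>z. norm (fst z - snd z) \<partial>?N)" by simp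
    moreover have le: "ennreal (\<integral>z. norm (fst z - snd z) \<partial>?N) \<le> ennreal (vm_integral \<mu> u)"
      using optimal_transport_integral(2)[OF \<pi> u] integrable_transport_distance(2)[OF fin] by simp
    \<comment> \<open>\<open>ennreal\<close> sends negative numbers to 0, so \<open>le\<close>
      becomes a comparison of reals only after the dual value is known to be non-negative; the
      competitor 0 shows this.\<close>
    moreover have "0 \<le> vm_integral \<mu> u"
    proof -
      have "1-lipschitz_on UNIV (\<lambda>_::'a. 0::'b)"
        by (simp add: lipschitz_on_def)
      then have "vm_integral \<mu> (\<lambda>_. 0) \<le> vm_integral \<mu> u"
        using u by (auto simp: optimal_potential_def is_arg_max_def not_less)
      then show ?thesis
        by (simp add: vm_integral_def)
    qed
    ultimately show ?thesis by simp
  qed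
  finally have "(\<integral>z. ?g z \<partial>?N) = 0"
    using integral_nonneg_AE[OF nonneg] by simp
  then have "AE z in ?N. ?g z = 0"
    using integral_nonneg_eq_0_iff_AE[OF Bochner_Integration.integrable_diff[OF ints] nonneg] by simp
  with bound show ?thesis
  proof eventually_elim
    case (elim z)
    define a \<theta> r where "a = u (fst z) - u (snd z)" and "\<theta> = ?\<theta> z" and "r = norm (fst z - snd z)"
    have h: "norm a \<le> r" "norm \<theta> = 1" "a \<bullet> \<theta> = r"
      using elim by (auto simp: a_def \<theta>_def r_def)
    have "(norm (a - r *\<^sub>R \<theta>))\<^sup>2 = (norm a)\<^sup>2 - 2 * r * (a \<bullet> \<theta>) + r\<^sup>2 * (norm \<theta>)\<^sup>2"
      unfolding power2_norm_eq_inner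
      by (simp add: inner_diff_left inner_diff_right inner_commute[of \<theta> a] power2_eq_square algebra_simps)
    also have "\<dots> = (norm a)\<^sup>2 - r\<^sup>2"
      using h by (simp add: power2_eq_square)
    also have "\<dots> \<le> 0"
      using h(1) power_mono[of "norm a" r 2] by simp
    finally have "norm (a - r *\<^sub>R \<theta>) = 0"
      by simp
    then show ?case
      by (simp add: a_def \<theta>_def r_def)
  qed
qed

text \<open>By weak duality, equality of the two values certifies both optimality claims at once.
  Non-negativity is required because truncation by \<open>ennreal\<close> would hide a negative dual
  value.\<close>

lemma optimal_pairI:
  fixes \<mu> :: "'a::euclidean_space set \<Rightarrow> 'b::euclidean_space"
  assumes \<mu>: "\<mu> \<in> W1_space" and \<pi>: "\<pi> \<in> transports \<mu>" and u: "1-lipschitz_on UNIV u"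
    and cost: "transport_cost \<pi> = ennreal (vm_integral \<mu> u)" and nonneg: "0 \<le> vm_integral \<mu> u"
  shows "optimal_transport \<mu> \<pi>" "optimal_potential \<mu> u"
proof -
  show "optimal_transport \<mu> \<pi>"
    using \<mu> \<pi> weak_duality[OF \<mu> _ u] by (auto simp: optimal_transport_def is_arg_min_def not_less cost)
  have "vm_integral \<mu> v \<le> vm_integral \<mu> u" if "1-lipschitz_on UNIV v" for v
    using weak_duality[OF \<mu> \<pi> that] nonneg by (simp add: cost)
  then show "optimal_potential \<mu> u"
    using \<mu> u by (auto simp: optimal_potential_def is_arg_max_def not_less)
qed

section \<open>Leaves of 1-Lipschitz maps\<close>

text \<open>Squared distances are compared so that the defect expands through inner products. For
  1-Lipschitz \<open>u\<close> it is non-negative, and it vanishes exactly on the pairs that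
  \<open>u\<close> keeps at their distance.\<close>

definition iso_defect :: "('a::real_inner \<Rightarrow> 'b::real_inner) \<Rightarrow> 'a \<Rightarrow> 'a \<Rightarrow> real" where
  "iso_defect u x y = (norm (x - y))\<^sup>2 - (norm (u x - u y))\<^sup>2"

lemma iso_defect_commute: "iso_defect u x y = iso_defect u y x"
  by (simp add: iso_defect_def norm_minus_commute)

lemma iso_defect_self [simp]: "iso_defect u x x = 0"
  by (simp add: iso_defect_def)

lemma iso_defect_nonneg:
  assumes "1-lipschitz_on UNIV u"
  shows "0 \<le> iso_defect u x y"
  using lipschitz_onD[OF assms, of x y] by (simp add: iso_defect_def dist_norm power_mono)

lemma iso_defect_eq_0: "iso_defect u x y = 0 \<longleftrightarrow> norm (u x - u y) = norm (x - y)"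
  by (auto simp: iso_defect_def power2_eq_iff_nonneg)

text \<open>The law of cosines at the vertex \<open>y\<close>, in the target and in the source; the
  mixed term decides whether isometry passes from two sides to the third.\<close>

lemma iso_defect_triangle:
  "iso_defect u x z = iso_defect u x y + iso_defect u y z
    + 2 * ((u x - u y) \<bullet> (u z - u y) - (x - y) \<bullet> (z - y))"
  by (simp add: iso_defect_def power2_norm_eq_inner inner_diff_left inner_diff_right inner_commute algebra_simps)

lemma continuous_on_iso_defect [continuous_intros]:
  fixes u :: "'a::real_inner \<Rightarrow> 'b::real_inner"
  assumes "continuous_on UNIV u" "continuous_on S f" "continuous_on S g"
  shows "continuous_on S (\<lambda>x. iso_defect u (f x) (g x))"
proof -
  have "continuous_on S (\<lambda>x. u (f x))" "continuous_on S (\<lambda>x. u (g x))"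
    using assms by (auto intro: continuous_on_compose2)
  with assms(2,3) show ?thesis
    unfolding iso_defect_def by (intro continuous_intros)
qed

lemma preserves_dist_iff_iso_defect:
  fixes u :: "'a::real_inner \<Rightarrow> 'b::real_inner"
  shows "preserves_dist u S \<longleftrightarrow> (\<forall>x\<in>S. \<forall>y\<in>S. iso_defect u x y = 0)"
  by (simp add: preserves_dist_def iso_defect_eq_0 dist_norm)

text \<open>The image of the intermediate point is at most \<open>t * r\<close> from one end and
  \<open>(1 - t) * r\<close> from the other, while the ends are \<open>r\<close> apart; strict
  convexity of the Euclidean norm leaves a single position.\<close>

lemma isometric_segment:
  fixes u :: "'a::real_inner \<Rightarrow> 'b::real_inner"
  assumes u: "1-lipschitz_on UNIV u" and xy: "iso_defect u x y = 0" and t: "0 \<le> t" "t \<le> 1"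
  shows "u (y + t *\<^sub>R (x - y)) = u y + t *\<^sub>R (u x - u y)"
proof -
  define p where "p = y + t *\<^sub>R (x - y)"
  define a where "a = u p - u y"
  define b where "b = u x - u y"
  define r where "r = norm (x - y)"
  have b: "b \<bullet> b = r\<^sup>2"
    using xy by (simp add: iso_defect_eq_0 b_def r_def flip: power2_norm_eq_inner)
  have "norm a \<le> t * r"
    using lipschitz_onD[OF u, of p y] t by (simp add: a_def p_def r_def dist_norm)
  then have "(norm a)\<^sup>2 \<le> (t * r)\<^sup>2"
    by (intro power_mono) auto
  then have a: "a \<bullet> a \<le> t\<^sup>2 * r\<^sup>2"
    by (simp add: power2_norm_eq_inner power_mult_distrib)
  have "x - p = (1 - t) *\<^sub>R (x - y)"
    by (simp add: p_def algebra_simps)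
  then have "norm (x - p) = (1 - t) * r"
    using t by (simp add: r_def)
  then have "norm (b - a) \<le> (1 - t) * r"
    using lipschitz_onD[OF u, of x p] by (simp add: a_def b_def dist_norm)
  then have "(norm (b - a))\<^sup>2 \<le> ((1 - t) * r)\<^sup>2"
    by (intro power_mono) auto
  then have ba: "b \<bullet> b - 2 * (a \<bullet> b) + a \<bullet> a \<le> (1 - t)\<^sup>2 * r\<^sup>2"
    by (simp add: power2_norm_eq_inner power_mult_distrib inner_diff_left inner_diff_right inner_commute)
  have "(a - t *\<^sub>R b) \<bullet> (a - t *\<^sub>R b) = a \<bullet> a - t * (2 * (a \<bullet> b)) + t\<^sup>2 * r\<^sup>2"
    using b by (simp add: inner_diff_left inner_diff_right inner_commute algebra_simps power2_eq_square)
  also have "\<dots> \<le> a \<bullet> a - t * (r\<^sup>2 + a \<bullet> a - (1 - t)\<^sup>2 * r\<^sup>2) + t\<^sup>2 * r\<^sup>2"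
    using ba b t by (intro add_right_mono diff_left_mono mult_left_mono) auto
  also have "\<dots> = (1 - t) * (a \<bullet> a) - (1 - t) * (t\<^sup>2 * r\<^sup>2)"
    by (simp add: algebra_simps power2_eq_square)
  also have "\<dots> \<le> 0"
    using mult_left_mono[OF a, of "1 - t"] t by simp
  finally have "a - t *\<^sub>R b = 0"
    by (metis inner_eq_zero_iff inner_ge_zero order_antisym)
  then show ?thesis
    by (simp add: a_def b_def p_def algebra_simps)
qed

text \<open>Difference quotients at \<open>y\<close> in direction \<open>h\<close> have norm at most
  \<open>norm h\<close>. Along an isometric segment they are constant by
  \<open>isometric_segment\<close>, which determines the derivative there.\<close>

lemma derivative_contraction:
  fixes u :: "'a::real_inner \<Rightarrow> 'b::real_inner"
  assumes u: "1-lipschitz_on UNIV u" and D: "(u has_derivative D) (at y)"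
  shows "norm (D h) \<le> norm h"
    and "iso_defect u x y = 0 \<Longrightarrow> D (x - y) = u x - u y"
proof -
  interpret D: bounded_linear D
    using D by (rule has_derivative_bounded_linear)
  have near: "\<exists>t. 0 < t \<and> t \<le> 1 \<and> norm (u (y + t *\<^sub>R k) - u y - t *\<^sub>R D k) \<le> e * (t * norm k)"
    if e: "0 < e" for e k
  proof -
    obtain d where d: "d > 0" "\<And>z. norm (z - y) < d \<Longrightarrow> norm (u z - u y - D (z - y)) \<le> e * norm (z - y)"
      using D e unfolding has_derivative_at_alt by blast
    \<comment> \<open>Adding 1 to \<open>norm k\<close> allows \<open>k = 0\<close>, and
      \<open>t \<le> 1\<close> keeps the point on the segment.\<close>
    define t where "t = min 1 (d / (2 * (norm k + 1)))"
    have k: "norm k + 1 > 0" by (simp add: add_nonneg_pos)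
    have t: "0 < t" "t \<le> 1" using d(1) k by (auto simp: t_def)
    have "t * norm k \<le> d / (2 * (norm k + 1)) * norm k"
      by (intro mult_right_mono) (auto simp: t_def)
    also have "\<dots> < d"
      using d(1) k by (simp add: field_simps) (smt (verit) mult_nonneg_nonneg norm_ge_zero)
    finally have "norm (y + t *\<^sub>R k - y) < d"
      using t by simp
    from d(2)[OF this] t show ?thesis
      by (intro exI[of _ t]) (simp add: D.scaleR)
  qed
  show "norm (D h) \<le> norm h"
  proof (rule field_le_epsilon)
    fix e :: real assume e: "0 < e"
    have h: "norm h + 1 > 0" by (simp add: add_nonneg_pos)
    obtain t where t: "0 < t" "norm (u (y + t *\<^sub>R h) - u y - t *\<^sub>R D h) \<le> e / (norm h + 1) * (t * norm h)"
      using near[of "e / (norm h + 1)" h] e h by auto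
    have "t * norm (D h) = norm (t *\<^sub>R D h)"
      using t by simp
    also have "\<dots> \<le> norm (u (y + t *\<^sub>R h) - u y) + norm (u (y + t *\<^sub>R h) - u y - t *\<^sub>R D h)"
      using norm_triangle_sub[of "t *\<^sub>R D h" "u (y + t *\<^sub>R h) - u y"] by (simp add: norm_minus_commute)
    also have "\<dots> \<le> t * norm h + e / (norm h + 1) * (t * norm h)"
      using t lipschitz_onD[OF u, of "y + t *\<^sub>R h" y] by (intro add_mono) (auto simp: dist_norm)
    also have "\<dots> = t * (norm h + e * (norm h / (norm h + 1)))"
      by (simp add: algebra_simps)
    finally have "norm (D h) \<le> norm h + e * (norm h / (norm h + 1))"
      using t(1) by simp
    also have "e * (norm h / (norm h + 1)) \<le> e * 1"
      using e h by (intro mult_left_mono) auto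
    finally show "norm (D h) \<le> norm h + e"
      by simp
  qed
  show "D (x - y) = u x - u y" if xy: "iso_defect u x y = 0"
  proof -
    have "norm (u x - u y - D (x - y)) \<le> 0"
    proof (rule field_le_epsilon)
      fix e :: real assume e: "0 < e"
      have k: "norm (x - y) + 1 > 0" by (simp add: add_nonneg_pos)
      obtain t where t: "0 < t" "t \<le> 1"
        "norm (u (y + t *\<^sub>R (x - y)) - u y - t *\<^sub>R D (x - y)) \<le> e / (norm (x - y) + 1) * (t * norm (x - y))"
        using near[of "e / (norm (x - y) + 1)" "x - y"] e k by auto
      have eq: "u (y + t *\<^sub>R (x - y)) - u y - t *\<^sub>R D (x - y) = t *\<^sub>R (u x - u y - D (x - y))"
        using isometric_segment[OF u xy] t by (simp add: algebra_simps)
      have "t * norm (u x - u y - D (x - y)) = norm (t *\<^sub>R (u x - u y - D (x - y)))"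
        using t(1) by simp
      also have "\<dots> \<le> e / (norm (x - y) + 1) * (t * norm (x - y))"
        using t(3) unfolding eq .
      also have "\<dots> = t * (e * (norm (x - y) / (norm (x - y) + 1)))"
        by simp
      finally have "t * norm (u x - u y - D (x - y)) \<le> t * (e * (norm (x - y) / (norm (x - y) + 1)))" .
      then have "norm (u x - u y - D (x - y)) \<le> e * (norm (x - y) / (norm (x - y) + 1))"
        using t(1) by (simp only: mult_le_cancel_left_pos)
      also have "\<dots> \<le> e * 1"
        using e k by (intro mult_left_mono) auto
      finally show "norm (u x - u y - D (x - y)) \<le> 0 + e"
        by simp
    qed
    then show ?thesis
      by simp
  qed
qed

text \<open>The derivative preserves the lengths of \<open>e = x - y\<close> and
  \<open>f = z - y\<close> and contracts \<open>e + f\<close> and \<open>e - f\<close>; the two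
  contractions bound \<open>D e \<bullet> D f\<close> from above and below by
  \<open>e \<bullet> f\<close>. So the angle at \<open>y\<close> is preserved, and with it the
  distance between \<open>x\<close> and \<open>z\<close>.\<close>

lemma iso_defect_differentiable:
  fixes u :: "'a::real_inner \<Rightarrow> 'b::real_inner"
  assumes u: "1-lipschitz_on UNIV u" and y: "u differentiable (at y)"
    and x: "iso_defect u x y = 0" and z: "iso_defect u z y = 0"
  shows "iso_defect u x z = 0"
proof -
  obtain D where D: "(u has_derivative D) (at y)"
    using y by (auto simp: differentiable_def)
  interpret D: bounded_linear D
    using D by (rule has_derivative_bounded_linear)
  define e f where "e = x - y" and "f = z - y"
  have De: "D e = u x - u y" and Df: "D f = u z - u y"
    using derivative_contraction(2)[OF u D] x z by (auto simp: e_def f_def)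
  have ee: "D e \<bullet> D e = e \<bullet> e" "D f \<bullet> D f = f \<bullet> f"
    using x z De Df by (simp_all add: iso_defect_eq_0 e_def f_def flip: power2_norm_eq_inner)
  have "(norm (D (e + f)))\<^sup>2 \<le> (norm (e + f))\<^sup>2" "(norm (D (e - f)))\<^sup>2 \<le> (norm (e - f))\<^sup>2"
    by (intro power_mono derivative_contraction(1)[OF u D] norm_ge_zero)+
  then have "D e \<bullet> D f = e \<bullet> f"
    using ee by (simp add: power2_norm_eq_inner D.add D.diff inner_add_left inner_add_right
        inner_diff_left inner_diff_right inner_commute)
  then have "(u x - u y) \<bullet> (u z - u y) = (x - y) \<bullet> (z - y)"
    unfolding De Df by (simp add: e_def f_def)
  then show ?thesis
    using iso_defect_triangle[of u x z y] x z by (simp add: iso_defect_commute)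
qed

section \<open>Leaves, their overlap and isometric classes\<close>

lemma leaf_extend:
  assumes "preserves_dist u A"
  obtains S where "leaf u S" "A \<subseteq> S"
proof -
  let ?F = "{S. A \<subseteq> S \<and> preserves_dist u S}"
  have "\<exists>M\<in>?F. \<forall>X\<in>?F. M \<subseteq> X \<longrightarrow> X = M"
  proof (rule subset_Zorn_nonempty)
    show "?F \<noteq> {}" using assms by auto
    fix C assume C: "C \<noteq> {}" "subset.chain ?F C"
    have "dist (u x) (u y) = dist x y" if xy: "x \<in> \<Union>C" "y \<in> \<Union>C" for x y
    proof -
      obtain X Y where XY: "X \<in> C" "Y \<in> C" "x \<in> X" "y \<in> Y" using xy by blast
      then have "X \<subseteq> Y \<or> Y \<subseteq> X"
        using C(2) unfolding subset_chain_def by blast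
      then obtain Z where "Z \<in> C" "x \<in> Z" "y \<in> Z" using XY by blast
      then show ?thesis
        using C(2) unfolding subset_chain_def preserves_dist_def by blast
    qed
    moreover have "A \<subseteq> \<Union>C"
      using C unfolding subset_chain_def by blast
    ultimately show "\<Union>C \<in> ?F"
      by (simp add: preserves_dist_def)
  qed
  then obtain S where S: "S \<in> ?F" and max: "\<forall>X\<in>?F. S \<subseteq> X \<longrightarrow> X = S"
    by (elim bexE)
  have "leaf u S"
    unfolding leaf_def
  proof (intro conjI allI impI)
    show "preserves_dist u S"
      using S by simp
    fix T assume T: "S \<subseteq> T \<and> preserves_dist u T"
    then have "T \<in> ?F"
      using S by auto
    then show "T = S"
      using max T by simp
  qed
  moreover have "A \<subseteq> S"
    using S by simp
  ultimately show ?thesis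
    by (rule that)
qed

text \<open>If every point of \<open>S\<close> were isometric to every point of \<open>T\<close>,
  the union would preserve distances, against maximality. The resulting description speaks of points
  instead of leaves: two equations and one inequation between continuous functions.\<close>

lemma leaf_overlap_iff:
  fixes u :: "'a::real_inner \<Rightarrow> 'b::real_inner"
  shows "x \<in> leaf_overlap u \<longleftrightarrow>
    (\<exists>y z. iso_defect u x y = 0 \<and> iso_defect u x z = 0 \<and> iso_defect u y z \<noteq> 0)"
proof
  assume "x \<in> leaf_overlap u"
  then obtain S T where ST: "leaf u S" "leaf u T" "S \<noteq> T" "x \<in> S" "x \<in> T"
    by (auto simp: leaf_overlap_def)
  have pS: "\<And>x y. x \<in> S \<Longrightarrow> y \<in> S \<Longrightarrow> iso_defect u x y = 0"
    and pT: "\<And>x y. x \<in> T \<Longrightarrow> y \<in> T \<Longrightarrow> iso_defect u x y = 0"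
    using ST(1,2) by (auto simp: leaf_def preserves_dist_iff_iso_defect)
  have "\<exists>y\<in>S. \<exists>z\<in>T. iso_defect u y z \<noteq> 0"
  proof (rule ccontr)
    assume "\<not> ?thesis"
    then have c: "\<And>y z. y \<in> S \<Longrightarrow> z \<in> T \<Longrightarrow> iso_defect u y z = 0" by blast
    then have "preserves_dist u (S \<union> T)"
      using pS pT iso_defect_commute[of u] unfolding preserves_dist_iff_iso_defect by (metis Un_iff)
    then have "S \<union> T = S" "S \<union> T = T"
      using ST(1,2) unfolding leaf_def by blast+
    with ST(3) show False by blast
  qed
  then show "\<exists>y z. iso_defect u x y = 0 \<and> iso_defect u x z = 0 \<and> iso_defect u y z \<noteq> 0"
    using pS pT ST(4,5) by blast
next
  assume "\<exists>y z. iso_defect u x y = 0 \<and> iso_defect u x z = 0 \<and> iso_defect u y z \<noteq> 0"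
  then obtain y z where yz: "iso_defect u x y = 0" "iso_defect u x z = 0" "iso_defect u y z \<noteq> 0"
    by blast
  have "preserves_dist u {x, y}" "preserves_dist u {x, z}"
    using yz by (auto simp: preserves_dist_iff_iso_defect iso_defect_commute[of u y x] iso_defect_commute[of u z x])
  then obtain S T where ST: "leaf u S" "{x, y} \<subseteq> S" "leaf u T" "{x, z} \<subseteq> T"
    using leaf_extend by metis
  have "S \<noteq> T"
    using ST yz(3) by (auto simp: leaf_def preserves_dist_iff_iso_defect)
  with ST show "x \<in> leaf_overlap u"
    by (auto simp: leaf_overlap_def)
qed

lemma leaf_overlap_subset_nondiff:
  fixes u :: "'a::real_inner \<Rightarrow> 'b::real_inner"
  assumes "1-lipschitz_on UNIV u"
  shows "leaf_overlap u \<subseteq> nondiff_set u"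
proof
  fix x assume "x \<in> leaf_overlap u"
  then obtain y z where "iso_defect u x y = 0" "iso_defect u x z = 0" "iso_defect u y z \<noteq> 0"
    by (auto simp: leaf_overlap_iff)
  then show "x \<in> nondiff_set u"
    using iso_defect_differentiable[OF assms, of x y z] by (auto simp: nondiff_set_def iso_defect_commute)
qed

text \<open>The overlap is the projection of a countable union of compact sets of triples, hence a
  countable union of compact sets; the bound \<open>1 / Suc k\<close> replaces the open condition on
  the third defect.\<close>

lemma borel_leaf_overlap:
  fixes u :: "'a::euclidean_space \<Rightarrow> 'b::euclidean_space"
  assumes u: "1-lipschitz_on UNIV u"
  shows "leaf_overlap u \<in> sets borel"
proof -
  have cont: "continuous_on UNIV u" by (rule lipschitz_on_continuous_on[OF u])
  define K where "K = (\<lambda>k::nat. {p :: 'a \<times> 'a \<times> 'a. norm p \<le> k \<and> iso_defect u (fst p) (fst (snd p)) = 0 \<and>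
    iso_defect u (fst p) (snd (snd p)) = 0 \<and> 1 / Suc k \<le> iso_defect u (fst (snd p)) (snd (snd p))})"
  have "compact (K k)" for k
  proof -
    have "K k = cball 0 (real k) \<inter> ({p. iso_defect u (fst p) (fst (snd p)) = 0} \<inter>
        {p. iso_defect u (fst p) (snd (snd p)) = 0} \<inter> {p. 1 / Suc k \<le> iso_defect u (fst (snd p)) (snd (snd p))})"
      by (auto simp: K_def)
    moreover have "closed {p :: 'a \<times> 'a \<times> 'a. iso_defect u (fst p) (fst (snd p)) = 0}"
      "closed {p :: 'a \<times> 'a \<times> 'a. iso_defect u (fst p) (snd (snd p)) = 0}"
      "closed {p :: 'a \<times> 'a \<times> 'a. 1 / Suc k \<le> iso_defect u (fst (snd p)) (snd (snd p))}"
      by (intro closed_Collect_eq closed_Collect_le continuous_on_iso_defect[OF cont] continuous_on_fst continuous_on_snd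
          continuous_on_id continuous_on_const)+
    ultimately show ?thesis
      by (simp add: compact_Int_closed closed_Int)
  qed
  then have "fst ` K k \<in> sets borel" for k
    by (intro borel_closed compact_imp_closed compact_continuous_image continuous_on_fst continuous_on_id)
  moreover have "leaf_overlap u = (\<Union>k. fst ` K k)"
  proof (intro equalityI subsetI)
    fix x assume "x \<in> leaf_overlap u"
    then obtain y z where yz: "iso_defect u x y = 0" "iso_defect u x z = 0" "iso_defect u y z \<noteq> 0"
      by (auto simp: leaf_overlap_iff)
    then have "iso_defect u y z > 0"
      using iso_defect_nonneg[OF u, of y z] by simp
    then obtain i :: nat where i: "1 / Suc i < iso_defect u y z"
      using nat_approx_posE by blast
    obtain j :: nat where j: "norm (x, y, z) \<le> j"
      using real_arch_simple by blast
    define k where "k = max i j"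
    have "1 / real (Suc k) \<le> 1 / Suc i"
      by (simp add: k_def field_simps)
    moreover have "real j \<le> k" by (simp add: k_def)
    ultimately have "(x, y, z) \<in> K k"
      using i j yz by (simp add: K_def)
    then show "x \<in> (\<Union>k. fst ` K k)"
      by force
  next
    fix x assume "x \<in> (\<Union>k. fst ` K k)"
    then obtain k y z where "(x, y, z) \<in> K k" by auto
    then have "iso_defect u x y = 0" "iso_defect u x z = 0" "1 / Suc k \<le> iso_defect u y z"
      by (auto simp: K_def)
    moreover have "0 < 1 / real (Suc k)" by simp
    ultimately show "x \<in> leaf_overlap u"
      unfolding leaf_overlap_iff by (metis not_le)
  qed
  ultimately show ?thesis
    by auto
qed

text \<open>Meaningful for every \<open>x\<close>: off the overlap it is the leaf through
  \<open>x\<close>, on the overlap it is the union of all leaves through \<open>x\<close>.\<close>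

definition iso_class :: "('a::real_inner \<Rightarrow> 'b::real_inner) \<Rightarrow> 'a \<Rightarrow> 'a set" where
  "iso_class u x = {y. iso_defect u x y = 0}"

lemma iso_class_preserves:
  fixes u :: "'a::real_inner \<Rightarrow> 'b::real_inner"
  assumes "x \<notin> leaf_overlap u"
  shows "preserves_dist u (iso_class u x)"
  using assms unfolding leaf_overlap_iff preserves_dist_iff_iso_defect iso_class_def by blast

lemma leaf_eq_iso_class:
  fixes u :: "'a::real_inner \<Rightarrow> 'b::real_inner"
  assumes x: "x \<notin> leaf_overlap u"
  shows "leaf u S \<and> x \<in> S \<longleftrightarrow> S = iso_class u x"
proof
  assume S: "leaf u S \<and> x \<in> S"
  then have "S \<subseteq> iso_class u x"
    by (auto simp: leaf_def preserves_dist_iff_iso_defect iso_class_def)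
  with S iso_class_preserves[OF x] show "S = iso_class u x"
    unfolding leaf_def by blast
next
  assume S: "S = iso_class u x"
  have xS: "x \<in> S"
    by (simp add: S iso_class_def)
  have "T = S" if T: "S \<subseteq> T" "preserves_dist u T" for T
  proof -
    have "T \<subseteq> S"
      using T xS unfolding S iso_class_def preserves_dist_iff_iso_defect by blast
    with T(1) show ?thesis by blast
  qed
  then show "leaf u S \<and> x \<in> S"
    using iso_class_preserves[OF x] xS S by (auto simp: leaf_def)
qed

lemma leaf_map_eq:
  fixes u :: "'a::real_inner \<Rightarrow> 'b::real_inner"
  assumes "1-lipschitz_on UNIV u"
  shows "leaf_map u x = (if x \<in> nondiff_set u then {x} else iso_class u x)"
proof (cases "x \<in> nondiff_set u")
  case False
  then have "x \<notin> leaf_overlap u"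
    using leaf_overlap_subset_nondiff[OF assms] by blast
  then have "(THE S. leaf u S \<and> x \<in> S) = iso_class u x"
    by (simp add: leaf_eq_iso_class)
  with False show ?thesis
    by (simp add: leaf_map_def)
qed (simp add: leaf_map_def)

lemma iso_class_eq:
  fixes u :: "'a::real_inner \<Rightarrow> 'b::real_inner"
  assumes "x \<notin> leaf_overlap u" "y \<notin> leaf_overlap u" "y \<in> iso_class u x"
  shows "iso_class u y = iso_class u x"
proof -
  have "leaf u (iso_class u x) \<and> y \<in> iso_class u x"
    using leaf_eq_iso_class[OF assms(1)] assms(3) by blast
  then show ?thesis
    using leaf_eq_iso_class[OF assms(2)] by blast
qed

lemma closed_iso_class:
  fixes u :: "'a::real_inner \<Rightarrow> 'b::real_inner"
  assumes "continuous_on UNIV u"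
  shows "closed (iso_class u x)"
  unfolding iso_class_def
  by (rule closed_Collect_eq[OF continuous_on_iso_defect[OF assms continuous_on_const continuous_on_id] continuous_on_const])

text \<open>\<open>u\<close> is affine on the segment from \<open>y\<close> to \<open>z\<close>, so
  in \<open>iso_defect_triangle\<close> based at \<open>y\<close> both inner products are linear in
  the position on the segment, and they agree at its end \<open>z\<close>.\<close>

lemma convex_iso_class:
  fixes u :: "'a::real_inner \<Rightarrow> 'b::real_inner"
  assumes u: "1-lipschitz_on UNIV u" and x: "x \<notin> leaf_overlap u"
  shows "convex (iso_class u x)"
  unfolding convex_alt
proof (intro ballI allI impI)
  fix y z and t :: real
  assume y: "y \<in> iso_class u x" and z: "z \<in> iso_class u x" and t: "0 \<le> t \<and> t \<le> 1"
  have P: "iso_defect u a b = 0" if "a \<in> iso_class u x" "b \<in> iso_class u x" for a b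
    using iso_class_preserves[OF x] that unfolding preserves_dist_iff_iso_defect by blast
  have xx: "x \<in> iso_class u x"
    by (simp add: iso_class_def)
  note d = P[OF xx y] P[OF xx z] P[OF z y] P[OF y z]
  define p where "p = y + t *\<^sub>R (z - y)"
  have up: "u p = u y + t *\<^sub>R (u z - u y)"
    unfolding p_def using isometric_segment[OF u d(3)] t by blast
  have inner: "(u x - u y) \<bullet> (u z - u y) = (x - y) \<bullet> (z - y)"
    using iso_defect_triangle[of u x z y] d by simp
  have py: "iso_defect u y p = 0"
  proof -
    have "u y - u p = - (t *\<^sub>R (u z - u y))" "y - p = - (t *\<^sub>R (z - y))"
      by (simp_all add: up) (simp add: p_def)
    then show ?thesis
      using d(3) by (simp add: iso_defect_eq_0)
  qed
  have "(u x - u y) \<bullet> (u p - u y) = t * ((u x - u y) \<bullet> (u z - u y))"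
    by (simp add: up)
  moreover have "(x - y) \<bullet> (p - y) = t * ((x - y) \<bullet> (z - y))"
    by (simp add: p_def)
  ultimately have "iso_defect u x p = 0"
    using iso_defect_triangle[of u x p y] d(1) py inner by simp
  moreover have "(1 - t) *\<^sub>R y + t *\<^sub>R z = p"
    by (simp add: p_def algebra_simps)
  ultimately show "(1 - t) *\<^sub>R y + t *\<^sub>R z \<in> iso_class u x"
    by (simp add: iso_class_def)
qed

lemma self_in_iso_class [simp]: "x \<in> iso_class u x"
  by (simp add: iso_class_def)

lemma measurable_iso_defect [measurable]:
  fixes u :: "'a::euclidean_space \<Rightarrow> 'b::euclidean_space"
  assumes [measurable]: "u \<in> borel_measurable borel" "f \<in> borel_measurable M" "g \<in> borel_measurable M"
  shows "(\<lambda>x. iso_defect u (f x) (g x)) \<in> borel_measurable M"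
  unfolding iso_defect_def by measurable

section \<open>Mass arriving at non-differentiability points\<close>

text \<open>A measurable selection from countably many Borel sets by the least index. Exact
  isometric partners are replaced by points of a dense sequence so that this suffices.\<close>

lemma measurable_first_index:
  fixes q :: "nat \<Rightarrow> 'a::topological_space" and G :: "nat \<Rightarrow> 'c::topological_space set"
  assumes "\<And>k. G k \<in> sets borel"
  shows "\<exists>\<zeta>. \<zeta> \<in> borel \<rightarrow>\<^sub>M borel \<and> (\<forall>y \<in> (\<Union>k. G k). \<exists>k. \<zeta> y = q k \<and> y \<in> G k)"
proof (rule exI[of _ "\<lambda>y. q (LEAST k. y \<in> G k)"], intro conjI ballI)
  let ?i = "\<lambda>y. LEAST k. y \<in> G k"
  have "?i \<in> borel \<rightarrow>\<^sub>M count_space UNIV"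
    using assms by (intro measurable_Least) auto
  then show "(\<lambda>y. q (?i y)) \<in> borel \<rightarrow>\<^sub>M borel"
    by (rule measurable_compose) simp
  fix y assume y: "y \<in> (\<Union>k. G k)"
  obtain k where "y \<in> G k" using y by blast
  then have "y \<in> G (?i y)" by (rule LeastI)
  then show "\<exists>k. q (?i y) = q k \<and> y \<in> G k"
    by (intro exI[of _ "?i y"] conjI refl)
qed

text \<open>Here \<open>N\<close> is charged neither by \<open>\<mu>\<close> nor by the first marginal of the transport, so
  that the second marginal vanishes on \<open>N\<close> as a vector measure. Averaging over the first coordinate with the
  second one fixed shows that mass can only cancel at a point of \<open>N\<close> if it comes from a single leaf.\<close>

locale cancelling_target =
  fixes \<mu> :: "'a::euclidean_space set \<Rightarrow> 'b::euclidean_space" and \<pi> u N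
  assumes vm: "vector_measure \<mu>" and \<pi>: "\<pi> \<in> transports \<mu>" and lip: "1-lipschitz_on UNIV u"
    and direction: "AE z in total_variation \<pi>. u (fst z) - u (snd z) = norm (fst z - snd z) *\<^sub>R polar_density \<pi> z"
    and N[measurable]: "N \<in> sets borel"
    and N_\<mu>: "N \<in> null_sets (total_variation \<mu>)"
    and N_fst: "AE z in total_variation \<pi>. fst z \<notin> N"
begin

abbreviation "P \<equiv> total_variation \<pi>"
abbreviation "\<theta> \<equiv> polar_density \<pi>"

text \<open>Division by zero makes \<open>e\<close> vanish on the diagonal. Almost every pair ending
  in \<open>N\<close> is off the diagonal, as its source is not in \<open>N\<close>.\<close>

definition e :: "'a \<times> 'a \<Rightarrow> 'a" where
  "e z = (1 / norm (fst z - snd z)) *\<^sub>R (fst z - snd z)"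

lemma vm\<pi>: "vector_measure \<pi>"
  using \<pi> by (simp add: transports_def)

sublocale P: finite_measure P
  by (rule finite_total_variation[OF vm\<pi>])

lemma u_cont: "continuous_on UNIV u"
  by (rule lipschitz_on_continuous_on[OF lip])

lemma u_m[measurable]: "u \<in> borel_measurable borel"
  by (rule borel_measurable_continuous_onI[OF u_cont])

lemma \<theta>_m[measurable]: "\<theta> \<in> borel_measurable borel"
  using integrable_polar_density[OF vm\<pi>] by auto

lemma e_m[measurable]: "e \<in> borel_measurable borel"
  unfolding e_def[abs_def] by measurable

lemma norm_e: "norm (e z) \<le> 1"
  by (simp add: e_def)

text \<open>\<open>w\<close> lives on \<open>N\<close>, where neither \<open>\<mu>\<close> nor the
  first marginal has mass, so the marginal identity reduces to the second coordinate.\<close>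

lemma second_marginal_cancels:
  assumes w[measurable]: "w \<in> borel_measurable borel" and bdd: "\<And>y. norm (w y) \<le> B" and supp: "\<And>y. y \<notin> N \<Longrightarrow> w y = 0"
  shows "(\<integral>z. w (snd z) \<bullet> \<theta> z \<partial>P) = 0"
proof -
  have [measurable]: "polar_density \<mu> \<in> borel_measurable borel"
    using integrable_polar_density[OF vm] by auto
  have "AE x in total_variation \<mu>. w x \<bullet> polar_density \<mu> x = 0"
    using AE_not_in[OF N_\<mu>] by eventually_elim (simp add: supp)
  then have "(\<integral>x. w x \<bullet> polar_density \<mu> x \<partial>total_variation \<mu>) = 0"
    by (rule integral_eq_zero_AE)
  then have "(\<integral>z. (w (fst z) - w (snd z)) \<bullet> \<theta> z \<partial>P) = 0"
    using transport_integral_bounded[OF vm \<pi> w bdd] by simp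
  moreover have "(\<integral>z. (w (fst z) - w (snd z)) \<bullet> \<theta> z \<partial>P) = (\<integral>z. - (w (snd z) \<bullet> \<theta> z) \<partial>P)"
  proof (rule integral_cong_AE)
    show "AE z in P. (w (fst z) - w (snd z)) \<bullet> \<theta> z = - (w (snd z) \<bullet> \<theta> z)"
      using N_fst by eventually_elim (simp add: supp)
  qed measurable
  ultimately show ?thesis by simp
qed

text \<open>\<open>m\<close> is the conditional mean of \<open>e\<close> given the second
  coordinate, obtained as the density of the image under \<open>snd\<close> of the vector measure
  \<open>vm_density P e\<close> with respect to the image of \<open>P\<close>.\<close>

lemma mean_direction:
  obtains m where "m \<in> borel_measurable borel" "\<And>y. norm (m y) \<le> 1"
    "\<And>w B. w \<in> borel_measurable borel \<Longrightarrow> (\<And>y. norm (w y) \<le> B) \<Longrightarrow> (\<And>y. y \<notin> N \<Longrightarrow> w y = 0) \<Longrightarrow>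
      (\<integral>z. w (snd z) \<bullet> e z \<partial>P) = (\<integral>z. w (snd z) \<bullet> m (snd z) \<partial>P)"
proof -
  have int_e: "integrable P e"
    by (rule P.integrable_const_bound[where B = 1]) (auto simp: norm_e)
  define \<sigma> where "\<sigma> = distr P borel snd"
  have \<sigma>: "sets \<sigma> = sets borel" "finite_measure \<sigma>"
    by (auto simp: \<sigma>_def intro!: P.finite_measure_distr)
  define \<rho> where "\<rho> = (\<lambda>E. vm_density P e (snd -` E))"
  have snd_b: "snd -` E \<in> sets (borel :: ('a \<times> 'a) measure)" if "E \<in> sets borel" for E :: "'a set"
    using measurable_sets[OF borel_measurable_fst_snd(2) that] by simp
  have vm\<rho>: "vector_measure \<rho>"
    unfolding \<rho>_def by (rule vector_measure_vimage[OF vector_measure_density[OF int_e]]) auto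
  have le: "ennreal (norm (\<rho> E)) \<le> emeasure \<sigma> E" if E: "E \<in> sets borel" for E
  proof -
    have "ennreal (norm (\<rho> E)) \<le> emeasure (density P (\<lambda>x. norm (e x))) (snd -` E)"
      unfolding \<rho>_def vm_density_def using snd_b[OF E] by (intro norm_set_integral_le[OF int_e]) simp
    also have "\<dots> = (\<integral>\<^sup>+z. ennreal (norm (e z)) * indicator (snd -` E) z \<partial>P)"
      using snd_b[OF E] by (intro emeasure_density) auto
    also have "\<dots> \<le> (\<integral>\<^sup>+z. indicator (snd -` E) z \<partial>P)"
      by (intro nn_integral_mono) (auto simp: indicator_def norm_e)
    also have "\<dots> = emeasure P (snd -` E)"
      using snd_b[OF E] by simp
    also have "\<dots> = emeasure \<sigma> E"
      using E by (simp add: \<sigma>_def emeasure_distr)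
    finally show ?thesis .
  qed
  obtain m0 where m0: "integrable \<sigma> m0" "\<And>A. A \<in> sets borel \<Longrightarrow> vm_density \<sigma> m0 A = \<rho> A" "AE y in \<sigma>. norm (m0 y) \<le> 1"
    using vm_radon_nikodym[OF \<sigma>(2,1) vm\<rho> le] by blast
  have [measurable]: "m0 \<in> borel_measurable borel"
    using borel_measurable_integrable[OF m0(1)] measurable_cong_sets[OF \<sigma>(1) refl] by blast
  \<comment> \<open>The density has norm at most 1 only almost everywhere; resetting it to 0
    elsewhere makes the bound hold at every point.\<close>
  define m where "m = (\<lambda>y. if norm (m0 y) \<le> 1 then m0 y else 0)"
  have m_m[measurable]: "m \<in> borel_measurable borel"
    unfolding m_def by measurable
  have AE_m: "AE y in \<sigma>. m0 y = m y"
    using m0(3) by eventually_elim (simp add: m_def)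
  show ?thesis
  proof (rule that[OF m_m])
    show "norm (m y) \<le> 1" for y by (simp add: m_def)
    fix w :: "'a \<Rightarrow> 'a" and B
    assume w[measurable]: "w \<in> borel_measurable borel" and bdd: "\<And>y. norm (w y) \<le> B" and "\<And>y. y \<notin> N \<Longrightarrow> w y = 0"
    have "(\<integral>y. w y \<bullet> m0 y \<partial>\<sigma>) = (\<integral>z. (w (snd z) - 0 *\<^sub>R w (snd z)) \<bullet> e z \<partial>P)"
    proof (rule marginal_integral[OF _ m0(1) int_e \<sigma>(1) _ _ _ w bdd])
      fix A :: "'a set" assume A: "A \<in> sets borel"
      have "(LINT y:A|\<sigma>. m0 y) = \<rho> A"
        using m0(2)[OF A] by (simp add: vm_density_def)
      also have "\<dots> = (\<integral>z. (indicator A (snd z) - 0 * indicator A (snd z)) *\<^sub>R e z \<partial>P)"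
        unfolding \<rho>_def vm_density_def set_lebesgue_integral_def
        by (intro Bochner_Integration.integral_cong) (auto simp: indicator_def)
      finally show "(LINT y:A|\<sigma>. m0 y) = (\<integral>z. (indicator A (snd z) - 0 * indicator A (snd z)) *\<^sub>R e z \<partial>P)" .
    qed auto
    also have "(\<integral>y. w y \<bullet> m0 y \<partial>\<sigma>) = (\<integral>y. w y \<bullet> m y \<partial>\<sigma>)"
    proof (rule integral_cong_AE)
      show "AE y in \<sigma>. w y \<bullet> m0 y = w y \<bullet> m y"
        using AE_m by eventually_elim simp
    qed (simp_all add: \<sigma>_def)
    also have "\<dots> = (\<integral>z. w (snd z) \<bullet> m (snd z) \<partial>P)"
      unfolding \<sigma>_def by (rule integral_distr) auto
    finally show "(\<integral>z. w (snd z) \<bullet> e z \<partial>P) = (\<integral>z. w (snd z) \<bullet> m (snd z) \<partial>P)"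
      by simp
  qed
qed

text \<open>The mixed term of \<open>iso_defect_triangle\<close> for source, \<open>w\<close> and
  target, divided by the distance between source and target. The direction identity makes it linear
  in \<open>\<theta> z\<close> and \<open>e z\<close>.\<close>

definition gap :: "'a \<Rightarrow> 'a \<times> 'a \<Rightarrow> real" where
  "gap w z = (u w - u (snd z)) \<bullet> \<theta> z - (w - snd z) \<bullet> e z"

lemma gap_identity:
  "AE z in P. snd z \<in> N \<longrightarrow> 0 < norm (fst z - snd z) \<and> e z = (1 / norm (fst z - snd z)) *\<^sub>R (fst z - snd z) \<and>
    (\<forall>w. iso_defect u (fst z) w = iso_defect u (snd z) w + 2 * norm (fst z - snd z) * gap w z \<and>
      \<bar>gap w z\<bar> \<le> 2 * norm (w - snd z))"
  using N_fst direction norm_polar_density[OF vm\<pi>]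
proof eventually_elim
  case (elim z)
  show ?case
  proof (intro impI conjI allI)
    assume z: "snd z \<in> N"
    let ?r = "norm (fst z - snd z)"
    have "fst z \<noteq> snd z" using elim(1) z by metis
    then show r: "0 < ?r" by simp
    show "e z = (1 / ?r) *\<^sub>R (fst z - snd z)" by (simp add: e_def)
    have re: "fst z - snd z = ?r *\<^sub>R e z"
      using r by (simp add: e_def)
    have d: "iso_defect u (fst z) (snd z) = 0"
      using elim(2,3) by (simp add: iso_defect_eq_0)
    fix w
    have "(u (fst z) - u (snd z)) \<bullet> (u w - u (snd z)) - (fst z - snd z) \<bullet> (w - snd z) = ?r * gap w z"
    proof -
      have "(u (fst z) - u (snd z)) \<bullet> (u w - u (snd z)) = ?r * ((u w - u (snd z)) \<bullet> \<theta> z)"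
        unfolding elim(2) by (simp add: inner_commute)
      moreover have "(fst z - snd z) \<bullet> (w - snd z) = ?r * ((w - snd z) \<bullet> e z)"
        by (subst re) (simp add: inner_commute)
      ultimately show ?thesis
        by (simp add: gap_def right_diff_distrib)
    qed
    then show "iso_defect u (fst z) w = iso_defect u (snd z) w + 2 * ?r * gap w z"
      using iso_defect_triangle[of u "fst z" w "snd z"] d by simp
    have "\<bar>(u w - u (snd z)) \<bullet> \<theta> z\<bar> \<le> norm (w - snd z)"
      using Cauchy_Schwarz_ineq2[of "u w - u (snd z)" "\<theta> z"] elim(3) lipschitz_onD[OF lip, of w "snd z"]
      by (simp add: dist_norm)
    moreover have "\<bar>(w - snd z) \<bullet> e z\<bar> \<le> norm (w - snd z)"
      using Cauchy_Schwarz_ineq2[of "w - snd z" "e z"] mult_left_le[OF norm_e[of z] norm_ge_zero[of "w - snd z"]]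
      by linarith
    ultimately show "\<bar>gap w z\<bar> \<le> 2 * norm (w - snd z)"
      unfolding gap_def by linarith
  qed
qed

text \<open>On average the part of \<open>gap\<close> with \<open>\<theta>\<close> cancels, which
  leaves the part with \<open>e\<close>. The negative part of \<open>gap\<close> is at most
  \<open>1 / Suc j\<close> divided by \<open>2 * norm (fst z - snd z)\<close>, because the defect of
  \<open>fst z\<close> and \<open>\<zeta> j (snd z)\<close> is non-negative, so it disappears in the
  limit.\<close>

lemma gap_limit:
  fixes F :: "'a set" and \<zeta> :: "nat \<Rightarrow> 'a \<Rightarrow> 'a"
  assumes F[measurable]: "F \<in> sets borel" and FN: "F \<subseteq> N" and FR: "\<And>y. y \<in> F \<Longrightarrow> norm y \<le> R"
    and \<zeta>[measurable]: "\<And>j. \<zeta> j \<in> borel_measurable borel" and \<zeta>R: "\<And>j y. y \<in> F \<Longrightarrow> norm (\<zeta> j y) \<le> R"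
    and small: "\<And>j y. y \<in> F \<Longrightarrow> iso_defect u y (\<zeta> j y) \<le> 1 / Suc j"
  defines "D \<equiv> \<lambda>j z. indicator F (snd z) * gap (\<zeta> j (snd z)) z"
  shows "integrable P (D j)" "D j \<in> borel_measurable P"
    and "(\<integral>z. D j z \<partial>P) = - (\<integral>z. (indicator F (snd z) *\<^sub>R (\<zeta> j (snd z) - snd z)) \<bullet> e z \<partial>P)"
    and "(\<lambda>j. \<integral>z. max 0 (- D j z) \<partial>P) \<longlonglongrightarrow> 0"
    and "integrable P (\<lambda>z. max 0 (- D j z))"
proof -
  have R: "0 \<le> R" if "y \<in> F" for y
    using FR[OF that] norm_ge_zero order_trans by blast
  have \<zeta>y: "norm (\<zeta> j y - y) \<le> 2 * R" if "y \<in> F" for j y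
    using norm_triangle_ineq4[of "\<zeta> j y" y] \<zeta>R[OF that, of j] FR[OF that] by simp
  have Dm[measurable]: "D j \<in> borel_measurable borel" for j
    unfolding D_def gap_def by measurable
  then show "D j \<in> borel_measurable P" for j by simp
  have bound: "AE z in P. \<bar>D j z\<bar> \<le> 4 * \<bar>R\<bar>" for j
    using gap_identity
  proof eventually_elim
    case (elim z)
    show ?case
    proof (cases "snd z \<in> F")
      case True
      then have "\<bar>gap (\<zeta> j (snd z)) z\<bar> \<le> 2 * norm (\<zeta> j (snd z) - snd z)"
        using elim FN by blast
      then show ?thesis
        using \<zeta>y[OF True, of j] True by (simp add: D_def)
    qed (simp add: D_def)
  qed
  show int: "integrable P (D j)" for j
    using bound[of j] by (intro P.integrable_const_bound[where B = "4 * \<bar>R\<bar>"]) auto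
  show "integrable P (\<lambda>z. max 0 (- D j z))" for j
    using int[of j] by auto
  define w1 w2 where "w1 = (\<lambda>j y. indicator F y *\<^sub>R (u (\<zeta> j y) - u y))" and "w2 = (\<lambda>j y. indicator F y *\<^sub>R (\<zeta> j y - y))"
  have [measurable]: "w1 j \<in> borel_measurable borel" "w2 j \<in> borel_measurable borel" for j
    unfolding w1_def w2_def by measurable
  have w2b: "norm (w2 j y) \<le> 2 * \<bar>R\<bar>" for j y
    using \<zeta>y[of y j] by (cases "y \<in> F") (auto simp: w2_def)
  have w1b: "norm (w1 j y) \<le> 2 * \<bar>R\<bar>" for j y
    using \<zeta>y[of y j] lipschitz_onD[OF lip, of "\<zeta> j y" y] by (cases "y \<in> F") (auto simp: w1_def dist_norm)
  have "D j z = w1 j (snd z) \<bullet> \<theta> z - w2 j (snd z) \<bullet> e z" for j z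
    by (simp add: D_def gap_def w1_def w2_def right_diff_distrib)
  moreover have "integrable P (\<lambda>z. w1 j (snd z) \<bullet> \<theta> z)" for j
    by (rule integrable_bounded_inner[OF integrable_polar_density[OF vm\<pi>]]) (use w1b in auto)
  moreover have "integrable P (\<lambda>z. w2 j (snd z) \<bullet> e z)" for j
    by (rule integrable_bounded_inner[OF P.integrable_const_bound[where B = 1]]) (use w2b norm_e in auto)
  moreover have "(\<integral>z. w1 j (snd z) \<bullet> \<theta> z \<partial>P) = 0" for j
    using FN by (intro second_marginal_cancels[where B = "2 * \<bar>R\<bar>"] w1b) (auto simp: w1_def indicator_def)
  ultimately show "(\<integral>z. D j z \<partial>P) = - (\<integral>z. (indicator F (snd z) *\<^sub>R (\<zeta> j (snd z) - snd z)) \<bullet> e z \<partial>P)" for j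
    by (simp add: w2_def)
  have "(\<lambda>j. \<integral>z. max 0 (- D j z) \<partial>P) \<longlonglongrightarrow> (\<integral>z. 0 \<partial>P)"
  proof (rule integral_dominated_convergence[where w = "\<lambda>_. 4 * \<bar>R\<bar>"])
    show "AE z in P. norm (max 0 (- D j z)) \<le> 4 * \<bar>R\<bar>" for j
      using bound[of j] by eventually_elim auto
    show "AE z in P. (\<lambda>j. max 0 (- D j z)) \<longlonglongrightarrow> 0"
      using gap_identity
    proof eventually_elim
      case (elim z)
      show ?case
      proof (cases "snd z \<in> F")
        case True
        let ?r = "norm (fst z - snd z)"
        have r: "?r > 0" and id: "\<And>w. iso_defect u (fst z) w = iso_defect u (snd z) w + 2 * ?r * gap w z"
          using elim True FN by blast+
        have le: "max 0 (- D j z) \<le> 1 / (2 * ?r) * inverse (real (Suc j))" for j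
        proof -
          have "0 \<le> 1 / Suc j + 2 * ?r * gap (\<zeta> j (snd z)) z"
            using id[of "\<zeta> j (snd z)"] small[OF True, of j] iso_defect_nonneg[OF lip, of "fst z" "\<zeta> j (snd z)"] by linarith
          then have "- gap (\<zeta> j (snd z)) z * (2 * ?r) \<le> 1 / Suc j"
            by (simp add: mult.commute)
          then have "- gap (\<zeta> j (snd z)) z \<le> (1 / Suc j) / (2 * ?r)"
            using r by (subst pos_le_divide_eq) auto
          then have "- gap (\<zeta> j (snd z)) z \<le> 1 / (2 * ?r) * inverse (real (Suc j))"
            by (simp add: field_simps del: of_nat_Suc)
          then show ?thesis
            using True r by (simp add: D_def)
        qed
        have "(\<lambda>j. 1 / (2 * ?r) * inverse (real (Suc j))) \<longlonglongrightarrow> 1 / (2 * ?r) * 0"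
          by (intro tendsto_mult tendsto_const LIMSEQ_inverse_real_of_nat)
        then have lim: "(\<lambda>j. 1 / (2 * ?r) * inverse (real (Suc j))) \<longlonglongrightarrow> 0"
          by simp
        show ?thesis
        proof (rule tendsto_sandwich[OF _ _ tendsto_const lim])
          show "\<forall>\<^sub>F j in sequentially. 0 \<le> max 0 (- D j z)"
            by simp
          show "\<forall>\<^sub>F j in sequentially. max 0 (- D j z) \<le> 1 / (2 * ?r) * inverse (real (Suc j))"
            by (rule always_eventually[OF allI[OF le]])
        qed
      qed (simp add: D_def)
    qed
  qed auto
  then show "(\<lambda>j. \<integral>z. max 0 (- D j z) \<partial>P) \<longlonglongrightarrow> 0"
    by simp
qed

lemma dense_sequence:
  obtains q :: "nat \<Rightarrow> 'a" where "\<And>U x. open U \<Longrightarrow> x \<in> U \<Longrightarrow> \<exists>k. q k \<in> U"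
proof -
  obtain Q :: "'a set" where Q: "countable Q" "\<And>x e. 0 < e \<Longrightarrow> \<exists>q\<in>Q. dist q x < e"
    using countable_dense_points[where 'a='a] by metis
  have "\<exists>k. from_nat_into Q k \<in> U" if U: "open U" "x \<in> U" for U x
  proof -
    obtain d where "d > 0" "ball x d \<subseteq> U"
      using openE[OF U] by blast
    moreover obtain p where "p \<in> Q" "dist p x < d"
      using Q(2)[OF \<open>d > 0\<close>] by blast
    moreover obtain k where "from_nat_into Q k = p"
      using from_nat_into_surj[OF Q(1) \<open>p \<in> Q\<close>] by blast
    ultimately have "from_nat_into Q k \<in> U"
      by (auto simp: dist_commute)
    then show ?thesis by blast
  qed
  then show ?thesis by (rule that)
qed

lemma isometric_AE: "AE z in P. iso_defect u (fst z) (snd z) = 0"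
  using direction norm_polar_density[OF vm\<pi>]
  by eventually_elim (simp add: iso_defect_eq_0)

lemma open_near_isometric:
  "open {w. norm w < R \<and> iso_defect u y w < d}"
  by (intro open_Collect_conj open_Collect_less continuous_on_iso_defect[OF u_cont] continuous_intros)

text \<open>Targets \<open>y\<close> with nearly isometric points \<open>w\<close> such that
  \<open>(w - y) \<bullet> m y\<close> stays above \<open>1 / Suc i\<close> form a null set: there
  the mean of \<open>gap\<close> would be too negative for \<open>gap_limit\<close>. The sources are
  such points \<open>w\<close>, so \<open>m (snd z) \<bullet> e z \<le> 0\<close>; as
  \<open>m\<close> is the mean of \<open>e\<close>, the integral of \<open>m \<bullet> m\<close>
  over targets in \<open>N\<close> is at most 0.\<close>

lemma mean_direction_zero:
  assumes w: "w \<in> borel_measurable borel" and bdd: "\<And>y. norm (w y) \<le> B" and supp: "\<And>y. y \<notin> N \<Longrightarrow> w y = 0"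
  shows "(\<integral>z. w (snd z) \<bullet> e z \<partial>P) = 0"
proof -
  obtain m where m[measurable]: "m \<in> borel_measurable borel" and m1: "\<And>y. norm (m y) \<le> 1"
    and mean: "\<And>w B. w \<in> borel_measurable borel \<Longrightarrow> (\<And>y. norm (w y) \<le> B) \<Longrightarrow> (\<And>y. y \<notin> N \<Longrightarrow> w y = 0) \<Longrightarrow>
      (\<integral>z. w (snd z) \<bullet> e z \<partial>P) = (\<integral>z. w (snd z) \<bullet> m (snd z) \<partial>P)"
    using mean_direction by blast
  obtain q :: "nat \<Rightarrow> 'a" where q: "\<And>U x. open U \<Longrightarrow> x \<in> U \<Longrightarrow> \<exists>k. q k \<in> U"
    using dense_sequence by blast
  \<comment> \<open>The dense point \<open>q k\<close> is an admissible choice for \<open>y\<close>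
    at level \<open>j\<close>. The bound \<open>R\<close> keeps all choices bounded, and
    \<open>i\<close> fixes how far the inner product stays above 0.\<close>
  define G where "G = (\<lambda>i (R::nat) (j::nat) k. {y \<in> N. norm y \<le> R \<and> norm (q k) \<le> R \<and>
    iso_defect u y (q k) \<le> 1 / Suc j \<and> 1 / real (Suc i) \<le> (q k - y) \<bullet> m y})"
  have G[measurable]: "G i R j k \<in> sets borel" for i R j k
    unfolding G_def by measurable
  define F where "F = (\<lambda>i R. \<Inter>j. \<Union>k. G i R j k)"
  have F[measurable]: "F i R \<in> sets borel" for i R
    unfolding F_def by measurable
  have F_null: "AE z in P. snd z \<notin> F i R" for i R
  proof -
    have "\<forall>j. \<exists>\<zeta>. \<zeta> \<in> borel \<rightarrow>\<^sub>M borel \<and> (\<forall>y \<in> (\<Union>k. G i R j k). \<exists>k. \<zeta> y = q k \<and> y \<in> G i R j k)"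
      by (intro allI measurable_first_index[OF G])
    from choice[OF this] obtain \<zeta> where \<zeta>': "\<forall>j. \<zeta> j \<in> borel \<rightarrow>\<^sub>M borel \<and> (\<forall>y \<in> (\<Union>k. G i R j k). \<exists>k. \<zeta> j y = q k \<and> y \<in> G i R j k)"
      by (elim exE)
    then have \<zeta>: "\<And>j. \<zeta> j \<in> borel \<rightarrow>\<^sub>M borel"
      by simp
    have \<zeta>2: "\<forall>y \<in> (\<Union>k. G i R j k). \<exists>k. \<zeta> j y = q k \<and> y \<in> G i R j k" for j
      using \<zeta>' by (elim allE[of _ j] conjE)
    have \<zeta>F: "y \<in> N" "norm y \<le> R" "norm (\<zeta> j y) \<le> R" "iso_defect u y (\<zeta> j y) \<le> 1 / Suc j"
      "1 / real (Suc i) \<le> (\<zeta> j y - y) \<bullet> m y" if y: "y \<in> F i R" for j y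
    proof -
      have "y \<in> (\<Union>k. G i R j k)"
        using y unfolding F_def by blast
      then obtain k where "\<zeta> j y = q k" "y \<in> G i R j k"
        using \<zeta>2[of j] by (elim ballE exE conjE) auto
      then show "y \<in> N" "norm y \<le> R" "norm (\<zeta> j y) \<le> R" "iso_defect u y (\<zeta> j y) \<le> 1 / Suc j"
        "1 / real (Suc i) \<le> (\<zeta> j y - y) \<bullet> m y"
        by (simp_all add: G_def)
    qed
    have FN: "F i R \<subseteq> N"
      using \<zeta>F(1) by blast
    note gl = gap_limit[OF F FN \<zeta>F(2) \<zeta> \<zeta>F(3) \<zeta>F(4)]
    have [measurable]: "\<zeta> j \<in> borel_measurable borel" for j
      by (rule \<zeta>)
    define W where "W = (\<lambda>j y. indicator (F i R) y *\<^sub>R (\<zeta> j y - y))"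
    have W_m[measurable]: "W j \<in> borel_measurable borel" for j
      unfolding W_def by measurable
    have W_b: "norm (W j y) \<le> 2 * real R" for j y
    proof (cases "y \<in> F i R")
      case True
      then show ?thesis
        using norm_triangle_ineq4[of "\<zeta> j y" y] \<zeta>F(2)[OF True] \<zeta>F(3)[OF True, of j] by (simp add: W_def)
    qed (simp add: W_def)
    have le: "1 / real (Suc i) * measure P (snd -` F i R) \<le> (\<integral>z. max 0 (- (indicator (F i R) (snd z) * gap (\<zeta> j (snd z)) z)) \<partial>P)" for j
    proof -
      have "1 / real (Suc i) * measure P (snd -` F i R) = (\<integral>z. 1 / real (Suc i) * indicator (F i R) (snd z) \<partial>P)"
      proof -
        have "(\<integral>z. indicator (snd -` F i R) z \<partial>P) = measure P (snd -` F i R)"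
          using measurable_sets[OF borel_measurable_fst_snd(2) F] by simp
        then show ?thesis
          by (simp add: indicator_def vimage_def)
      qed
      also have "\<dots> \<le> (\<integral>z. W j (snd z) \<bullet> m (snd z) \<partial>P)"
      proof (rule integral_mono)
        show "integrable P (\<lambda>z. 1 / real (Suc i) * indicator (F i R) (snd z))"
          by (rule P.integrable_const_bound[where B = 1]) (auto simp: indicator_def)
        show "integrable P (\<lambda>z. W j (snd z) \<bullet> m (snd z))"
          by (rule integrable_bounded_inner[OF P.integrable_const_bound[where B = 1]]) (use W_b m1 in auto)
        show "1 / real (Suc i) * indicator (F i R) (snd z) \<le> W j (snd z) \<bullet> m (snd z)" for z :: "'a \<times> 'a"
          using \<zeta>F(5)[of "snd z" j] by (cases "snd z \<in> F i R") (auto simp: W_def)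
      qed
      also have "\<dots> = (\<integral>z. W j (snd z) \<bullet> e z \<partial>P)"
        using FN by (intro mean[OF W_m W_b, symmetric]) (auto simp: W_def indicator_def)
      also have "\<dots> = (\<integral>z. - (indicator (F i R) (snd z) * gap (\<zeta> j (snd z)) z) \<partial>P)"
        using gl(3)[of j] by (simp add: W_def)
      also have "\<dots> \<le> (\<integral>z. max 0 (- (indicator (F i R) (snd z) * gap (\<zeta> j (snd z)) z)) \<partial>P)"
        by (rule integral_mono[OF integrable_minus[OF gl(1)] gl(5)]) (assumption | rule max.cobounded2)+
      finally show ?thesis .
    qed
    have "1 / real (Suc i) * measure P (snd -` F i R) \<le> 0"
      by (rule LIMSEQ_le_const[OF gl(4)]) (use le in auto)
    then have "measure P (snd -` F i R) = 0"
      using measure_nonneg[of P "snd -` F i R"] by (simp add: field_simps)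
    then have "snd -` F i R \<in> null_sets P"
      using measurable_sets[OF borel_measurable_fst_snd(2) F] by (auto simp: null_sets_def P.emeasure_eq_measure)
    from AE_not_in[OF this] show ?thesis
      by eventually_elim simp
  qed
  then have "AE z in P. \<forall>i R. snd z \<notin> F i R"
    by (simp add: AE_all_countable)
  with isometric_AE have neg: "AE z in P. snd z \<in> N \<longrightarrow> (fst z - snd z) \<bullet> m (snd z) \<le> 0"
  proof eventually_elim
    case (elim z)
    show ?case
    proof (rule impI, rule ccontr)
      assume y: "snd z \<in> N" and "\<not> (fst z - snd z) \<bullet> m (snd z) \<le> 0"
      then obtain i where i: "1 / real (Suc i) < (fst z - snd z) \<bullet> m (snd z)"
        using nat_approx_posE[of "(fst z - snd z) \<bullet> m (snd z)"] by auto
      obtain R :: nat where R: "max (norm (fst z) + 1) (norm (snd z)) \<le> R"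
        using real_arch_simple by blast
      \<comment> \<open>\<open>fst z\<close> is isometric to \<open>snd z\<close>, and the
        conditions in \<open>?U\<close> are open, so at every level \<open>j\<close> a dense point
        can take its place.\<close>
      have "\<exists>k. snd z \<in> G i R j k" for j
      proof -
        let ?U = "{w. norm w < R \<and> iso_defect u (snd z) w < 1 / Suc j} \<inter> {w. 1 / real (Suc i) < (w - snd z) \<bullet> m (snd z)}"
        have "open ?U"
          by (intro open_Int open_near_isometric open_Collect_less continuous_intros)
        moreover have "fst z \<in> ?U"
          using elim(1) i R by (simp add: iso_defect_commute)
        ultimately obtain k where "q k \<in> ?U"
          using q by blast
        then show ?thesis
          using y R by (intro exI[of _ k]) (simp add: G_def)
      qed
      then have "snd z \<in> F i R"
        unfolding F_def by blast
      with elim(2) show False by blast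
    qed
  qed
  have ind_m[measurable]: "(\<lambda>y. indicator N y *\<^sub>R m y) \<in> borel_measurable borel"
    by measurable
  have "(\<integral>z. (indicator N (snd z) *\<^sub>R m (snd z)) \<bullet> m (snd z) \<partial>P) = (\<integral>z. (indicator N (snd z) *\<^sub>R m (snd z)) \<bullet> e z \<partial>P)"
    by (rule mean[OF ind_m, of 1, symmetric]) (auto simp: indicator_def m1)
  also have "\<dots> \<le> 0"
  proof -
    have "AE z in P. 0 \<le> - ((indicator N (snd z) *\<^sub>R m (snd z)) \<bullet> e z)"
      using neg
    proof eventually_elim
      case (elim z)
      have "m (snd z) \<bullet> e z = (1 / norm (fst z - snd z)) * ((fst z - snd z) \<bullet> m (snd z))"
        by (simp add: e_def inner_commute)
      with elim show ?case
        by (cases "snd z \<in> N") (auto intro!: divide_nonpos_nonneg)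
    qed
    from integral_nonneg_AE[OF this] show ?thesis by simp
  qed
  finally have "(\<integral>z. indicator N (snd z) * (m (snd z) \<bullet> m (snd z)) \<partial>P) \<le> 0"
    by simp
  moreover have int: "integrable P (\<lambda>z. indicator N (snd z) * (m (snd z) \<bullet> m (snd z)))"
  proof (rule P.integrable_const_bound[where B = 1])
    have "m y \<bullet> m y \<le> 1" for y
      using m1[of y] by (simp add: power2_norm_eq_inner[symmetric] power_le_one)
    then show "AE z in P. norm (indicator N (snd z) * (m (snd z) \<bullet> m (snd z))) \<le> 1"
      by (auto simp: indicator_def)
  qed measurable
  moreover have nn: "AE z in P. 0 \<le> indicator N (snd z) * (m (snd z) \<bullet> m (snd z))"
    by (auto simp: indicator_def)
  ultimately have "(\<integral>z. indicator N (snd z) * (m (snd z) \<bullet> m (snd z)) \<partial>P) = 0"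
    using integral_nonneg_AE[OF nn] by linarith
  then have "AE z in P. indicator N (snd z) * (m (snd z) \<bullet> m (snd z)) = 0"
    using integral_nonneg_eq_0_iff_AE[OF int nn] by blast
  then have "AE z in P. w (snd z) \<bullet> m (snd z) = 0"
    by eventually_elim (use supp in \<open>auto simp: indicator_def split: if_splits\<close>)
  then have "(\<integral>z. w (snd z) \<bullet> m (snd z) \<partial>P) = 0"
    by (rule integral_eq_zero_AE)
  with mean[OF w bdd supp] show ?thesis
    by simp
qed

text \<open>With the mean of \<open>e\<close> gone, \<open>gap_limit\<close> gives
  \<open>gap\<close> mean 0 and a vanishing negative part, hence convergence to 0 in the mean and
  almost everywhere along a subsequence. Then \<open>fst z\<close> is nearly isometric to the points
  chosen close to \<open>w\<close>. Countably many balls \<open>V i n\<close> catch all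
  \<open>w\<close> with a single null set.\<close>

theorem leaf_through_target:
  "AE z in P. snd z \<in> N \<longrightarrow> (\<forall>w. iso_defect u (snd z) w = 0 \<longrightarrow> iso_defect u (fst z) w = 0)"
proof -
  obtain q :: "nat \<Rightarrow> 'a" where q: "\<And>U x. open U \<Longrightarrow> x \<in> U \<Longrightarrow> \<exists>k. q k \<in> U"
    using dense_sequence by blast
  define V where "V = (\<lambda>i n. ball (q i) (1 / real (Suc n)))"
  define G where "G = (\<lambda>i n (R::nat) (j::nat) k. {y \<in> N. norm y \<le> R \<and> norm (q k) \<le> R \<and>
    iso_defect u y (q k) \<le> 1 / Suc j \<and> q k \<in> V i n})"
  have G[measurable]: "G i n R j k \<in> sets borel" for i n R j k
    unfolding G_def by measurable
  define F where "F = (\<lambda>i n R. \<Inter>j. \<Union>k. G i n R j k)"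
  have F[measurable]: "F i n R \<in> sets borel" for i n R
    unfolding F_def by measurable
  have main: "AE z in P. snd z \<in> F i n R \<longrightarrow> (\<forall>d>0. \<exists>w\<in>V i n. iso_defect u (fst z) w < d)" for i n R
  proof -
    have "\<forall>j. \<exists>\<zeta>. \<zeta> \<in> borel \<rightarrow>\<^sub>M borel \<and> (\<forall>y \<in> (\<Union>k. G i n R j k). \<exists>k. \<zeta> y = q k \<and> y \<in> G i n R j k)"
      by (intro allI measurable_first_index[OF G])
    from choice[OF this] obtain \<zeta> where \<zeta>': "\<forall>j. \<zeta> j \<in> borel \<rightarrow>\<^sub>M borel \<and> (\<forall>y \<in> (\<Union>k. G i n R j k). \<exists>k. \<zeta> j y = q k \<and> y \<in> G i n R j k)"
      by (elim exE)
    then have \<zeta>: "\<And>j. \<zeta> j \<in> borel \<rightarrow>\<^sub>M borel"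
      by simp
    have \<zeta>2: "\<forall>y \<in> (\<Union>k. G i n R j k). \<exists>k. \<zeta> j y = q k \<and> y \<in> G i n R j k" for j
      using \<zeta>' by (elim allE[of _ j] conjE)
    have \<zeta>F: "y \<in> N" "norm y \<le> R" "norm (\<zeta> j y) \<le> R" "iso_defect u y (\<zeta> j y) \<le> 1 / Suc j"
      "\<zeta> j y \<in> V i n" if y: "y \<in> F i n R" for j y
    proof -
      have "y \<in> (\<Union>k. G i n R j k)"
        using y unfolding F_def by blast
      then obtain k where "\<zeta> j y = q k" "y \<in> G i n R j k"
        using \<zeta>2[of j] by (elim ballE exE conjE) auto
      then show "y \<in> N" "norm y \<le> R" "norm (\<zeta> j y) \<le> R" "iso_defect u y (\<zeta> j y) \<le> 1 / Suc j"
        "\<zeta> j y \<in> V i n"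
        by (simp_all add: G_def)
    qed
    have FN: "F i n R \<subseteq> N"
      using \<zeta>F(1) by blast
    note gl = gap_limit[OF F FN \<zeta>F(2) \<zeta> \<zeta>F(3) \<zeta>F(4)]
    have [measurable]: "\<zeta> j \<in> borel_measurable borel" for j
      by (rule \<zeta>)
    define D where "D = (\<lambda>j z. indicator (F i n R) (snd z) * gap (\<zeta> j (snd z)) z)"
    have "(\<integral>z. (indicator (F i n R) (snd z) *\<^sub>R (\<zeta> j (snd z) - snd z)) \<bullet> e z \<partial>P) = 0" for j
    proof (rule mean_direction_zero[where B = "2 * real R"])
      show "norm (indicator (F i n R) y *\<^sub>R (\<zeta> j y - y)) \<le> 2 * real R" for y
      proof (cases "y \<in> F i n R")
        case True
        then show ?thesis
          using norm_triangle_ineq4[of "\<zeta> j y" y] \<zeta>F(2)[OF True] \<zeta>F(3)[OF True, of j] by simp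
      qed simp
    qed (use FN in \<open>auto simp: indicator_def\<close>)
    then have D0: "(\<integral>z. D j z \<partial>P) = 0" for j
      using gl(3)[of j] by (simp add: D_def)
    have "(\<integral>z. norm (D j z) \<partial>P) = 2 * (\<integral>z. max 0 (- D j z) \<partial>P)" for j
    proof -
      have "(\<integral>z. norm (D j z) \<partial>P) = (\<integral>z. D j z + 2 * max 0 (- D j z) \<partial>P)"
        by (intro Bochner_Integration.integral_cong) (auto simp: max_def)
      also have "\<dots> = (\<integral>z. D j z \<partial>P) + (\<integral>z. 2 * max 0 (- D j z) \<partial>P)"
        using gl(1)[of j] gl(5)[of j] unfolding D_def by (intro Bochner_Integration.integral_add) auto
      finally show ?thesis using D0 by simp
    qed
    moreover have "(\<lambda>j. 2 * (\<integral>z. max 0 (- D j z) \<partial>P)) \<longlonglongrightarrow> 2 * 0"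
      using gl(4) unfolding D_def by (intro tendsto_mult tendsto_const)
    ultimately have "(\<lambda>j. \<integral>z. norm (D j z) \<partial>P) \<longlonglongrightarrow> 0"
      by simp
    moreover have "integrable P (D j)" for j
      using gl(1)[of j] by (simp add: D_def)
    ultimately obtain s :: "nat \<Rightarrow> nat" where s: "strict_mono s" "AE z in P. (\<lambda>j. D (s j) z) \<longlonglongrightarrow> 0"
      using tendsto_L1_AE_subseq[of P D] by blast
    from s(2) gap_identity show ?thesis
    proof eventually_elim
      case (elim z)
      show ?case
      proof (intro impI allI)
        fix d :: real
        assume y: "snd z \<in> F i n R" and d: "0 < d"
        let ?r = "norm (fst z - snd z)"
        have id: "iso_defect u (fst z) w = iso_defect u (snd z) w + 2 * ?r * gap w z" for w
          using elim(2) y FN by blast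
        have "(\<lambda>j. inverse (real (Suc (s j))) + 2 * ?r * D (s j) z) \<longlonglongrightarrow> 0 + 2 * ?r * 0"
          by (intro tendsto_add tendsto_mult tendsto_const elim(1) LIMSEQ_subseq_LIMSEQ[OF LIMSEQ_inverse_real_of_nat s(1), unfolded comp_def])
        then have "(\<lambda>j. inverse (real (Suc (s j))) + 2 * ?r * D (s j) z) \<longlonglongrightarrow> 0"
          by simp
        then have "\<forall>\<^sub>F j in sequentially. inverse (real (Suc (s j))) + 2 * ?r * D (s j) z < d"
          using d by (rule order_tendstoD(2))
        then obtain j where j: "inverse (real (Suc (s j))) + 2 * ?r * D (s j) z < d"
          by (auto simp: eventually_sequentially)
        have "iso_defect u (fst z) (\<zeta> (s j) (snd z)) < d"
          using id[of "\<zeta> (s j) (snd z)"] \<zeta>F(4)[OF y, of "s j"] j y by (simp add: D_def inverse_eq_divide)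
        with \<zeta>F(5)[OF y] show "\<exists>w\<in>V i n. iso_defect u (fst z) w < d"
          by blast
      qed
    qed
  qed
  have "AE z in P. \<forall>i n R. snd z \<in> F i n R \<longrightarrow> (\<forall>d>0. \<exists>w\<in>V i n. iso_defect u (fst z) w < d)"
    unfolding AE_all_countable using main by blast
  then show ?thesis
  proof eventually_elim
    case (elim z)
    show ?case
    proof (intro impI allI, rule ccontr)
      fix w
      assume y: "snd z \<in> N" and w: "iso_defect u (snd z) w = 0" and ne: "iso_defect u (fst z) w \<noteq> 0"
      \<comment> \<open>A positive defect at \<open>w\<close> persists above \<open>\<eta>\<close>
        on a small ball, whereas \<open>V i n\<close> inside that ball contains a point with defect
        below \<open>\<eta>\<close>.\<close>
      define \<eta> where "\<eta> = iso_defect u (fst z) w / 2"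
      have \<eta>: "0 < \<eta>" "\<eta> < iso_defect u (fst z) w"
        using ne iso_defect_nonneg[OF lip, of "fst z" w] by (auto simp: \<eta>_def)
      have "open {w. \<eta> < iso_defect u (fst z) w}"
        by (intro open_Collect_less continuous_on_iso_defect[OF u_cont] continuous_intros)
      then obtain d where d: "d > 0" "ball w d \<subseteq> {w. \<eta> < iso_defect u (fst z) w}"
        using openE[of "{w. \<eta> < iso_defect u (fst z) w}" w] \<eta>(2) by blast
      obtain n where n: "1 / real (Suc n) < d / 2"
        using nat_approx_posE[of "d / 2"] d(1) by auto
      obtain i where i: "q i \<in> ball w (1 / real (Suc n))"
        using q[of "ball w (1 / real (Suc n))" w] by auto
      have wV: "w \<in> V i n"
        using i by (simp add: V_def dist_commute)
      have Vd: "V i n \<subseteq> ball w d"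
      proof
        fix p assume "p \<in> V i n"
        then have "dist (q i) p < 1 / Suc n" by (simp add: V_def)
        then show "p \<in> ball w d"
          using i n dist_triangle[of w p "q i"] by simp
      qed
      obtain R :: nat where R: "max (norm w + 1) (norm (snd z)) \<le> R"
        using real_arch_simple by blast
      have "\<exists>k. snd z \<in> G i n R j k" for j
      proof -
        let ?U = "{w. norm w < R \<and> iso_defect u (snd z) w < 1 / Suc j} \<inter> V i n"
        have "open ?U"
          unfolding V_def by (intro open_Int open_near_isometric open_ball)
        moreover have "w \<in> ?U"
          using w R wV by simp
        ultimately obtain k where "q k \<in> ?U"
          using q by blast
        then show ?thesis
          using y R by (intro exI[of _ k]) (simp add: G_def)
      qed
      then have "snd z \<in> F i n R"
        unfolding F_def by blast
      then obtain p where "p \<in> V i n" "iso_defect u (fst z) p < \<eta>"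
        using elim \<eta>(1) by blast
      with d(2) Vd show False
        by fastforce
    qed
  qed
qed

end

section \<open>Restriction to transport sets\<close>

lemma null_sets_total_variation:
  fixes \<mu> :: "'a::topological_space set \<Rightarrow> 'b::euclidean_space"
  assumes \<mu>: "vector_measure \<mu>" and A: "A \<in> sets borel"
    and zero: "\<And>B. B \<in> sets borel \<Longrightarrow> B \<subseteq> A \<Longrightarrow> \<mu> B = 0"
  shows "A \<in> null_sets (total_variation \<mu>)"
proof -
  have "variation \<mu> A \<le> 0"
  proof (rule variation_least)
    fix E :: "nat \<Rightarrow> 'a set"
    assume E: "range E \<subseteq> sets borel" "disjoint_family E" "(\<Union>i. E i) = A"
    have "\<mu> (E i) = 0" for i
      using E(1,3) by (intro zero) auto
    then show "(\<Sum>i. ennreal (norm (\<mu> (E i)))) \<le> 0" by simp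
  qed
  then show ?thesis
    using A by (simp add: null_sets_def emeasure_total_variation[OF \<mu> A])
qed

lemma null_sets_total_variation_lborel:
  fixes \<mu> :: "'a::euclidean_space set \<Rightarrow> 'b::euclidean_space"
  assumes \<mu>: "vector_measure \<mu>" and ac: "vm_absolutely_continuous lborel \<mu>" and A: "A \<in> null_sets lborel"
  shows "A \<in> null_sets (total_variation \<mu>)"
proof (rule null_sets_total_variation[OF \<mu>])
  show "A \<in> sets borel" using A by auto
  fix B assume "B \<in> sets borel" "B \<subseteq> A"
  then have "B \<in> null_sets lborel"
    using A by (intro null_sets_subset[OF A]) auto
  then show "\<mu> B = 0"
    using ac by (simp add: vm_absolutely_continuous_def)
qed

lemma vm_restrict_eq_density:
  fixes \<mu> :: "'a::topological_space set \<Rightarrow> 'b::euclidean_space"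
  assumes \<mu>: "vector_measure \<mu>" and A: "A \<in> sets borel" and B: "B \<in> sets borel"
  shows "vm_restrict \<mu> A B = vm_density (total_variation \<mu>) (\<lambda>x. indicator A x *\<^sub>R polar_density \<mu> x) B"
proof -
  have "vm_restrict \<mu> A B = (LINT x:(B \<inter> A)|total_variation \<mu>. polar_density \<mu> x)"
    using vm_density_polar[OF \<mu>, of "B \<inter> A"] A B by (simp add: vm_restrict_def vm_density_def)
  then show ?thesis
    by (simp add: vm_density_def set_lebesgue_integral_def indicator_inter_arith)
qed

lemma integrable_restrict_polar:
  fixes \<mu> :: "'a::topological_space set \<Rightarrow> 'b::euclidean_space"
  assumes "vector_measure \<mu>" "A \<in> sets borel"
  shows "integrable (total_variation \<mu>) (\<lambda>x. indicator A x *\<^sub>R polar_density \<mu> x)"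
  by (rule integrable_mult_indicator[OF _ integrable_polar_density[OF assms(1)]]) (simp add: assms(2))

lemma vector_measure_restrict:
  fixes \<mu> :: "'a::topological_space set \<Rightarrow> 'b::euclidean_space"
  assumes "vector_measure \<mu>" "A \<in> sets borel"
  shows "vector_measure (vm_restrict \<mu> A)"
proof -
  have "vector_measure (vm_restrict \<mu> A) \<longleftrightarrow>
      vector_measure (vm_density (total_variation \<mu>) (\<lambda>x. indicator A x *\<^sub>R polar_density \<mu> x))"
    by (rule vector_measure_cong) (rule vm_restrict_eq_density[OF assms])
  then show ?thesis
    using vector_measure_density[OF integrable_restrict_polar[OF assms] sets_total_variation] by (rule iffD2)
qed

lemma total_variation_restrict:
  fixes \<mu> :: "'a::topological_space set \<Rightarrow> 'b::euclidean_space"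
  assumes "vector_measure \<mu>" "A \<in> sets borel"
  shows "total_variation (vm_restrict \<mu> A) = density (total_variation \<mu>) (\<lambda>x. ennreal (indicator A x))"
proof -
  have [measurable]: "polar_density \<mu> \<in> borel_measurable borel" "A \<in> sets borel"
    using integrable_polar_density[OF assms(1)] assms(2) by auto
  have "total_variation (vm_restrict \<mu> A) =
      total_variation (vm_density (total_variation \<mu>) (\<lambda>x. indicator A x *\<^sub>R polar_density \<mu> x))"
    by (rule total_variation_cong) (rule vm_restrict_eq_density[OF assms])
  also have "\<dots> = density (total_variation \<mu>) (\<lambda>x. ennreal (norm (indicator A x *\<^sub>R polar_density \<mu> x)))"
    by (rule total_variation_density[OF finite_total_variation[OF assms(1)] sets_total_variation integrable_restrict_polar[OF assms]])
  also have "\<dots> = density (total_variation \<mu>) (\<lambda>x. ennreal (indicator A x))"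
  proof (rule density_cong)
    show "AE x in total_variation \<mu>. ennreal (norm (indicator A x *\<^sub>R polar_density \<mu> x)) = ennreal (indicator A x)"
      using norm_polar_density[OF assms(1)] by eventually_elim (simp add: indicator_def)
  qed measurable
  finally show ?thesis .
qed

lemma vm_integral_restrict:
  fixes \<mu> :: "'a::topological_space set \<Rightarrow> 'b::euclidean_space"
  assumes "vector_measure \<mu>" "A \<in> sets borel" "v \<in> borel_measurable borel"
  shows "vm_integral (vm_restrict \<mu> A) v = (\<integral>x. indicator A x * (v x \<bullet> polar_density \<mu> x) \<partial>total_variation \<mu>)"
proof -
  have "vm_integral (vm_restrict \<mu> A) v = (\<integral>x. v x \<bullet> (indicator A x *\<^sub>R polar_density \<mu> x) \<partial>total_variation \<mu>)"
    by (rule vm_integral_density[OF finite_total_variation[OF assms(1)] sets_total_variation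
      integrable_restrict_polar[OF assms(1,2)] vm_restrict_eq_density[OF assms(1,2)] assms(3)])
  then show ?thesis by (simp only: inner_scaleR_right)
qed

text \<open>Two isometric partners of \<open>snd z\<close> that are not isometric to each other are
  also partners of \<open>fst z\<close> by \<open>leaf_through_target\<close>. They would put
  \<open>fst z\<close> into the overlap, which lies in the non-differentiability set, a null set for
  the first marginal.\<close>

theorem transport_avoids_overlap:
  fixes \<mu> :: "'a::euclidean_space set \<Rightarrow> 'b::euclidean_space"
  assumes ac: "vm_absolutely_continuous lborel \<mu>" and u: "optimal_potential \<mu> u" and \<pi>: "optimal_transport \<mu> \<pi>"
    and fst_ac: "absolutely_continuous (total_variation \<mu>) (distr (total_variation \<pi>) borel fst)"
  shows "AE z in total_variation \<pi>. fst z \<notin> leaf_overlap u \<and> snd z \<notin> leaf_overlap u"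
proof -
  have \<mu>: "\<mu> \<in> W1_space" and \<pi>t: "\<pi> \<in> transports \<mu>" and lip: "1-lipschitz_on UNIV u"
    using \<pi> u by (auto simp: optimal_transport_def optimal_potential_def is_arg_min_def is_arg_max_def)
  let ?N = "nondiff_set u"
  note vm = W1_spaceD(1)[OF \<mu>]
  have N0: "?N \<in> null_sets lborel" by (rule rademacher[OF lip])
  then have N: "?N \<in> sets borel" by auto
  note N\<mu> = null_sets_total_variation_lborel[OF vm ac N0]
  then have "?N \<in> null_sets (distr (total_variation \<pi>) borel fst)"
    using fst_ac by (auto simp: absolutely_continuous_def)
  then have "AE x in distr (total_variation \<pi>) borel fst. x \<notin> ?N"
    by (rule AE_not_in)
  then have N_fst: "AE z in total_variation \<pi>. fst z \<notin> ?N"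
    by (rule AE_distrD[rotated]) (simp add: measurable_cong_sets[OF sets_total_variation refl])
  interpret cancelling_target \<mu> \<pi> u ?N
    by (rule cancelling_target.intro[OF vm \<pi>t lip optimal_transport_direction[OF \<pi> u] N N\<mu> N_fst])
  show ?thesis
    using N_fst leaf_through_target
  proof eventually_elim
    case (elim z)
    have f: "fst z \<notin> leaf_overlap u"
      using elim(1) leaf_overlap_subset_nondiff[OF lip] by blast
    moreover have "snd z \<notin> leaf_overlap u"
    proof
      assume s: "snd z \<in> leaf_overlap u"
      then have "snd z \<in> ?N"
        using leaf_overlap_subset_nondiff[OF lip] by blast
      with elim(2) have "\<And>w. iso_defect u (snd z) w = 0 \<Longrightarrow> iso_defect u (fst z) w = 0"
        by blast
      with s have "fst z \<in> leaf_overlap u"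
        unfolding leaf_overlap_iff by blast
      with f show False ..
    qed
    ultimately show ?case by blast
  qed
qed

text \<open>Almost every pair is isometric with both ends off the overlap, so the closure property
  of a transport set applies from either end.\<close>

lemma transport_respects_transport_set:
  fixes \<mu> :: "'a::euclidean_space set \<Rightarrow> 'b::euclidean_space"
  assumes ac: "vm_absolutely_continuous lborel \<mu>" and u: "optimal_potential \<mu> u" and \<pi>: "optimal_transport \<mu> \<pi>"
    and fst_ac: "absolutely_continuous (total_variation \<mu>) (distr (total_variation \<pi>) borel fst)"
    and A: "transport_set u A"
  shows "AE z in total_variation \<pi>. fst z \<in> A \<longleftrightarrow> snd z \<in> A"
proof -
  have "vector_measure \<pi>"
    using \<pi> by (auto simp: optimal_transport_def is_arg_min_def transports_def)
  from norm_polar_density[OF this] optimal_transport_direction[OF \<pi> u] transport_avoids_overlap[OF ac u \<pi> fst_ac]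
  show ?thesis
  proof eventually_elim
    case (elim z)
    then have "norm (u (fst z) - u (snd z)) = norm (fst z - snd z)"
      by simp
    moreover from this have "norm (u (snd z) - u (fst z)) = norm (snd z - fst z)"
      by (simp add: norm_minus_commute)
    ultimately show ?case
      using A elim(3) unfolding transport_set_def by blast
  qed
qed

theorem optimal_transport_localises:
  fixes \<mu> :: "'a::euclidean_space set \<Rightarrow> 'b::euclidean_space"
  assumes ac: "vm_absolutely_continuous lborel \<mu>" and u: "optimal_potential \<mu> u" and \<pi>: "optimal_transport \<mu> \<pi>"
    and fst_ac: "absolutely_continuous (total_variation \<mu>) (distr (total_variation \<pi>) borel fst)"
  shows "localises_to_transport_sets \<mu> u \<pi>"
  unfolding localises_to_transport_sets_def
proof (intro allI impI)
  fix A assume tA: "transport_set u A"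
  have \<mu>: "\<mu> \<in> W1_space" and \<pi>t: "\<pi> \<in> transports \<mu>" and lip: "1-lipschitz_on UNIV u"
    using \<pi> u by (auto simp: optimal_transport_def optimal_potential_def is_arg_min_def is_arg_max_def)
  note vm = W1_spaceD(1)[OF \<mu>]
  have vm\<pi>: "vector_measure \<pi>" and marg: "\<And>B. B \<in> sets borel \<Longrightarrow> \<pi> (B \<times> UNIV) - \<pi> (UNIV \<times> B) = \<mu> B"
    using \<pi>t by (auto simp: transports_def)
  have A[measurable]: "A \<in> sets borel" using tA by (simp add: transport_set_def)
  let ?P = "total_variation \<pi>" and ?\<theta> = "polar_density \<pi>"
  let ?\<pi>A = "vm_restrict \<pi> (A \<times> A)" and ?\<mu>A = "vm_restrict \<mu> A"
  have AA[measurable]: "A \<times> A \<in> sets borel" by (rule borel_Times[OF A A])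
  have \<theta>[measurable]: "?\<theta> \<in> borel_measurable borel" using integrable_polar_density[OF vm\<pi>] by auto
  have u_m[measurable]: "u \<in> borel_measurable borel"
    using lipschitz_on_continuous_on[OF lip] by (rule borel_measurable_continuous_onI)
  note sat = transport_respects_transport_set[OF ac u \<pi> fst_ac tA]
  \<comment> \<open>Sets that agree on the pairs with both or no coordinates in \<open>A\<close>
    have the same value under \<open>\<pi>\<close>; this yields the marginals of the restriction and
    \<open>\<mu> A = 0\<close>.\<close>
  have \<pi>_eq: "\<pi> E = \<pi> F" if E: "E \<in> sets borel" and F: "F \<in> sets borel"
    and EF: "\<And>z. (fst z \<in> A \<longleftrightarrow> snd z \<in> A) \<Longrightarrow> z \<in> E \<longleftrightarrow> z \<in> F" for E F
  proof -
    have "(LINT z:E|?P. ?\<theta> z) = (LINT z:F|?P. ?\<theta> z)"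
      unfolding set_lebesgue_integral_def
    proof (rule integral_cong_AE)
      show "AE z in ?P. indicator E z *\<^sub>R ?\<theta> z = indicator F z *\<^sub>R ?\<theta> z"
        using sat by eventually_elim (simp add: EF indicator_def)
    qed (use E F in measurable)
    then show ?thesis
      using vm_density_polar[OF vm\<pi> E] vm_density_polar[OF vm\<pi> F] by (simp add: vm_density_def)
  qed
  have vm\<pi>A: "vector_measure ?\<pi>A" and vm\<mu>A: "vector_measure ?\<mu>A"
    by (rule vector_measure_restrict[OF vm\<pi> AA], rule vector_measure_restrict[OF vm A])
  have \<pi>A: "?\<pi>A \<in> transports ?\<mu>A"
    unfolding transports_def
  proof (intro CollectI conjI ballI vm\<pi>A)
    fix B :: "'a set" assume B: "B \<in> sets borel"
    have BA: "B \<inter> A \<in> sets borel" using A B by (rule sets.Int[rotated])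
    have "\<pi> ((B \<times> UNIV) \<inter> (A \<times> A)) = \<pi> ((B \<inter> A) \<times> UNIV)"
      by (rule \<pi>_eq) (intro sets.Int AA transport_sets_borel(1)[OF B] transport_sets_borel(1)[OF BA], intro transport_sets_borel(1)[OF BA], auto simp: mem_Times_iff)
    moreover have "\<pi> ((UNIV \<times> B) \<inter> (A \<times> A)) = \<pi> (UNIV \<times> (B \<inter> A))"
      by (rule \<pi>_eq) (intro sets.Int AA transport_sets_borel(2)[OF B], intro transport_sets_borel(2)[OF BA], auto simp: mem_Times_iff)
    ultimately show "?\<pi>A (B \<times> UNIV) - ?\<pi>A (UNIV \<times> B) = ?\<mu>A B"
      using marg[OF BA] by (simp add: vm_restrict_def)
  qed
  have \<mu>A0: "\<mu> A = 0"
  proof -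
    have "\<pi> (A \<times> UNIV) = \<pi> (UNIV \<times> A)"
      by (rule \<pi>_eq) (intro transport_sets_borel(1)[OF A], intro transport_sets_borel(2)[OF A], auto simp: mem_Times_iff)
    with marg[OF A] show ?thesis by simp
  qed
  have \<mu>A: "?\<mu>A \<in> W1_space"
    unfolding W1_space_def
  proof (intro CollectI conjI exI vm\<mu>A)
    show "?\<mu>A UNIV = 0" using \<mu>A0 by (simp add: vm_restrict_def)
    have int: "integrable (total_variation \<mu>) (\<lambda>x. indicator A x *\<^sub>R norm (x - 0))"
      by (rule integrable_mult_indicator[OF _ W1_spaceD(3)[OF \<mu>]]) (simp add: A)
    show "integrable (total_variation ?\<mu>A) (\<lambda>x. norm (x - 0))"
      unfolding total_variation_restrict[OF vm A]
    proof (rule integrable_density[THEN iffD2])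
      show "(\<lambda>x::'a. norm (x - 0)) \<in> borel_measurable (total_variation \<mu>)" by measurable
      show "indicat_real A \<in> borel_measurable (total_variation \<mu>)" by measurable
      show "AE x in total_variation \<mu>. 0 \<le> indicat_real A x" by simp
    qed (rule int)
  qed
  have cost: "transport_cost ?\<pi>A = (\<integral>\<^sup>+z. ennreal (indicator (A \<times> A) z) * ennreal (norm (fst z - snd z)) \<partial>?P)"
    unfolding transport_cost_def total_variation_restrict[OF vm\<pi> AA] case_prod_unfold
    by (rule nn_integral_density) measurable
  have "transport_cost ?\<pi>A \<le> transport_cost \<pi>"
    unfolding cost unfolding transport_cost_def case_prod_unfold
    by (intro nn_integral_mono) (simp add: indicator_def)
  then have fin: "transport_cost ?\<pi>A < \<infinity>"
    using optimal_transport_integral(1)[OF \<pi> u] by (rule le_less_trans)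
  \<comment> \<open>By the direction identity the integrand on \<open>A \<times> A\<close> is the
    distance itself, so the dual value equals the cost.\<close>
  have vi: "vm_integral ?\<mu>A u = (\<integral>z. norm (fst z - snd z) \<partial>total_variation ?\<pi>A)"
  proof -
    have "vm_integral ?\<mu>A u = vm_integral ?\<pi>A (\<lambda>z. u (fst z) - u (snd z))"
      using transport_integral_lipschitz(2)[OF \<mu>A \<pi>A fin lip] by (simp add: vm_integral_def)
    also have "\<dots> = (\<integral>z. indicator (A \<times> A) z * ((u (fst z) - u (snd z)) \<bullet> ?\<theta> z) \<partial>?P)"
      by (rule vm_integral_restrict[OF vm\<pi> AA]) measurable
    also have "\<dots> = (\<integral>z. indicator (A \<times> A) z *\<^sub>R norm (fst z - snd z) \<partial>?P)"
    proof (rule integral_cong_AE)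
      show "AE z in ?P. indicator (A \<times> A) z * ((u (fst z) - u (snd z)) \<bullet> ?\<theta> z) = indicator (A \<times> A) z *\<^sub>R norm (fst z - snd z)"
        using optimal_transport_direction[OF \<pi> u] norm_polar_density[OF vm\<pi>]
        by eventually_elim (simp add: dot_square_norm)
    qed measurable
    also have "\<dots> = (\<integral>z. norm (fst z - snd z) \<partial>total_variation ?\<pi>A)"
      unfolding total_variation_restrict[OF vm\<pi> AA]
    proof (rule integral_density[THEN sym])
      show "(\<lambda>z::'a \<times> 'a. norm (fst z - snd z)) \<in> borel_measurable ?P" by measurable
      show "indicat_real (A \<times> A) \<in> borel_measurable ?P" by measurable
      show "AE x in ?P. 0 \<le> indicat_real (A \<times> A) x" by simp
    qed
    finally show ?thesis .
  qed
  have cost_eq: "transport_cost ?\<pi>A = ennreal (vm_integral ?\<mu>A u)" and nonneg: "0 \<le> vm_integral ?\<mu>A u"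
    using integrable_transport_distance(2)[OF fin] by (simp_all add: vi)
  show "?\<pi>A \<in> transports ?\<mu>A \<and> optimal_transport ?\<mu>A ?\<pi>A \<and> \<mu> A = 0 \<and> optimal_potential ?\<mu>A u"
    using \<pi>A \<mu>A0 optimal_pairI[OF \<mu>A \<pi>A lip cost_eq nonneg] by blast
qed

section \<open>Wijsman measurability\<close>

definition wijsman_box :: "'a::euclidean_space \<Rightarrow> real \<Rightarrow> real \<Rightarrow> 'a set set" where
  "wijsman_box q r s = {S \<in> closed_convex_sets. r < infdist q S \<and> infdist q S < s}"

text \<open>With finite \<open>I\<close>, centres from a countable dense set and rational bounds,
  the cells form a countable base; intersecting two cells amounts to uniting their index
  sets.\<close>

definition wijsman_cell :: "('a::euclidean_space \<times> real \<times> real) set \<Rightarrow> 'a set set" where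
  "wijsman_cell I = {S \<in> closed_convex_sets. \<forall>(q, r, s)\<in>I. S \<in> wijsman_box q r s}"

lemma infdist_lipschitz: "\<bar>infdist x S - infdist y S\<bar> \<le> dist x y"
  using infdist_triangle[of x S y] infdist_triangle[of y S x] dist_commute[of y x] by linarith

text \<open>Since \<open>infdist x S\<close> is Lipschitz in \<open>x\<close>, rational boxes at the points of a dense set suffice to
  refine every open set, so the Wijsman topology is second countable.\<close>

lemma wijsman_open_refine:
  fixes Q :: "'a::euclidean_space set"
  assumes Q: "\<And>x e. 0 < e \<Longrightarrow> \<exists>q\<in>Q. dist q x < e" and U: "openin wijsman_topology U"
  shows "U \<subseteq> closed_convex_sets \<and>
    (\<forall>S\<in>U. \<exists>I. finite I \<and> I \<subseteq> Q \<times> \<rat> \<times> \<rat> \<and> S \<in> wijsman_cell I \<and> wijsman_cell I \<subseteq> U)"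
proof -
  let ?\<G> = "{{S \<in> closed_convex_sets. infdist x S \<in> V} | (x::'a) V. open V}"
  have "generate_topology_on ?\<G> U"
    using U unfolding wijsman_topology_def by (rule openin_topology_generated_by)
  then show ?thesis
  proof (induction rule: generate_topology_on.induct)
    case (Int U V)
    show ?case
    proof (intro conjI ballI)
      show "U \<inter> V \<subseteq> closed_convex_sets" using Int.IH by blast
      fix S assume S: "S \<in> U \<inter> V"
      obtain I where I: "finite I" "I \<subseteq> Q \<times> \<rat> \<times> \<rat>" "S \<in> wijsman_cell I" "wijsman_cell I \<subseteq> U"
        using Int.IH(1) S by blast
      obtain J where J: "finite J" "J \<subseteq> Q \<times> \<rat> \<times> \<rat>" "S \<in> wijsman_cell J" "wijsman_cell J \<subseteq> V"
        using Int.IH(2) S by blast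
      have "wijsman_cell (I \<union> J) = wijsman_cell I \<inter> wijsman_cell J"
        unfolding wijsman_cell_def ball_Un by blast
      with I J show "\<exists>I. finite I \<and> I \<subseteq> Q \<times> \<rat> \<times> \<rat> \<and> S \<in> wijsman_cell I \<and> wijsman_cell I \<subseteq> U \<inter> V"
        by (intro exI[of _ "I \<union> J"]) auto
    qed
  next
    case (UN K)
    show ?case
    proof (intro conjI ballI)
      show "\<Union>K \<subseteq> closed_convex_sets" using UN.IH by blast
      fix S assume "S \<in> \<Union>K"
      then obtain U where U: "U \<in> K" "S \<in> U" by blast
      obtain I where "finite I" "I \<subseteq> Q \<times> \<rat> \<times> \<rat>" "S \<in> wijsman_cell I" "wijsman_cell I \<subseteq> U"
        using UN.IH[OF U(1)] U(2) by blast
      moreover have "U \<subseteq> \<Union>K" using U(1) by blast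
      ultimately show "\<exists>I. finite I \<and> I \<subseteq> Q \<times> \<rat> \<times> \<rat> \<and> S \<in> wijsman_cell I \<and> wijsman_cell I \<subseteq> \<Union>K"
        by (intro exI[of _ I]) simp
    qed
  next
    case (Basis B)
    then obtain x V where B: "B = {S \<in> closed_convex_sets. infdist x S \<in> V}" and V: "open V"
      by blast
    show ?case
    proof (intro conjI ballI)
      show "B \<subseteq> closed_convex_sets" by (auto simp: B)
      fix S assume S: "S \<in> B"
      define a where "a = infdist x S"
      obtain e where e: "e > 0" "ball a e \<subseteq> V"
        using openE[OF V, of a] S by (auto simp: B a_def)
      obtain q where q: "q \<in> Q" "dist q x < e / 4"
        using Q[of "e / 4" x] e(1) by auto
      have qa: "\<bar>infdist q S - a\<bar> < e / 4"
        using infdist_lipschitz[of q S x] q(2) by (simp add: a_def)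
      obtain r where r: "r \<in> \<rat>" "infdist q S - e / 4 < r" "r < infdist q S"
        using Rats_dense_in_real[of "infdist q S - e / 4" "infdist q S"] e(1) by auto
      obtain s where s: "s \<in> \<rat>" "infdist q S < s" "s < infdist q S + e / 4"
        using Rats_dense_in_real[of "infdist q S" "infdist q S + e / 4"] e(1) by auto
      have "wijsman_cell {(q, r, s)} \<subseteq> B"
      proof
        fix S' assume "S' \<in> wijsman_cell {(q, r, s)}"
        then have S': "S' \<in> closed_convex_sets" "r < infdist q S'" "infdist q S' < s"
          by (auto simp: wijsman_cell_def wijsman_box_def)
        have "\<bar>infdist x S' - a\<bar> < e"
          using infdist_lipschitz[of q S' x] q(2) S'(2,3) r(2) s(3) qa by linarith
        then have "infdist x S' \<in> ball a e"
          by (simp add: dist_real_def abs_minus_commute)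
        with e(2) S'(1) show "S' \<in> B"
          by (auto simp: B)
      qed
      moreover have "S \<in> wijsman_cell {(q, r, s)}"
        using S r s by (simp add: B wijsman_cell_def wijsman_box_def)
      ultimately show "\<exists>I. finite I \<and> I \<subseteq> Q \<times> \<rat> \<times> \<rat> \<and> S \<in> wijsman_cell I \<and> wijsman_cell I \<subseteq> B"
        using q(1) r(1) s(1) by (intro exI[of _ "{(q, r, s)}"]) simp
    qed
  qed simp
qed

text \<open>By \<open>wijsman_open_refine\<close> an open set is a countable union of cells, and the
  preimage of a cell is described by finitely many distance functions.\<close>

lemma measurable_wijsman_borel:
  fixes f :: "'x \<Rightarrow> 'a::euclidean_space set"
  assumes f: "\<And>x. x \<in> space M \<Longrightarrow> f x \<in> closed_convex_sets"
    and dist: "\<And>q. (\<lambda>x. infdist q (f x)) \<in> borel_measurable M"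
  shows "f \<in> M \<rightarrow>\<^sub>M wijsman_borel"
  unfolding wijsman_borel_def
proof (rule measurable_measure_of)
  obtain Q :: "'a set" where Q: "countable Q" "\<And>x e. 0 < e \<Longrightarrow> \<exists>q\<in>Q. dist q x < e"
    using countable_dense_points[where 'a='a] by metis
  have refine: "U \<subseteq> closed_convex_sets \<and>
      (\<forall>S\<in>U. \<exists>I. finite I \<and> I \<subseteq> Q \<times> \<rat> \<times> \<rat> \<and> S \<in> wijsman_cell I \<and> wijsman_cell I \<subseteq> U)"
    if "openin wijsman_topology U" for U
    by (rule wijsman_open_refine[OF _ that]) (rule Q(2))
  show "{U :: 'a set set. openin wijsman_topology U} \<subseteq> Pow closed_convex_sets"
  proof (rule subsetI, rule PowI)
    fix U :: "'a set set" assume "U \<in> {U. openin wijsman_topology U}"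
    then have "openin wijsman_topology U" by (rule CollectD)
    from refine[OF this] show "U \<subseteq> closed_convex_sets" by (rule conjunct1)
  qed
  show "f \<in> space M \<rightarrow> closed_convex_sets"
    by (rule Pi_I) (rule f)
  fix U :: "'a set set" assume "U \<in> {U. openin wijsman_topology U}"
  then have U: "openin wijsman_topology U" by simp
  let ?\<I> = "{I. finite I \<and> I \<subseteq> Q \<times> \<rat> \<times> \<rat> \<and> wijsman_cell I \<subseteq> U}"
  have "countable {I. finite I \<and> I \<subseteq> Q \<times> (\<rat>::real set) \<times> (\<rat>::real set)}"
    by (rule countable_Collect_finite_subset) (intro countable_SIGMA Q(1) countable_rat)
  then have cnt: "countable ?\<I>"
    by (rule countable_subset[rotated]) (intro subsetI CollectI; elim CollectE conjE; intro conjI)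
  have cell: "f -` wijsman_cell I \<inter> space M \<in> sets M" if I: "finite I" for I
  proof -
    have eq: "f -` wijsman_cell I \<inter> space M = {x \<in> space M. \<forall>i\<in>I. fst (snd i) < infdist (fst i) (f x) \<and> infdist (fst i) (f x) < snd (snd i)}"
      using f by (auto simp: wijsman_cell_def wijsman_box_def)
    have "{x \<in> space M. fst (snd i) < infdist (fst i) (f x) \<and> infdist (fst i) (f x) < snd (snd i)} \<in> sets M" for i :: "'a \<times> real \<times> real"
    proof -
      note [measurable] = dist[of "fst i"]
      show ?thesis by measurable
    qed
    then show ?thesis
      unfolding eq by (cases "I = {}") (simp, intro sets.sets_Collect_finite_All' I, simp)
  qed
  have "f -` U \<inter> space M = (\<Union>I\<in>?\<I>. f -` wijsman_cell I \<inter> space M)"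
  proof (intro equalityI subsetI)
    fix x assume x: "x \<in> f -` U \<inter> space M"
    then obtain I where "finite I" "I \<subseteq> Q \<times> \<rat> \<times> \<rat>" "f x \<in> wijsman_cell I" "wijsman_cell I \<subseteq> U"
    proof -
      have "f x \<in> U" using x by simp
      from refine[OF U, THEN conjunct2, rule_format, OF this] show thesis
        by (elim exE conjE) (rule that)
    qed
    with x show "x \<in> (\<Union>I\<in>?\<I>. f -` wijsman_cell I \<inter> space M)"
      by blast
  qed blast
  also have "\<dots> \<in> sets M"
    by (intro sets.countable_UN'[OF cnt] image_subsetI) (rule cell, simp)
  finally show "f -` U \<inter> space M \<in> sets M" .
qed

text \<open>The infimum is attained, so a value at most \<open>r\<close> means that \<open>x\<close>
  has an isometric partner in the compact ball \<open>cball q r\<close>; projecting a closed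
  relation along a compact set gives a closed set.\<close>

lemma borel_infdist_iso_class:
  fixes u :: "'a::euclidean_space \<Rightarrow> 'b::euclidean_space"
  assumes cont: "continuous_on UNIV u"
  shows "(\<lambda>x. infdist q (iso_class u x)) \<in> borel_measurable borel"
proof (rule borel_measurableI_le)
  fix r :: real
  have eq: "{x. infdist q (iso_class u x) \<le> r} = {x. \<exists>y. y \<in> cball q r \<and> (y, x) \<in> {p. iso_defect u (snd p) (fst p) = 0}}"
  proof (intro equalityI subsetI; clarsimp)
    fix x assume "infdist q (iso_class u x) \<le> r"
    moreover obtain y where "y \<in> iso_class u x" "infdist q (iso_class u x) = dist q y"
    proof (rule infdist_attains_inf)
      show "closed (iso_class u x)" by (rule closed_iso_class[OF cont])
      show "iso_class u x \<noteq> {}" using self_in_iso_class[of x u] by blast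
    qed
    ultimately show "\<exists>y. dist q y \<le> r \<and> iso_defect u x y = 0"
      by (auto simp: iso_class_def)
  next
    fix x y assume "dist q y \<le> r" "iso_defect u x y = 0"
    then show "infdist q (iso_class u x) \<le> r"
      using infdist_le[of y "iso_class u x" q] by (simp add: iso_class_def)
  qed
  have cl: "closed {p :: 'a \<times> 'a. iso_defect u (snd p) (fst p) = 0}"
    by (rule closed_Collect_eq[OF continuous_on_iso_defect[OF cont continuous_on_snd[OF continuous_on_id] continuous_on_fst[OF continuous_on_id]] continuous_on_const])
  have "closed {x. infdist q (iso_class u x) \<le> r}"
    unfolding eq by (rule closed_compact_projection[OF compact_cball cl])
  then show "{x \<in> space borel. infdist q (iso_class u x) \<le> r} \<in> sets borel"
    by simp
qed

text \<open>The set \<open>B\<close> is left open for two uses: \<open>nondiff_set u\<close> gives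
  \<open>leaf_map u\<close>, and \<open>leaf_overlap u\<close> gives the map behind
  \<open>saturation\<close>.\<close>

lemma measurable_class_map:
  fixes u :: "'a::euclidean_space \<Rightarrow> 'b::euclidean_space"
  assumes u: "1-lipschitz_on UNIV u" and B[measurable]: "B \<in> sets borel" and over: "leaf_overlap u \<subseteq> B"
  shows "(\<lambda>x. if x \<in> B then {x} else iso_class u x) \<in> borel \<rightarrow>\<^sub>M wijsman_borel"
proof (rule measurable_wijsman_borel)
  note cont = lipschitz_on_continuous_on[OF u]
  show "(if x \<in> B then {x} else iso_class u x) \<in> closed_convex_sets" for x
  proof (cases "x \<in> B")
    case False
    then have "x \<notin> leaf_overlap u" using over by blast
    moreover have "iso_class u x \<noteq> {}" using self_in_iso_class by blast
    ultimately show ?thesis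
      using False closed_iso_class[OF cont] convex_iso_class[OF u] by (simp add: closed_convex_sets_def)
  qed (simp add: closed_convex_sets_def)
  fix q :: 'a
  have "(\<lambda>x. infdist q (if x \<in> B then {x} else iso_class u x)) = (\<lambda>x. if x \<in> B then dist q x else infdist q (iso_class u x))"
    by (auto simp: fun_eq_iff)
  also have "\<dots> \<in> borel_measurable borel"
    using borel_infdist_iso_class[OF cont, of q] by measurable
  finally show "(\<lambda>x. infdist q (if x \<in> B then {x} else iso_class u x)) \<in> borel_measurable borel" .
qed

text \<open>The whole overlap is included whatever \<open>C\<close> is: an isometric partner of a
  point off the overlap may lie on it, and a transport set has to contain that partner.\<close>

definition saturation :: "('a::euclidean_space \<Rightarrow> 'b::euclidean_space) \<Rightarrow> 'a set set \<Rightarrow> 'a set" where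
  "saturation u C = leaf_overlap u \<union> {x. x \<notin> leaf_overlap u \<and> iso_class u x \<in> C}"

lemma transport_set_saturation:
  fixes u :: "'a::euclidean_space \<Rightarrow> 'b::euclidean_space"
  assumes u: "1-lipschitz_on UNIV u" and C: "C \<in> sets wijsman_borel"
  shows "transport_set u (saturation u C)"
  unfolding transport_set_def
proof (intro conjI ballI allI impI)
  let ?\<phi> = "\<lambda>x. if x \<in> leaf_overlap u then {x} else iso_class u x"
  have "?\<phi> -` C \<in> sets borel"
    using measurable_sets[OF measurable_class_map[OF u borel_leaf_overlap[OF u] order_refl] C] by simp
  moreover have "saturation u C = leaf_overlap u \<union> ?\<phi> -` C"
    by (auto simp: saturation_def)
  ultimately show "saturation u C \<in> sets borel"
    using borel_leaf_overlap[OF u] by simp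
  fix x y assume x: "x \<in> saturation u C - leaf_overlap u" and "norm (u x - u y) = norm (x - y)"
  then have y: "y \<in> iso_class u x"
    by (simp add: iso_class_def iso_defect_eq_0)
  show "y \<in> saturation u C"
  proof (cases "y \<in> leaf_overlap u")
    case False
    have x': "x \<notin> leaf_overlap u" "iso_class u x \<in> C"
      using x unfolding saturation_def by blast+
    have "iso_class u y = iso_class u x"
      using y by (intro iso_class_eq x'(1) False)
    with x' False show ?thesis by (simp add: saturation_def)
  qed (simp add: saturation_def)
qed

text \<open>Restricted to a dense sequence, the 1-Lipschitz maps form a subset of a countable
  product, which is separable. Convergence at the dense points spreads to all points because the
  maps share one Lipschitz constant.\<close>

lemma lipschitz_countable_dense:
  obtains V :: "('a::euclidean_space \<Rightarrow> 'b::euclidean_space) set"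
  where "countable V" "\<And>v. v \<in> V \<Longrightarrow> 1-lipschitz_on UNIV v"
    "\<And>v. 1-lipschitz_on UNIV v \<Longrightarrow> \<exists>s. range s \<subseteq> V \<and> (\<forall>x. (\<lambda>k::nat. s k x) \<longlonglongrightarrow> v x)"
proof -
  obtain Q :: "'a set" where Q: "countable Q" "\<And>x e. 0 < e \<Longrightarrow> \<exists>q\<in>Q. dist q x < e"
    using countable_dense_points[where 'a='a] by metis
  define q where "q = from_nat_into Q"
  have q: "\<exists>i. dist (q i) x < e" if "0 < e" for x e
    using Q(2)[OF that, of x] from_nat_into_surj[OF Q(1)] unfolding q_def by metis
  define \<Phi> :: "('a \<Rightarrow> 'b) \<Rightarrow> nat \<Rightarrow> 'b" where "\<Phi> = (\<lambda>v i. v (q i))"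
  obtain T where T: "countable T" "T \<subseteq> \<Phi> ` {v. 1-lipschitz_on UNIV v}" "\<Phi> ` {v. 1-lipschitz_on UNIV v} \<subseteq> closure T"
    using separable[of "\<Phi> ` {v. 1-lipschitz_on UNIV v}"] by metis
  have "\<forall>t\<in>T. \<exists>v. 1-lipschitz_on UNIV v \<and> \<Phi> v = t"
    using T(2) by blast
  from bchoice[OF this] obtain W where W: "\<And>t. t \<in> T \<Longrightarrow> 1-lipschitz_on UNIV (W t)" "\<And>t. t \<in> T \<Longrightarrow> \<Phi> (W t) = t"
    by blast
  show ?thesis
  proof (rule that[of "W ` T"])
    show "countable (W ` T)" using T(1) by simp
    show "1-lipschitz_on UNIV v" if "v \<in> W ` T" for v using that W(1) by blast
    fix v :: "'a \<Rightarrow> 'b" assume v: "1-lipschitz_on UNIV v"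
    then have "\<Phi> v \<in> closure T" using T(3) by blast
    then obtain t where t: "\<And>k. t k \<in> T" "t \<longlonglongrightarrow> \<Phi> v"
      unfolding closure_sequential by blast
    have coord: "(\<lambda>k. W (t k) (q i)) \<longlonglongrightarrow> v (q i)" for i
    proof -
      have "(\<lambda>k. t k i) \<longlonglongrightarrow> \<Phi> v i"
        using continuous_on_tendsto_compose[OF continuous_on_product_coordinates[of i] t(2)] by simp
      moreover have "t k i = W (t k) (q i)" for k
        using W(2)[OF t(1)[of k]] unfolding \<Phi>_def by (simp add: fun_eq_iff)
      ultimately show ?thesis by (simp add: \<Phi>_def)
    qed
    have "(\<lambda>k. W (t k) x) \<longlonglongrightarrow> v x" for x
    proof (rule metric_LIMSEQ_I)
      fix e :: real assume e: "0 < e"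
      obtain i where i: "dist (q i) x < e / 3" using q[of "e / 3" x] e by auto
      obtain K where K: "\<And>k. k \<ge> K \<Longrightarrow> dist (W (t k) (q i)) (v (q i)) < e / 3"
        using metric_LIMSEQ_D[OF coord[of i], of "e / 3"] e by auto
      have "dist (W (t k) x) (v x) < e" if "k \<ge> K" for k
      proof -
        have "dist (W (t k) x) (W (t k) (q i)) \<le> dist (q i) x"
          using lipschitz_onD[OF W(1)[OF t(1)[of k]], of x "q i"] by (simp add: dist_commute)
        moreover have "dist (v (q i)) (v x) \<le> dist (q i) x"
          using lipschitz_onD[OF v, of "q i" x] by simp
        moreover have "dist (W (t k) x) (v x) \<le> dist (W (t k) x) (W (t k) (q i)) + dist (W (t k) (q i)) (v (q i)) + dist (v (q i)) (v x)"
          using dist_triangle[of "W (t k) x" "v x" "v (q i)"] dist_triangle[of "W (t k) x" "v (q i)" "W (t k) (q i)"] by linarith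
        ultimately show ?thesis
          using K[OF that] i by linarith
      qed
      then show "\<exists>K. \<forall>k\<ge>K. dist (W (t k) x) (v x) < e" by blast
    qed
    then show "\<exists>s. range s \<subseteq> W ` T \<and> (\<forall>x. (\<lambda>k::nat. s k x) \<longlonglongrightarrow> v x)"
      using t(1) by (intro exI[of _ "\<lambda>k. W (t k)"]) auto
  qed
qed

section \<open>Disintegration into leaves\<close>

text \<open>Concentration of \<open>\<kappa> s\<close> on the fibre lets
  \<open>indicator C (T x)\<close> leave the inner integral as \<open>indicator C s\<close>. The
  hypothesis thus says that the inner integral, as a function of \<open>s\<close>, has non-negative
  integral over every set of \<open>N\<close>.\<close>

lemma disintegration_nonneg:
  fixes \<eta> :: "'a::topological_space measure" and f :: "'a \<Rightarrow> real"
  assumes \<eta>: "finite_measure \<eta>" "sets \<eta> = sets borel" and T: "T \<in> \<eta> \<rightarrow>\<^sub>M N" and \<kappa>: "disintegration \<eta> N T \<kappa>"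
    and f: "integrable \<eta> f" and nonneg: "\<And>C. C \<in> sets N \<Longrightarrow> 0 \<le> (\<integral>x. indicator C (T x) * f x \<partial>\<eta>)"
  shows "AE s in distr \<eta> N T. 0 \<le> (\<integral>x. f x \<partial>\<kappa> s)"
proof -
  let ?\<nu> = "distr \<eta> N T" and ?F = "\<lambda>s. \<integral>x. f x \<partial>\<kappa> s"
  interpret \<eta>: finite_measure \<eta> by fact
  interpret \<nu>: finite_measure ?\<nu> by (rule \<eta>.finite_measure_distr[OF T])
  have prob: "\<And>s. s \<in> space N \<Longrightarrow> sets (\<kappa> s) = sets borel"
    and conc: "AE s in ?\<nu>. AE x in \<kappa> s. T x = s"
    and bochner: "\<And>g::'a \<Rightarrow> real. integrable \<eta> g \<Longrightarrow>
      has_bochner_integral (completion ?\<nu>) (\<lambda>s. \<integral>x. g x \<partial>\<kappa> s) (\<integral>x. g x \<partial>\<eta>)"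
    using \<kappa> by (simp_all add: disintegration_def)
  have F: "integrable (completion ?\<nu>) ?F"
    using bochner[OF f] by (rule integrable.intros)
  have "AE s in completion ?\<nu>. 0 \<le> ?F s"
  proof (rule sigma_finite_measure.density_nonneg[OF _ F])
    have "emeasure (completion ?\<nu>) (space (completion ?\<nu>)) \<noteq> \<infinity>"
      using \<nu>.emeasure_finite[of "space ?\<nu>"] by (subst emeasure_completion) (auto simp del: space_distr)
    then show "sigma_finite_measure (completion ?\<nu>)"
      by (rule finite_measure.axioms(1)[OF finite_measureI])
    fix A assume A: "A \<in> sets (completion ?\<nu>)"
    \<comment> \<open>The inner integral is measurable for the completion only, so it has to be
      tested on completed sets; the main part is a set of \<open>N\<close> that differs from
      \<open>A\<close> by a null set.\<close>
    define C where "C = main_part ?\<nu> A"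
    have C: "C \<in> sets N" unfolding C_def using main_part_sets[OF A] by simp
    have AC: "AE s in completion ?\<nu>. s \<in> A \<longleftrightarrow> s \<in> C"
      using AE_completion[OF AE_in_main_part[OF A]] unfolding C_def by eventually_elim blast
    have [measurable]: "T \<in> \<eta> \<rightarrow>\<^sub>M N" "C \<in> sets N" by fact+
    have gI: "integrable \<eta> (\<lambda>x. indicator C (T x) * f x)"
    proof (rule Bochner_Integration.integrable_bound[OF f])
      have [measurable]: "f \<in> borel_measurable \<eta>" using f by auto
      show "(\<lambda>x. indicator C (T x) * f x) \<in> borel_measurable \<eta>" by measurable
    qed (simp add: indicator_def)
    have fm: "f \<in> borel_measurable borel"
      using borel_measurable_integrable[OF f] by (simp add: measurable_cong_sets[OF \<eta>(2) refl])
    have "AE s in ?\<nu>. s \<in> space N" using AE_space[of ?\<nu>] by simp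
    with conc have "AE s in ?\<nu>. (\<integral>x. indicator C (T x) * f x \<partial>\<kappa> s) = indicator C s * ?F s"
    proof eventually_elim
      case (elim s)
      have "(\<integral>x. indicator C (T x) * f x \<partial>\<kappa> s) = (\<integral>x. indicator C s * f x \<partial>\<kappa> s)"
      proof (rule integral_cong_AE)
        have eq: "measurable (\<kappa> s) borel = borel_measurable \<eta>"
          by (rule measurable_cong_sets[OF _ refl]) (simp add: prob[OF elim(2)] \<eta>(2))
        show "(\<lambda>x. indicator C (T x) * f x) \<in> borel_measurable (\<kappa> s)"
          unfolding eq by (rule borel_measurable_integrable[OF gI])
        show "(\<lambda>x. indicator C s * f x) \<in> borel_measurable (\<kappa> s)"
          unfolding eq by (rule borel_measurable_times[OF borel_measurable_const borel_measurable_integrable[OF f]])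
        show "AE x in \<kappa> s. indicator C (T x) * f x = indicator C s * f x"
          using elim(1) by eventually_elim simp
      qed
      then show ?case by simp
    qed
    then have "AE s in completion ?\<nu>. (\<integral>x. indicator C (T x) * f x \<partial>\<kappa> s) = indicator C s * ?F s"
      by (rule AE_completion)
    with AC have "AE s in completion ?\<nu>. indicator A s *\<^sub>R ?F s = (\<integral>x. indicator C (T x) * f x \<partial>\<kappa> s)"
      by eventually_elim (simp add: indicator_def)
    then have "set_lebesgue_integral (completion ?\<nu>) A ?F = (\<integral>s. (\<integral>x. indicator C (T x) * f x \<partial>\<kappa> s) \<partial>completion ?\<nu>)"
      unfolding set_lebesgue_integral_def
      by (rule integral_cong_AE[rotated 2])
        (rule borel_measurable_integrable[OF integrable_mult_indicator[OF A F]],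
         rule borel_measurable_integrable[OF integrable.intros[OF bochner[OF gI]]])
    also have "\<dots> = (\<integral>x. indicator C (T x) * f x \<partial>\<eta>)"
      by (rule has_bochner_integral_integral_eq[OF bochner[OF gI]])
    finally show "0 \<le> set_lebesgue_integral (completion ?\<nu>) A ?F"
      using nonneg[OF C] by simp
  qed
  then show ?thesis
    by (simp add: AE_completion_iff)
qed

lemma disintegration_zero:
  fixes \<eta> :: "'a::topological_space measure" and f :: "'a \<Rightarrow> real"
  assumes \<eta>: "finite_measure \<eta>" "sets \<eta> = sets borel" and T: "T \<in> \<eta> \<rightarrow>\<^sub>M N" and \<kappa>: "disintegration \<eta> N T \<kappa>"
    and f: "integrable \<eta> f" and zero: "\<And>C. C \<in> sets N \<Longrightarrow> (\<integral>x. indicator C (T x) * f x \<partial>\<eta>) = 0"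
  shows "AE s in distr \<eta> N T. (\<integral>x. f x \<partial>\<kappa> s) = 0"
proof -
  have "AE s in distr \<eta> N T. 0 \<le> (\<integral>x. f x \<partial>\<kappa> s)"
    by (rule disintegration_nonneg[OF \<eta> T \<kappa> f]) (simp add: zero)
  moreover have "AE s in distr \<eta> N T. 0 \<le> (\<integral>x. - f x \<partial>\<kappa> s)"
    by (rule disintegration_nonneg[OF \<eta> T \<kappa> integrable_minus[OF f]]) (simp add: zero)
  ultimately show ?thesis
    by eventually_elim simp
qed

text \<open>The first moment is expressed through the weight \<open>norm (h x)\<close>: in this form
  it is the integral of one real function, and its finiteness is inherited by almost every leaf
  measure.\<close>

lemma integrable_lipschitz_inner_weighted:
  fixes h :: "'a::euclidean_space \<Rightarrow> 'b::euclidean_space"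
  assumes K: "sets K = sets borel" and h: "integrable K h" and xh: "integrable K (\<lambda>x. norm x * norm (h x))"
    and v: "1-lipschitz_on UNIV v"
  shows "integrable K (\<lambda>x. v x \<bullet> h x)"
proof (rule Bochner_Integration.integrable_bound)
  note [measurable_cong] = K
  have [measurable]: "v \<in> borel_measurable borel" "h \<in> borel_measurable K"
    using lipschitz_on_continuous_on[OF v] h by (auto intro: borel_measurable_continuous_onI)
  show "integrable K (\<lambda>x. norm (v 0) * norm (h x) + norm x * norm (h x))"
    using h xh by (intro Bochner_Integration.integrable_add integrable_mult_right integrable_norm)
  show "(\<lambda>x. v x \<bullet> h x) \<in> borel_measurable K" by measurable
  show "AE x in K. norm (v x \<bullet> h x) \<le> norm (norm (v 0) * norm (h x) + norm x * norm (h x))"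
  proof (rule AE_I2)
    fix x
    have "norm (v x) \<le> norm (v 0) + norm x"
      using lipschitz_onD[OF v, of x 0] norm_triangle_sub[of "v x" "v 0"] by (simp add: dist_norm)
    then have "norm (v x) * norm (h x) \<le> (norm (v 0) + norm x) * norm (h x)"
      by (rule mult_right_mono) simp
    then show "norm (v x \<bullet> h x) \<le> norm (norm (v 0) * norm (h x) + norm x * norm (h x))"
      using Cauchy_Schwarz_ineq2[of "v x" "h x"] by (simp add: distrib_right)
  qed
qed

lemma optimal_potential_density:
  fixes h :: "'a::euclidean_space \<Rightarrow> 'b::euclidean_space"
  assumes K: "finite_measure K" "sets K = sets borel" and h: "integrable K h" and mean: "(\<integral>x. h x \<partial>K) = 0"
    and xh: "integrable K (\<lambda>x. norm x * norm (h x))" and u: "1-lipschitz_on UNIV u"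
    and dense: "\<And>v. 1-lipschitz_on UNIV v \<Longrightarrow> \<exists>s. range s \<subseteq> V \<and> (\<forall>x. (\<lambda>k::nat. s k x) \<longlonglongrightarrow> v x)"
    and V: "\<And>v. v \<in> V \<Longrightarrow> 1-lipschitz_on UNIV v"
    and opt: "\<And>v. v \<in> V \<Longrightarrow> (\<integral>x. v x \<bullet> h x \<partial>K) \<le> (\<integral>x. u x \<bullet> h x \<partial>K)"
  shows "optimal_potential (vm_density K h) u"
proof -
  note [measurable_cong] = K(2)
  have spK: "space K = UNIV" using sets_eq_imp_space_eq[OF K(2)] by simp
  have [measurable]: "h \<in> borel_measurable K" using h by auto
  have vi: "vm_integral (vm_density K h) v = (\<integral>x. v x \<bullet> h x \<partial>K)" if "1-lipschitz_on UNIV v" for v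
    by (rule vm_integral_density[OF K h refl])
      (rule borel_measurable_continuous_onI[OF lipschitz_on_continuous_on[OF that]])
  have "vm_density K h \<in> W1_space"
    unfolding W1_space_def
  proof (intro CollectI conjI exI)
    show "vector_measure (vm_density K h)" by (rule vector_measure_density[OF h K(2)])
    show "vm_density K h UNIV = 0"
      using mean by (simp add: vm_density_def set_lebesgue_integral_def)
    have int: "integrable K (\<lambda>x. norm (h x) *\<^sub>R norm (x - 0))"
      using xh by (simp add: mult.commute)
    show "integrable (total_variation (vm_density K h)) (\<lambda>x. norm (x - 0))"
      unfolding total_variation_density[OF K h]
    proof (rule integrable_density[THEN iffD2])
      show "(\<lambda>x::'a. norm (x - 0)) \<in> borel_measurable K" by measurable
      show "(\<lambda>x. norm (h x)) \<in> borel_measurable K" by measurable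
      show "AE x in K. 0 \<le> norm (h x)" by simp
    qed (rule int)
  qed
  moreover have "(\<integral>x. v x \<bullet> h x \<partial>K) \<le> (\<integral>x. u x \<bullet> h x \<partial>K)" if v: "1-lipschitz_on UNIV v" for v
  proof -
    obtain s where s: "range s \<subseteq> V" "\<And>x. (\<lambda>k::nat. s k x) \<longlonglongrightarrow> v x"
      using dense[OF v] by blast
    have sV: "s k \<in> V" for k using s(1) by blast
    \<comment> \<open>Convergence at the single point 0 bounds the values there, and the common
      Lipschitz constant turns this into one dominating function for all \<open>k\<close>.\<close>
    have "Bseq (\<lambda>k. s k 0)"
      using s(2)[of 0] by (intro convergent_imp_Bseq) (rule convergentI)
    then obtain B where B: "\<And>k. norm (s k 0) \<le> B"
      unfolding Bseq_def by blast
    have "(\<lambda>k. \<integral>x. s k x \<bullet> h x \<partial>K) \<longlonglongrightarrow> (\<integral>x. v x \<bullet> h x \<partial>K)"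
    proof (rule integral_dominated_convergence)
      show "integrable K (\<lambda>x. B * norm (h x) + norm x * norm (h x))"
        using h xh by (intro Bochner_Integration.integrable_add integrable_mult_right integrable_norm)
      show "(\<lambda>x. v x \<bullet> h x) \<in> borel_measurable K"
        by (rule borel_measurable_integrable[OF integrable_lipschitz_inner_weighted[OF K(2) h xh v]])
      show "(\<lambda>x. s k x \<bullet> h x) \<in> borel_measurable K" for k
        by (rule borel_measurable_integrable[OF integrable_lipschitz_inner_weighted[OF K(2) h xh V[OF sV]]])
      show "AE x in K. (\<lambda>k. s k x \<bullet> h x) \<longlonglongrightarrow> v x \<bullet> h x"
        by (intro AE_I2 tendsto_inner s(2) tendsto_const)
      show "AE x in K. norm (s k x \<bullet> h x) \<le> B * norm (h x) + norm x * norm (h x)" for k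
      proof (rule AE_I2)
        fix x
        have "norm (s k x) \<le> B + norm x"
          using lipschitz_onD[OF V[OF sV[of k]], of x 0] norm_triangle_sub[of "s k x" "s k 0"] B[of k] by (simp add: dist_norm)
        then have "norm (s k x) * norm (h x) \<le> (B + norm x) * norm (h x)"
          by (rule mult_right_mono) simp
        then show "norm (s k x \<bullet> h x) \<le> B * norm (h x) + norm x * norm (h x)"
          using Cauchy_Schwarz_ineq2[of "s k x" "h x"] by (simp add: distrib_right)
      qed
    qed
    then show ?thesis
      by (rule LIMSEQ_le_const2) (use opt[OF sV] in blast)
  qed
  ultimately show ?thesis
    using u vi by (simp add: optimal_potential_def is_arg_max_def not_less)
qed

lemma saturation_iff:
  assumes u: "1-lipschitz_on UNIV u" and x: "x \<notin> nondiff_set u"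
  shows "x \<in> saturation u C \<longleftrightarrow> leaf_map u x \<in> C"
proof -
  have "x \<notin> leaf_overlap u" using leaf_overlap_subset_nondiff[OF u] x by blast
  then show ?thesis by (simp add: saturation_def leaf_map_eq[OF u] x)
qed

theorem transport_sets_localise_to_leaves:
  fixes \<mu> :: "'a::euclidean_space set \<Rightarrow> 'b::euclidean_space"
  assumes \<mu>: "\<mu> \<in> W1_space" and ac: "vm_absolutely_continuous lborel \<mu>" and u: "1-lipschitz_on UNIV u"
    and zero: "\<And>A. transport_set u A \<Longrightarrow> \<mu> A = 0"
    and opt: "\<And>A. transport_set u A \<Longrightarrow> optimal_potential (vm_restrict \<mu> A) u"
  shows "localises_to_leaves \<mu> u"
  unfolding localises_to_leaves_def
proof (intro allI impI)
  let ?\<eta> = "total_variation \<mu>" and ?h = "polar_density \<mu>" and ?T = "leaf_map u" and ?N = "nondiff_set u"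
  fix \<kappa> assume \<kappa>: "disintegration ?\<eta> wijsman_borel ?T \<kappa>"
  let ?\<nu> = "distr ?\<eta> wijsman_borel ?T"
  note vm = W1_spaceD(1)[OF \<mu>]
  note \<eta> = finite_total_variation[OF vm] sets_total_variation[of \<mu>]
  have h: "integrable ?\<eta> ?h" by (rule integrable_polar_density[OF vm])
  have h_m[measurable]: "?h \<in> borel_measurable borel" using h by auto
  have N0: "?N \<in> null_sets lborel" by (rule rademacher[OF u])
  then have N: "?N \<in> sets borel" by auto
  have Tb: "?T \<in> borel \<rightarrow>\<^sub>M wijsman_borel"
    using measurable_class_map[OF u N leaf_overlap_subset_nondiff[OF u]]
    by (simp add: leaf_map_eq[OF u, abs_def])
  then have T: "?T \<in> ?\<eta> \<rightarrow>\<^sub>M wijsman_borel"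
    by (simp add: measurable_cong_sets[OF \<eta>(2) refl])
  have AE_N: "AE x in ?\<eta>. x \<notin> ?N"
    by (rule AE_not_in[OF null_sets_total_variation_lborel[OF vm ac N0]])
  \<comment> \<open>Off the null set \<open>nondiff_set u\<close>, the condition
    \<open>leaf_map u x \<in> C\<close> is membership in a transport set, so integrals over
    preimages of \<open>C\<close> fall under the hypotheses.\<close>
  have pull: "(\<integral>x. indicator C (?T x) * f x \<partial>?\<eta>) = (\<integral>x. indicator (saturation u C) x * f x \<partial>?\<eta>)"
    if C: "C \<in> sets wijsman_borel" and f: "f \<in> borel_measurable borel" for C and f :: "'a \<Rightarrow> real"
  proof (rule integral_cong_AE)
    have sat: "saturation u C \<in> sets borel"
      using transport_set_saturation[OF u C] by (simp add: transport_set_def)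
    have m: "borel_measurable ?\<eta> = borel_measurable borel"
      by (rule measurable_cong_sets[OF \<eta>(2) refl])
    show "(\<lambda>x. indicator C (?T x) * f x) \<in> borel_measurable ?\<eta>"
      unfolding m by (intro borel_measurable_times measurable_compose[OF Tb borel_measurable_indicator[OF C]] f)
    show "(\<lambda>x. indicator (saturation u C) x * f x) \<in> borel_measurable ?\<eta>"
      unfolding m by (intro borel_measurable_times borel_measurable_indicator f sat)
    show "AE x in ?\<eta>. indicator C (?T x) * f x = indicator (saturation u C) x * f x"
      using AE_N by eventually_elim (simp add: indicator_def saturation_iff[OF u])
  qed
  have xh: "integrable ?\<eta> (\<lambda>x. norm x * norm (?h x))"
  proof (rule integrable_cong_AE_imp)
    show "integrable ?\<eta> (\<lambda>x. norm x)" using W1_spaceD(3)[OF \<mu>, of 0] by simp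
    show "(\<lambda>x. norm x * norm (?h x)) \<in> borel_measurable ?\<eta>" by measurable
    show "AE x in ?\<eta>. norm x = norm x * norm (?h x)"
      using norm_polar_density[OF vm] by eventually_elim simp
  qed
  obtain V :: "('a \<Rightarrow> 'b) set" where V: "countable V" "\<And>v. v \<in> V \<Longrightarrow> 1-lipschitz_on UNIV v"
    and dense: "\<And>v. 1-lipschitz_on UNIV v \<Longrightarrow> \<exists>s. range s \<subseteq> V \<and> (\<forall>x. (\<lambda>k::nat. s k x) \<longlonglongrightarrow> v x)"
    by (rule lipschitz_countable_dense) (rule that; blast)
  have int_f: "AE S in ?\<nu>. integrable (\<kappa> S) f" if "integrable ?\<eta> f" for f :: "'a \<Rightarrow> real"
    using \<kappa> that by (simp add: disintegration_def)
  \<comment> \<open>\<open>disintegration\<close> speaks of real functions, so the vector-valued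
    density is treated through its coordinates.\<close>
  have hb: "integrable ?\<eta> (\<lambda>x. ?h x \<bullet> b)" for b
    by (rule integrable_inner_left) (rule h)
  have "AE S in ?\<nu>. \<forall>b\<in>Basis. integrable (\<kappa> S) (\<lambda>x. ?h x \<bullet> b)"
    by (rule AE_finite_allI[OF finite_Basis]) (rule int_f[OF hb])
  moreover have "AE S in ?\<nu>. \<forall>b\<in>Basis. (\<integral>x. ?h x \<bullet> b \<partial>\<kappa> S) = 0"
  proof (rule AE_finite_allI[OF finite_Basis])
    fix b :: 'b
    show "AE S in ?\<nu>. (\<integral>x. ?h x \<bullet> b \<partial>\<kappa> S) = 0"
    proof (rule disintegration_zero[OF \<eta> T \<kappa> hb])
      fix C :: "'a set set" assume C: "C \<in> sets wijsman_borel"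
      note tr = transport_set_saturation[OF u C]
      then have A: "saturation u C \<in> sets borel" by (simp add: transport_set_def)
      have "(\<integral>x. indicator (saturation u C) x * (?h x \<bullet> b) \<partial>?\<eta>) = \<mu> (saturation u C) \<bullet> b"
        unfolding vm_density_polar[OF vm A, symmetric] vm_density_def
        by (rule set_integral_inner_right[OF h]) (simp add: A)
      then show "(\<integral>x. indicator C (?T x) * (?h x \<bullet> b) \<partial>?\<eta>) = 0"
        using zero[OF tr] pull[OF C, of "\<lambda>x. ?h x \<bullet> b"] by simp
    qed
  qed
  \<comment> \<open>The difference is tested as one real function, so that comparing
    \<open>u\<close> and \<open>v\<close> on a leaf is the sign of a single inner integral;
    countability of \<open>V\<close> keeps the union of the exceptional sets null.\<close>
  moreover have "AE S in ?\<nu>. \<forall>v\<in>V. 0 \<le> (\<integral>x. u x \<bullet> ?h x - v x \<bullet> ?h x \<partial>\<kappa> S)"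
  proof (rule AE_ball_countable'[OF _ V(1)])
    fix v assume v: "v \<in> V"
    note lip = V(2)[OF v]
    have [measurable]: "u \<in> borel_measurable borel" "v \<in> borel_measurable borel"
      by (rule borel_measurable_continuous_onI[OF lipschitz_on_continuous_on[OF u]],
          rule borel_measurable_continuous_onI[OF lipschitz_on_continuous_on[OF lip]])
    note ints = integrable_lipschitz_inner[OF \<mu> u] integrable_lipschitz_inner[OF \<mu> lip]
    show "AE S in ?\<nu>. 0 \<le> (\<integral>x. u x \<bullet> ?h x - v x \<bullet> ?h x \<partial>\<kappa> S)"
    proof (rule disintegration_nonneg[OF \<eta> T \<kappa> Bochner_Integration.integrable_diff[OF ints]])
      fix C :: "'a set set" assume C: "C \<in> sets wijsman_borel"
      let ?A = "saturation u C"
      note tr = transport_set_saturation[OF u C]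
      then have A[measurable]: "?A \<in> sets borel" by (simp add: transport_set_def)
      have vi: "vm_integral (vm_restrict \<mu> ?A) w = (\<integral>x. indicator ?A x * (w x \<bullet> ?h x) \<partial>?\<eta>)"
        if "w \<in> borel_measurable borel" for w
        by (rule vm_integral_restrict[OF vm A that])
      have "vm_integral (vm_restrict \<mu> ?A) v \<le> vm_integral (vm_restrict \<mu> ?A) u"
        using opt[OF tr] lip by (auto simp: optimal_potential_def is_arg_max_def not_less)
      moreover have "integrable ?\<eta> (\<lambda>x. indicator ?A x * (u x \<bullet> ?h x))" "integrable ?\<eta> (\<lambda>x. indicator ?A x * (v x \<bullet> ?h x))"
        using integrable_mult_indicator[OF _ ints(1), of ?A] integrable_mult_indicator[OF _ ints(2), of ?A] by simp_all
      ultimately have "0 \<le> (\<integral>x. indicator ?A x * (u x \<bullet> ?h x) - indicator ?A x * (v x \<bullet> ?h x) \<partial>?\<eta>)"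
        by (simp add: vi)
      also have "\<dots> = (\<integral>x. indicator C (?T x) * (u x \<bullet> ?h x - v x \<bullet> ?h x) \<partial>?\<eta>)"
        by (subst pull[OF C]) (measurable, simp add: right_diff_distrib)
      finally show "0 \<le> (\<integral>x. indicator C (?T x) * (u x \<bullet> ?h x - v x \<bullet> ?h x) \<partial>?\<eta>)" .
    qed
  qed
  moreover have "AE S in ?\<nu>. S \<in> space wijsman_borel"
    using AE_space[of ?\<nu>] by simp
  moreover note int_f[OF xh]
  ultimately show "AE S in ?\<nu>. integrable (\<kappa> S) ?h \<and> (\<integral>x. ?h x \<partial>\<kappa> S) = 0 \<and>
      optimal_potential (vm_density (\<kappa> S) ?h) u"
  proof eventually_elim
    case (elim S)
    let ?K = "\<kappa> S"
    have "prob_space ?K" and K: "sets ?K = sets borel"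
      using \<kappa> elim(4) by (simp_all add: disintegration_def)
    interpret prob_space ?K by fact
    have "integrable ?K (\<lambda>x. \<Sum>b\<in>Basis. (?h x \<bullet> b) *\<^sub>R b)"
      using elim(1) by (intro Bochner_Integration.integrable_sum integrable_scaleR_left) blast
    then have hK: "integrable ?K ?h"
      by (simp add: euclidean_representation)
    moreover have mean: "(\<integral>x. ?h x \<partial>?K) = 0"
    proof (rule euclidean_eqI)
      fix b :: 'b assume b: "b \<in> Basis"
      have "(\<integral>x. ?h x \<bullet> b \<partial>?K) = (\<integral>x. ?h x \<partial>?K) \<bullet> b"
        by (rule integral_inner_left) (rule hK)
      then show "(\<integral>x. ?h x \<partial>?K) \<bullet> b = 0 \<bullet> b"
        using elim(2) b by simp
    qed
    moreover have "optimal_potential (vm_density ?K ?h) u"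
    proof (rule optimal_potential_density[OF finite_measure_axioms K hK mean elim(5) u dense V(2)])
      fix v assume v: "v \<in> V"
      note int = integrable_lipschitz_inner_weighted[OF K hK elim(5)]
      show "(\<integral>x. v x \<bullet> ?h x \<partial>?K) \<le> (\<integral>x. u x \<bullet> ?h x \<partial>?K)"
        using elim(3) v Bochner_Integration.integral_diff[OF int[OF u] int[OF V(2)[OF v]]] by force
    qed
    ultimately show ?case by blast
  qed
qed

theorem theorem5:
  fixes \<mu> :: "(real ^ 'n) set \<Rightarrow> real ^ 'm"
    and u :: "real ^ 'n \<Rightarrow> real ^ 'm"
  assumes "CARD('m) \<le> CARD('n)"
    and "\<mu> \<in> W1_space"
    and "vm_absolutely_continuous lborel \<mu>"
    and "optimal_potential \<mu> u"
  shows "(\<forall>\<pi>. optimal_transport \<mu> \<pi> \<and>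
              absolutely_continuous (total_variation \<mu>) (distr (total_variation \<pi>) borel fst) \<longrightarrow>
            localises_to_transport_sets \<mu> u \<pi>)
       \<and> ((\<exists>\<pi>. optimal_transport \<mu> \<pi> \<and>
              absolutely_continuous (total_variation \<mu>) (distr (total_variation \<pi>) borel fst)) \<longrightarrow>
            (\<exists>\<pi>. optimal_transport \<mu> \<pi> \<and> localises_to_transport_sets \<mu> u \<pi>))
       \<and> ((\<exists>\<pi>. optimal_transport \<mu> \<pi> \<and> localises_to_transport_sets \<mu> u \<pi>) \<longrightarrow>
            localises_to_leaves \<mu> u)"
proof -
  have i: "localises_to_transport_sets \<mu> u \<pi>" if "optimal_transport \<mu> \<pi>"
    "absolutely_continuous (total_variation \<mu>) (distr (total_variation \<pi>) borel fst)" for \<pi>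
    by (rule optimal_transport_localises[OF assms(3,4) that])
  have lip: "1-lipschitz_on UNIV u"
    using assms(4) by (auto simp: optimal_potential_def is_arg_max_def)
  have ii: "localises_to_leaves \<mu> u" if "localises_to_transport_sets \<mu> u \<pi>" for \<pi>
    by (rule transport_sets_localise_to_leaves[OF assms(2,3) lip])
      (use that in \<open>simp_all add: localises_to_transport_sets_def\<close>)
  from i ii show ?thesis by blast
qed

end
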